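(* Let $x=(x_1,\dots,x_n)$, let $f$ be a vector of polynomials in $x$, let $P$ be a first-order real arithmetic formula written in normal form, and let a normal form of $\neg P$ be fixed. Then the formula $$\forall x\big(P\to\mathrm{Prog}_f(P)\big)\wedge\forall x\big(\neg P\to\mathrm{Prog}_{-f}(\neg P)\big)\;\leftrightarrow\;\forall x\big(P\to[x'=f(x)]P\big)$$ is derivable in the extended calculus $\mathcal{C}_1$.
   Context: A normal form is a formula $\bigvee_{i=0}^{M}\big(\bigwedge_{j=0}^{m(i)}p_{ij}\geq0\wedge\bigwedge_{j=0}^{n(i)}q_{ij}>0\big)$ with polynomials $p_{ij},q_{ij}$. Lie derivatives: $L_f(p)=\sum_i\frac{\partial p}{\partial x_i}f_i$, $L^0_f(p)=p$, $L^{i+1}_f(p)=L_f(L^i_f(p))$. The rank of $p$ (w.r.t. $f$) is the smallest $N\ge1$ with $L^N_f(p)=\sum_{i<N}g_iL^i_f(p)$ for some polynomials $g_i$. For $p$ of rank $N$: $\mathrm{Rad}_f(p)\equiv\bigwedge_{i=0}^{N-1}L^i_f(p)=0$; $\mathrm{Prog}_f^{>}(p)\equiv p\geq0\wedge\bigwedge_{k=1}^{N-2}\big(\bigwedge_{i=0}^{k-1}L^i_f(p)=0\to L^k_f(p)\geq0\big)\wedge\big(\bigwedge_{i=0}^{N-2}L^i_f(p)=0\to L^{N-1}_f(p)>0\big)$ (for $N=1$ this is $p>0$); $\mathrm{Prog}_f^{\geq}(p)\equiv\mathrm{Prog}_f^{>}(p)\vee\mathrm{Rad}_f(p)$. For a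 formula in the normal form above, $\mathrm{Prog}_f\equiv\bigvee_i\big(\bigwedge_j\mathrm{Prog}_f^{\geq}(p_{ij})\wedge\bigwedge_j\mathrm{Prog}_f^{>}(q_{ij})\big)$; $\mathrm{Prog}_{-f}$ is the same with Lie derivatives taken w.r.t. $x'=-f(x)$. Differential dynamic logic (dL): terms are polynomials with rational coefficients. Formulas are built from $e_1\sim e_2$ ($\sim\in\{=,\geq,>\}$) with $\neg,\wedge,\vee,\to,\leftrightarrow,\forall,\exists$ and modalities $[\alpha]\phi$, $\langle\alpha\rangle\phi$. Hybrid programs: $x:=e \mid\, ?\phi \mid x'=f(x)\,\&\,Q \mid \alpha\cup\beta \mid \alpha;\beta \mid \alpha^*$ ($x'=f(x)$ abbreviates $x'=f(x)\&\mathit{true}$). $(\omega,\nu)$ is a transition of $x'=f(x)\,\&\,Q$ iff there are $T\ge 0$ and a solution $\varphi:[0,T]\to$ states of $x'=f(x)$ (other variables constant) with $\varphi(0)=\omega$, $\varphi(T)=\nu$, $Q$ true along $\varphi$; $[\alpha]\phi$/$\langle\alpha\rangle\phi$: in all/some successors. A sequent $\Gamma\vdash\phi$ means $\bigwedge\Gamma\to\phi$. The base calculus $\mathcal{C}_0$: a classical sequent calculus for first-order logic (cut, weakening, connective rules, real witnesses for $\exists$) in which every valid formula of first-order real arithmetic is an axiom, plus all instances of: $\langle\alpha\rangle\phi\leftrightarrow\neg[\alpha]\neg\phi$; $[x:=e]\phi(x)\leftrightarrow\phi(e)$; $[?\psi]\phi\leftrightarrow(\psi\to\phi)$; $[\alpha\cup\beta]\phi\leftrightarrow[\alpha]\phi\wedge[\beta]\phi$;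 $[\alpha;\beta]\phi\leftrightarrow[\alpha][\beta]\phi$; $[\alpha^*]\phi\leftrightarrow\phi\wedge[\alpha][\alpha^*]\phi$; (K) $[\alpha](\phi\to\psi)\to([\alpha]\phi\to[\alpha]\psi)$; (I) $[\alpha^*]\phi\leftrightarrow\phi\wedge[\alpha^*](\phi\to[\alpha]\phi)$; (V) $\phi\to[\alpha]\phi$ if no free variable of $\phi$ is changed by $\alpha$; (G) from $\vdash\phi$ infer $\vdash[\alpha]\phi$; (DW) $[x'=f(x)\,\&\,Q]Q$; (DI, with Lie derivatives in place of differential terms) $(Q\to[x'=f(x)\,\&\,Q]L_f(p)\geq0)\to([x'=f(x)\,\&\,Q]p\succcurlyeq0\leftrightarrow(Q\to p\succcurlyeq0))$ for $\succcurlyeq\in\{\geq,>\}$, and the same with $=$; (DMP) $[x'=f(x)\,\&\,Q](Q\to R)\to([x'=f(x)\,\&\,R]\phi\to[x'=f(x)\,\&\,Q]\phi)$; (DG) $[x'=f(x)\,\&\,Q]\phi\leftrightarrow\exists y\,[x'=f(x),y'=a(x)y+b(x)\,\&\,Q]\phi$ for fresh $y$ and polynomial $a(x),b(x)$ not mentioning $y$; (B$'$) $\langle x'=f(x)\,\&\,Q\rangle\exists y\,\phi\leftrightarrow\exists y\,\langle x'=f(x)\,\&\,Q\rangle\phi$ for $y$ not among $x$. The extended calculus $\mathcal{C}_1$ is $\mathcal{C}_0$ plus all instances of the following axioms, where $y$ is a vector of fresh variables and, for (Cont) and (RI), the ODE contains an equation $x_1'=1$: (Uniq) $\langle x'=f(x)\&Q_1\rangle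 P_1\wedge\langle x'=f(x)\&Q_2\rangle P_2\to\langle x'=f(x)\&Q_1\wedge Q_2\rangle(P_1\vee P_2)$; (Cont) $x=y\to(p>0\to\langle x'=f(x)\&p>0\rangle x\neq y)$; (Dadj) $\langle x'=f(x)\&Q(x)\rangle x=y\leftrightarrow\langle y'=-f(y)\&Q(y)\rangle y=x$; (RI) $[x'=f(x)]P\leftrightarrow\forall y\,[x'=f(x)\&P\vee x=y](x=y\to P\wedge\langle x'=f(x)\&P\rangle x\neq y)$. *)

theory Defs
  imports Complex_Main "HOL-Library.Poly_Mapping"
begin

section \<open>Terms: polynomials with rational coefficients\<close>

type_synonym var = nat
type_synonym state = "var \<Rightarrow> real"

text \<open>A monomial maps each variable to its exponent, and a term maps each monomial to its
  coefficient.  Terms are thus elements of the polynomial ring over the rationals in countably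
  many variables, with the ring operations of \<^type>\<open>poly_mapping\<close>.\<close>

type_synonym trm = "(var \<Rightarrow>\<^sub>0 nat) \<Rightarrow>\<^sub>0 rat"

definition PVar :: "var \<Rightarrow> trm" where
  "PVar x = Poly_Mapping.single (Poly_Mapping.single x 1) 1"

definition PConst :: "rat \<Rightarrow> trm" where
  "PConst c = Poly_Mapping.single 0 c"

definition pvars :: "trm \<Rightarrow> var set" where
  "pvars p = (\<Union>m\<in>Poly_Mapping.keys p. Poly_Mapping.keys m)"

definition peval :: "state \<Rightarrow> trm \<Rightarrow> real" where
  "peval \<omega> p = (\<Sum>m\<in>Poly_Mapping.keys p. of_rat (Poly_Mapping.lookup p m) *
     (\<Prod>x\<in>Poly_Mapping.keys m. \<omega> x ^ Poly_Mapping.lookup m x))"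

definition psubst :: "(var \<Rightarrow> trm) \<Rightarrow> trm \<Rightarrow> trm" where
  "psubst \<sigma> p = (\<Sum>m\<in>Poly_Mapping.keys p. PConst (Poly_Mapping.lookup p m) *
     (\<Prod>x\<in>Poly_Mapping.keys m. \<sigma> x ^ Poly_Mapping.lookup m x))"

text \<open>Partial derivative.  Where \<open>x\<close> does not occur in \<open>m\<close> the truncated exponent is harmless,
  because the coefficient is 0.\<close>

definition pdiff :: "var \<Rightarrow> trm \<Rightarrow> trm" where
  "pdiff x p = (\<Sum>m\<in>Poly_Mapping.keys p.
     Poly_Mapping.single (m - Poly_Mapping.single x 1)
       (of_nat (Poly_Mapping.lookup m x) * Poly_Mapping.lookup p m))"


section \<open>Formulas and hybrid programs\<close>

text \<open>A system of differential equations is a list of pairs \<open>(x\<^sub>i, f\<^sub>i)\<close>.  Whenever the calculus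
  refers to a system, its left-hand sides are required to be distinct.\<close>

type_synonym ode = "(var \<times> trm) list"

datatype fml =
    Eq trm trm
  | Geq trm trm
  | Gt trm trm
  | Not fml
  | And fml fml
  | Or fml fml
  | Imp fml fml
  | Iff fml fml
  | Forall var fml
  | Exists var fml
  | Box prog fml
  | Dia prog fml
and prog =
    Assign var trm
  | Test fml
  | ODE ode fml
  | Choice prog prog
  | Seq prog prog
  | Loop prog

abbreviation TT :: fml where "TT \<equiv> Eq 0 0"
abbreviation FF :: fml where "FF \<equiv> Gt 0 0"

fun Conj :: "fml list \<Rightarrow> fml" where
  "Conj [] = TT"
| "Conj [\<phi>] = \<phi>"
| "Conj (\<phi> # \<psi> # \<Gamma>) = And \<phi> (Conj (\<psi> # \<Gamma>))"

fun Disj :: "fml list \<Rightarrow> fml" where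
  "Disj [] = FF"
| "Disj [\<phi>] = \<phi>"
| "Disj (\<phi> # \<psi> # \<Gamma>) = Or \<phi> (Disj (\<psi> # \<Gamma>))"

definition Foralls :: "var list \<Rightarrow> fml \<Rightarrow> fml" where
  "Foralls xs \<phi> = foldr Forall xs \<phi>"

definition VecEq :: "var list \<Rightarrow> var list \<Rightarrow> fml" where
  "VecEq xs ys = Conj (map (\<lambda>(x, y). Eq (PVar x) (PVar y)) (zip xs ys))"

abbreviation VecNeq :: "var list \<Rightarrow> var list \<Rightarrow> fml" where
  "VecNeq xs ys \<equiv> Not (VecEq xs ys)"

definition ode_vars :: "ode \<Rightarrow> var set" where
  "ode_vars F = fst ` set F"

definition wf_ode :: "ode \<Rightarrow> bool" where
  "wf_ode F \<longleftrightarrow> distinct (map fst F)"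

text \<open>First-order real arithmetic: no modalities.\<close>

primrec is_fol :: "fml \<Rightarrow> bool" where
  "is_fol (Eq a b) = True"
| "is_fol (Geq a b) = True"
| "is_fol (Gt a b) = True"
| "is_fol (Not \<phi>) = is_fol \<phi>"
| "is_fol (And \<phi> \<psi>) = (is_fol \<phi> \<and> is_fol \<psi>)"
| "is_fol (Or \<phi> \<psi>) = (is_fol \<phi> \<and> is_fol \<psi>)"
| "is_fol (Imp \<phi> \<psi>) = (is_fol \<phi> \<and> is_fol \<psi>)"
| "is_fol (Iff \<phi> \<psi>) = (is_fol \<phi> \<and> is_fol \<psi>)"
| "is_fol (Forall x \<phi>) = is_fol \<phi>"
| "is_fol (Exists x \<phi>) = is_fol \<phi>"
| "is_fol (Box \<alpha> \<phi>) = False"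
| "is_fol (Dia \<alpha> \<phi>) = False"


section \<open>Semantics\<close>

definition ode_solution :: "ode \<Rightarrow> real \<Rightarrow> (real \<Rightarrow> state) \<Rightarrow> bool" where
  "ode_solution F T \<phi> \<longleftrightarrow>
     (\<forall>t\<in>{0..T}.
        (\<forall>(x, f)\<in>set F. ((\<lambda>s. \<phi> s x) has_real_derivative peval (\<phi> t) f) (at t within {0..T})) \<and>
        (\<forall>z. z \<notin> ode_vars F \<longrightarrow> \<phi> t z = \<phi> 0 z))"

primrec fsem :: "fml \<Rightarrow> state set" and psem :: "prog \<Rightarrow> (state \<times> state) set" where
  "fsem (Eq a b) = {\<omega>. peval \<omega> a = peval \<omega> b}"
| "fsem (Geq a b) = {\<omega>. peval \<omega> a \<ge> peval \<omega> b}"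
| "fsem (Gt a b) = {\<omega>. peval \<omega> a > peval \<omega> b}"
| "fsem (Not \<phi>) = - fsem \<phi>"
| "fsem (And \<phi> \<psi>) = fsem \<phi> \<inter> fsem \<psi>"
| "fsem (Or \<phi> \<psi>) = fsem \<phi> \<union> fsem \<psi>"
| "fsem (Imp \<phi> \<psi>) = - fsem \<phi> \<union> fsem \<psi>"
| "fsem (Iff \<phi> \<psi>) = {\<omega>. \<omega> \<in> fsem \<phi> \<longleftrightarrow> \<omega> \<in> fsem \<psi>}"
| "fsem (Forall x \<phi>) = {\<omega>. \<forall>r. \<omega>(x := r) \<in> fsem \<phi>}"
| "fsem (Exists x \<phi>) = {\<omega>. \<exists>r. \<omega>(x := r) \<in> fsem \<phi>}"
| "fsem (Box \<alpha> \<phi>) = {\<omega>. \<forall>\<nu>. (\<omega>, \<nu>) \<in> psem \<alpha> \<longrightarrow> \<nu> \<in> fsem \<phi>}"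
| "fsem (Dia \<alpha> \<phi>) = {\<omega>. \<exists>\<nu>. (\<omega>, \<nu>) \<in> psem \<alpha> \<and> \<nu> \<in> fsem \<phi>}"
| "psem (Assign x e) = {(\<omega>, \<nu>). \<nu> = \<omega>(x := peval \<omega> e)}"
| "psem (Test \<psi>) = {(\<omega>, \<nu>). \<omega> = \<nu> \<and> \<omega> \<in> fsem \<psi>}"
| "psem (ODE F Q) = {(\<omega>, \<nu>). \<exists>T \<phi>. T \<ge> 0 \<and> \<phi> 0 = \<omega> \<and> \<phi> T = \<nu> \<and>
     ode_solution F T \<phi> \<and> (\<forall>t\<in>{0..T}. \<phi> t \<in> fsem Q)}"
| "psem (Choice \<alpha> \<beta>) = psem \<alpha> \<union> psem \<beta>"
| "psem (Seq \<alpha> \<beta>) = psem \<alpha> O psem \<beta>"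
| "psem (Loop \<alpha>) = (psem \<alpha>)\<^sup>*"

definition valid :: "fml \<Rightarrow> bool" where
  "valid \<phi> \<longleftrightarrow> (\<forall>\<omega>. \<omega> \<in> fsem \<phi>)"


section \<open>Bound and free variables\<close>

text \<open>\<open>BV \<alpha>\<close>: variables that \<open>\<alpha>\<close> may change.  \<open>MBV \<alpha>\<close>: variables that \<open>\<alpha>\<close> binds on every run,
  so that their initial value is not visible to a subsequent formula or program.\<close>

primrec BV :: "prog \<Rightarrow> var set" where
  "BV (Assign x e) = {x}"
| "BV (Test \<psi>) = {}"
| "BV (ODE F Q) = ode_vars F"
| "BV (Choice \<alpha> \<beta>) = BV \<alpha> \<union> BV \<beta>"
| "BV (Seq \<alpha> \<beta>) = BV \<alpha> \<union> BV \<beta>"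
| "BV (Loop \<alpha>) = BV \<alpha>"

primrec MBV :: "prog \<Rightarrow> var set" where
  "MBV (Assign x e) = {x}"
| "MBV (Test \<psi>) = {}"
| "MBV (ODE F Q) = ode_vars F"
| "MBV (Choice \<alpha> \<beta>) = MBV \<alpha> \<inter> MBV \<beta>"
| "MBV (Seq \<alpha> \<beta>) = MBV \<alpha> \<union> MBV \<beta>"
| "MBV (Loop \<alpha>) = {}"

primrec FV :: "fml \<Rightarrow> var set" and FVp :: "prog \<Rightarrow> var set" where
  "FV (Eq a b) = pvars a \<union> pvars b"
| "FV (Geq a b) = pvars a \<union> pvars b"
| "FV (Gt a b) = pvars a \<union> pvars b"
| "FV (Not \<phi>) = FV \<phi>"
| "FV (And \<phi> \<psi>) = FV \<phi> \<union> FV \<psi>"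
| "FV (Or \<phi> \<psi>) = FV \<phi> \<union> FV \<psi>"
| "FV (Imp \<phi> \<psi>) = FV \<phi> \<union> FV \<psi>"
| "FV (Iff \<phi> \<psi>) = FV \<phi> \<union> FV \<psi>"
| "FV (Forall x \<phi>) = FV \<phi> - {x}"
| "FV (Exists x \<phi>) = FV \<phi> - {x}"
| "FV (Box \<alpha> \<phi>) = FVp \<alpha> \<union> (FV \<phi> - MBV \<alpha>)"
| "FV (Dia \<alpha> \<phi>) = FVp \<alpha> \<union> (FV \<phi> - MBV \<alpha>)"
| "FVp (Assign x e) = pvars e"
| "FVp (Test \<psi>) = FV \<psi>"
| "FVp (ODE F Q) = ode_vars F \<union> (\<Union>(x, f)\<in>set F. pvars f) \<union> FV Q"
| "FVp (Choice \<alpha> \<beta>) = FVp \<alpha> \<union> FVp \<beta>"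
| "FVp (Seq \<alpha> \<beta>) = FVp \<alpha> \<union> (FVp \<beta> - MBV \<alpha>)"
| "FVp (Loop \<alpha>) = FVp \<alpha>"

definition FVs :: "fml list \<Rightarrow> var set" where
  "FVs \<Gamma> = (\<Union>\<phi>\<in>set \<Gamma>. FV \<phi>)"


section \<open>Admissible substitution\<close>

text \<open>Simultaneous substitution of terms for free variables.  \<open>fsub\<close> and \<open>psub\<close> stop at binders
  and never rename; \<open>fadm\<close> and \<open>padm\<close> are the side conditions under which the result is the intended
  \<open>\<phi>(e)\<close>.  A variable is replaced only if \<open>\<sigma>\<close> moves it, that is, \<open>\<sigma> x\<close> differs from \<open>PVar x\<close>.

  \<open>safe \<sigma> S B\<close>: for the variables \<open>S\<close> that are free under a binder for \<open>B\<close>, no moved variable is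
  itself (possibly) bound, and no replacement is captured.\<close>

definition drop_vars :: "var set \<Rightarrow> (var \<Rightarrow> trm) \<Rightarrow> var \<Rightarrow> trm" where
  "drop_vars B \<sigma> = (\<lambda>x. if x \<in> B then PVar x else \<sigma> x)"

definition safe :: "(var \<Rightarrow> trm) \<Rightarrow> var set \<Rightarrow> var set \<Rightarrow> bool" where
  "safe \<sigma> S B \<longleftrightarrow> (\<forall>x\<in>S. \<sigma> x \<noteq> PVar x \<longrightarrow> x \<notin> B \<and> pvars (\<sigma> x) \<inter> B = {})"

primrec fsub :: "fml \<Rightarrow> (var \<Rightarrow> trm) \<Rightarrow> fml" and psub :: "prog \<Rightarrow> (var \<Rightarrow> trm) \<Rightarrow> prog" where
  "fsub (Eq a b) \<sigma> = Eq (psubst \<sigma> a) (psubst \<sigma> b)"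
| "fsub (Geq a b) \<sigma> = Geq (psubst \<sigma> a) (psubst \<sigma> b)"
| "fsub (Gt a b) \<sigma> = Gt (psubst \<sigma> a) (psubst \<sigma> b)"
| "fsub (Not \<phi>) \<sigma> = Not (fsub \<phi> \<sigma>)"
| "fsub (And \<phi> \<psi>) \<sigma> = And (fsub \<phi> \<sigma>) (fsub \<psi> \<sigma>)"
| "fsub (Or \<phi> \<psi>) \<sigma> = Or (fsub \<phi> \<sigma>) (fsub \<psi> \<sigma>)"
| "fsub (Imp \<phi> \<psi>) \<sigma> = Imp (fsub \<phi> \<sigma>) (fsub \<psi> \<sigma>)"
| "fsub (Iff \<phi> \<psi>) \<sigma> = Iff (fsub \<phi> \<sigma>) (fsub \<psi> \<sigma>)"
| "fsub (Forall x \<phi>) \<sigma> = Forall x (fsub \<phi> (drop_vars {x} \<sigma>))"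
| "fsub (Exists x \<phi>) \<sigma> = Exists x (fsub \<phi> (drop_vars {x} \<sigma>))"
| "fsub (Box \<alpha> \<phi>) \<sigma> = Box (psub \<alpha> \<sigma>) (fsub \<phi> (drop_vars (BV \<alpha>) \<sigma>))"
| "fsub (Dia \<alpha> \<phi>) \<sigma> = Dia (psub \<alpha> \<sigma>) (fsub \<phi> (drop_vars (BV \<alpha>) \<sigma>))"
| "psub (Assign x e) \<sigma> = Assign x (psubst \<sigma> e)"
| "psub (Test \<psi>) \<sigma> = Test (fsub \<psi> \<sigma>)"
| "psub (ODE F Q) \<sigma> = ODE (map (\<lambda>(x, f). (x, psubst (drop_vars (ode_vars F) \<sigma>) f)) F)
     (fsub Q (drop_vars (ode_vars F) \<sigma>))"
| "psub (Choice \<alpha> \<beta>) \<sigma> = Choice (psub \<alpha> \<sigma>) (psub \<beta> \<sigma>)"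
| "psub (Seq \<alpha> \<beta>) \<sigma> = Seq (psub \<alpha> \<sigma>) (psub \<beta> (drop_vars (BV \<alpha>) \<sigma>))"
| "psub (Loop \<alpha>) \<sigma> = Loop (psub \<alpha> (drop_vars (BV \<alpha>) \<sigma>))"

primrec fadm :: "fml \<Rightarrow> (var \<Rightarrow> trm) \<Rightarrow> bool" and padm :: "prog \<Rightarrow> (var \<Rightarrow> trm) \<Rightarrow> bool" where
  "fadm (Eq a b) \<sigma> = True"
| "fadm (Geq a b) \<sigma> = True"
| "fadm (Gt a b) \<sigma> = True"
| "fadm (Not \<phi>) \<sigma> = fadm \<phi> \<sigma>"
| "fadm (And \<phi> \<psi>) \<sigma> = (fadm \<phi> \<sigma> \<and> fadm \<psi> \<sigma>)"
| "fadm (Or \<phi> \<psi>) \<sigma> = (fadm \<phi> \<sigma> \<and> fadm \<psi> \<sigma>)"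
| "fadm (Imp \<phi> \<psi>) \<sigma> = (fadm \<phi> \<sigma> \<and> fadm \<psi> \<sigma>)"
| "fadm (Iff \<phi> \<psi>) \<sigma> = (fadm \<phi> \<sigma> \<and> fadm \<psi> \<sigma>)"
| "fadm (Forall x \<phi>) \<sigma> = (safe \<sigma> (FV \<phi> - {x}) {x} \<and> fadm \<phi> (drop_vars {x} \<sigma>))"
| "fadm (Exists x \<phi>) \<sigma> = (safe \<sigma> (FV \<phi> - {x}) {x} \<and> fadm \<phi> (drop_vars {x} \<sigma>))"
| "fadm (Box \<alpha> \<phi>) \<sigma> =
     (padm \<alpha> \<sigma> \<and> safe \<sigma> (FV \<phi> - MBV \<alpha>) (BV \<alpha>) \<and> fadm \<phi> (drop_vars (BV \<alpha>) \<sigma>))"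
| "fadm (Dia \<alpha> \<phi>) \<sigma> =
     (padm \<alpha> \<sigma> \<and> safe \<sigma> (FV \<phi> - MBV \<alpha>) (BV \<alpha>) \<and> fadm \<phi> (drop_vars (BV \<alpha>) \<sigma>))"
| "padm (Assign x e) \<sigma> = True"
| "padm (Test \<psi>) \<sigma> = fadm \<psi> \<sigma>"
| "padm (ODE F Q) \<sigma> =
     (safe \<sigma> (FVp (ODE F Q)) (ode_vars F) \<and> fadm Q (drop_vars (ode_vars F) \<sigma>))"
| "padm (Choice \<alpha> \<beta>) \<sigma> = (padm \<alpha> \<sigma> \<and> padm \<beta> \<sigma>)"
| "padm (Seq \<alpha> \<beta>) \<sigma> =
     (padm \<alpha> \<sigma> \<and> safe \<sigma> (FVp \<beta> - MBV \<alpha>) (BV \<alpha>) \<and> padm \<beta> (drop_vars (BV \<alpha>) \<sigma>))"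
| "padm (Loop \<alpha>) \<sigma> = (safe \<sigma> (FVp \<alpha>) (BV \<alpha>) \<and> padm \<alpha> (drop_vars (BV \<alpha>) \<sigma>))"

definition sub1 :: "var \<Rightarrow> trm \<Rightarrow> var \<Rightarrow> trm" where
  "sub1 x e = PVar(x := e)"

definition subvec :: "var list \<Rightarrow> var list \<Rightarrow> var \<Rightarrow> trm" where
  "subvec xs ys = (\<lambda>z. case map_of (zip xs ys) z of None \<Rightarrow> PVar z | Some y \<Rightarrow> PVar y)"


section \<open>Lie derivatives, rank, and progress formulas\<close>

definition lie :: "ode \<Rightarrow> trm \<Rightarrow> trm" where
  "lie F p = (\<Sum>(x, f)\<leftarrow>F. pdiff x p * f)"

definition lie_pow :: "ode \<Rightarrow> nat \<Rightarrow> trm \<Rightarrow> trm" where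
  "lie_pow F i p = (lie F ^^ i) p"

definition rank :: "ode \<Rightarrow> trm \<Rightarrow> nat" where
  "rank F p = (LEAST N. N \<ge> 1 \<and>
     (\<exists>g :: nat \<Rightarrow> trm. lie_pow F N p = (\<Sum>i<N. g i * lie_pow F i p)))"

text \<open>\<open>lie_zero F n p\<close> says that \<open>L\<^sup>i(p) = 0\<close> for all \<open>i < n\<close>.\<close>

definition lie_zero :: "ode \<Rightarrow> nat \<Rightarrow> trm \<Rightarrow> fml" where
  "lie_zero F n p = Conj (map (\<lambda>i. Eq (lie_pow F i p) 0) [0..<n])"

definition Rad :: "ode \<Rightarrow> trm \<Rightarrow> fml" where
  "Rad F p = lie_zero F (rank F p) p"

definition Prog_gt :: "ode \<Rightarrow> trm \<Rightarrow> fml" where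
  "Prog_gt F p = (let N = rank F p in
     if N = 1 then Gt p 0
     else Conj ([Geq p 0]
       @ map (\<lambda>k. Imp (lie_zero F k p) (Geq (lie_pow F k p) 0)) [1..<N - 1]
       @ [Imp (lie_zero F (N - 1) p) (Gt (lie_pow F (N - 1) p) 0)]))"

definition Prog_ge :: "ode \<Rightarrow> trm \<Rightarrow> fml" where
  "Prog_ge F p = Or (Prog_gt F p) (Rad F p)"

text \<open>A normal form is the list of its disjuncts, each given by the polynomials \<open>p\<close> with
  \<open>p \<ge> 0\<close> and the polynomials \<open>q\<close> with \<open>q > 0\<close>.\<close>

type_synonym nform = "(trm list \<times> trm list) list"

definition nf_fml :: "nform \<Rightarrow> fml" where
  "nf_fml P = Disj (map (\<lambda>(ps, qs).
     And (Conj (map (\<lambda>p. Geq p 0) ps)) (Conj (map (\<lambda>q. Gt q 0) qs))) P)"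

definition Prog :: "ode \<Rightarrow> nform \<Rightarrow> fml" where
  "Prog F P = Disj (map (\<lambda>(ps, qs).
     And (Conj (map (Prog_ge F) ps)) (Conj (map (Prog_gt F) qs))) P)"


section \<open>The axioms\<close>

inductive axiom0 :: "fml \<Rightarrow> bool" where
  Arith: "is_fol \<phi> \<Longrightarrow> valid \<phi> \<Longrightarrow> axiom0 \<phi>"
| Diamond: "axiom0 (Iff (Dia \<alpha> \<phi>) (Not (Box \<alpha> (Not \<phi>))))"
| AssignB: "fadm \<phi> (sub1 x e) \<Longrightarrow> axiom0 (Iff (Box (Assign x e) \<phi>) (fsub \<phi> (sub1 x e)))"
| TestB: "axiom0 (Iff (Box (Test \<psi>) \<phi>) (Imp \<psi> \<phi>))"
| ChoiceB: "axiom0 (Iff (Box (Choice \<alpha> \<beta>) \<phi>) (And (Box \<alpha> \<phi>) (Box \<beta> \<phi>)))"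
| SeqB: "axiom0 (Iff (Box (Seq \<alpha> \<beta>) \<phi>) (Box \<alpha> (Box \<beta> \<phi>)))"
| IterateB: "axiom0 (Iff (Box (Loop \<alpha>) \<phi>) (And \<phi> (Box \<alpha> (Box (Loop \<alpha>) \<phi>))))"
| K: "axiom0 (Imp (Box \<alpha> (Imp \<phi> \<psi>)) (Imp (Box \<alpha> \<phi>) (Box \<alpha> \<psi>)))"
| I: "axiom0 (Iff (Box (Loop \<alpha>) \<phi>) (And \<phi> (Box (Loop \<alpha>) (Imp \<phi> (Box \<alpha> \<phi>)))))"
| V: "FV \<phi> \<inter> BV \<alpha> = {} \<Longrightarrow> axiom0 (Imp \<phi> (Box \<alpha> \<phi>))"
| DW: "wf_ode F \<Longrightarrow> axiom0 (Box (ODE F Q) Q)"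
| DIgeq: "wf_ode F \<Longrightarrow>
    axiom0 (Imp (Imp Q (Box (ODE F Q) (Geq (lie F p) 0)))
                (Iff (Box (ODE F Q) (Geq p 0)) (Imp Q (Geq p 0))))"
| DIgt: "wf_ode F \<Longrightarrow>
    axiom0 (Imp (Imp Q (Box (ODE F Q) (Geq (lie F p) 0)))
                (Iff (Box (ODE F Q) (Gt p 0)) (Imp Q (Gt p 0))))"
| DIeq: "wf_ode F \<Longrightarrow>
    axiom0 (Imp (Imp Q (Box (ODE F Q) (Eq (lie F p) 0)))
                (Iff (Box (ODE F Q) (Eq p 0)) (Imp Q (Eq p 0))))"
| DMP: "wf_ode F \<Longrightarrow>
    axiom0 (Imp (Box (ODE F Q) (Imp Q R)) (Imp (Box (ODE F R) \<phi>) (Box (ODE F Q) \<phi>)))"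
| DG: "wf_ode F \<Longrightarrow> y \<notin> FVp (ODE F Q) \<union> FV \<phi> \<union> pvars a \<union> pvars b \<Longrightarrow>
    axiom0 (Iff (Box (ODE F Q) \<phi>) (Exists y (Box (ODE (F @ [(y, a * PVar y + b)]) Q) \<phi>)))"
| BarcanD: "wf_ode F \<Longrightarrow> y \<notin> FVp (ODE F Q) \<Longrightarrow>
    axiom0 (Iff (Dia (ODE F Q) (Exists y \<phi>)) (Exists y (Dia (ODE F Q) \<phi>)))"

definition has_clock :: "ode \<Rightarrow> bool" where
  "has_clock F \<longleftrightarrow> (\<exists>x. (x, 1) \<in> set F)"

definition fresh_vec :: "var list \<Rightarrow> ode \<Rightarrow> fml \<Rightarrow> bool" where
  "fresh_vec ys F Q \<longleftrightarrow> distinct ys \<and> length ys = length F \<and> set ys \<inter> FVp (ODE F Q) = {}"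

text \<open>The system \<open>y' = - f(y)\<close> obtained from \<open>x' = f(x)\<close>.\<close>

definition reverse_ode :: "ode \<Rightarrow> var list \<Rightarrow> ode" where
  "reverse_ode F ys = zip ys (map (\<lambda>(x, f). - psubst (subvec (map fst F) ys) f) F)"

inductive axiom1 :: "fml \<Rightarrow> bool" where
  Base: "axiom0 \<phi> \<Longrightarrow> axiom1 \<phi>"
| Uniq: "wf_ode F \<Longrightarrow>
    axiom1 (Imp (And (Dia (ODE F Q1) P1) (Dia (ODE F Q2) P2))
                (Dia (ODE F (And Q1 Q2)) (Or P1 P2)))"
| Cont: "wf_ode F \<Longrightarrow> has_clock F \<Longrightarrow> xs = map fst F \<Longrightarrow> fresh_vec ys F (Gt p 0) \<Longrightarrow>
    axiom1 (Imp (VecEq xs ys) (Imp (Gt p 0) (Dia (ODE F (Gt p 0)) (VecNeq xs ys))))"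
| Dadj: "wf_ode F \<Longrightarrow> xs = map fst F \<Longrightarrow> fresh_vec ys F Q \<Longrightarrow> fadm Q (subvec xs ys) \<Longrightarrow>
    axiom1 (Iff (Dia (ODE F Q) (VecEq xs ys))
                (Dia (ODE (reverse_ode F ys) (fsub Q (subvec xs ys))) (VecEq ys xs)))"
| RI: "wf_ode F \<Longrightarrow> has_clock F \<Longrightarrow> xs = map fst F \<Longrightarrow> fresh_vec ys F P \<Longrightarrow>
    axiom1 (Iff (Box (ODE F TT) P)
                (Foralls ys (Box (ODE F (Or P (VecEq xs ys)))
                   (Imp (VecEq xs ys) (And P (Dia (ODE F P) (VecNeq xs ys)))))))"


section \<open>The sequent calculus\<close>

text \<open>\<open>derives Ax \<Gamma> \<phi>\<close>: the sequent with antecedent \<open>\<Gamma>\<close> and succedent \<open>\<phi>\<close> is derivable from the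
  axioms \<open>Ax\<close>.  \<open>Weaken\<close> includes exchange and contraction.\<close>

inductive derives :: "(fml \<Rightarrow> bool) \<Rightarrow> fml list \<Rightarrow> fml \<Rightarrow> bool" for Ax where
  Axiom: "Ax \<phi> \<Longrightarrow> derives Ax [] \<phi>"
| Id: "derives Ax [\<phi>] \<phi>"
| Weaken: "derives Ax \<Gamma> \<phi> \<Longrightarrow> set \<Gamma> \<subseteq> set \<Delta> \<Longrightarrow> derives Ax \<Delta> \<phi>"
| Cut: "derives Ax \<Gamma> \<phi> \<Longrightarrow> derives Ax (\<phi> # \<Gamma>) \<psi> \<Longrightarrow> derives Ax \<Gamma> \<psi>"
| Classical: "derives Ax (Not \<phi> # \<Gamma>) \<phi> \<Longrightarrow> derives Ax \<Gamma> \<phi>"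
| NotR: "derives Ax (\<phi> # \<Gamma>) FF \<Longrightarrow> derives Ax \<Gamma> (Not \<phi>)"
| NotL: "derives Ax \<Gamma> \<phi> \<Longrightarrow> derives Ax (Not \<phi> # \<Gamma>) \<psi>"
| AndR: "derives Ax \<Gamma> \<phi> \<Longrightarrow> derives Ax \<Gamma> \<psi> \<Longrightarrow> derives Ax \<Gamma> (And \<phi> \<psi>)"
| AndL: "derives Ax (\<phi> # \<psi> # \<Gamma>) \<chi> \<Longrightarrow> derives Ax (And \<phi> \<psi> # \<Gamma>) \<chi>"
| OrR1: "derives Ax \<Gamma> \<phi> \<Longrightarrow> derives Ax \<Gamma> (Or \<phi> \<psi>)"
| OrR2: "derives Ax \<Gamma> \<psi> \<Longrightarrow> derives Ax \<Gamma> (Or \<phi> \<psi>)"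
| OrL: "derives Ax (\<phi> # \<Gamma>) \<chi> \<Longrightarrow> derives Ax (\<psi> # \<Gamma>) \<chi> \<Longrightarrow> derives Ax (Or \<phi> \<psi> # \<Gamma>) \<chi>"
| ImpR: "derives Ax (\<phi> # \<Gamma>) \<psi> \<Longrightarrow> derives Ax \<Gamma> (Imp \<phi> \<psi>)"
| ImpL: "derives Ax \<Gamma> \<phi> \<Longrightarrow> derives Ax (\<psi> # \<Gamma>) \<chi> \<Longrightarrow> derives Ax (Imp \<phi> \<psi> # \<Gamma>) \<chi>"
| IffR: "derives Ax (\<phi> # \<Gamma>) \<psi> \<Longrightarrow> derives Ax (\<psi> # \<Gamma>) \<phi> \<Longrightarrow> derives Ax \<Gamma> (Iff \<phi> \<psi>)"
| IffL: "derives Ax (Imp \<phi> \<psi> # Imp \<psi> \<phi> # \<Gamma>) \<chi> \<Longrightarrow> derives Ax (Iff \<phi> \<psi> # \<Gamma>) \<chi>"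
| ForallR: "fadm \<phi> (sub1 x (PVar y)) \<Longrightarrow> y \<notin> FVs \<Gamma> \<union> FV (Forall x \<phi>) \<Longrightarrow>
    derives Ax \<Gamma> (fsub \<phi> (sub1 x (PVar y))) \<Longrightarrow> derives Ax \<Gamma> (Forall x \<phi>)"
| ForallL: "fadm \<phi> (sub1 x e) \<Longrightarrow>
    derives Ax (fsub \<phi> (sub1 x e) # \<Gamma>) \<psi> \<Longrightarrow> derives Ax (Forall x \<phi> # \<Gamma>) \<psi>"
| ExistsR: "fadm \<phi> (sub1 x e) \<Longrightarrow>
    derives Ax \<Gamma> (fsub \<phi> (sub1 x e)) \<Longrightarrow> derives Ax \<Gamma> (Exists x \<phi>)"
| ExistsL: "fadm \<phi> (sub1 x (PVar y)) \<Longrightarrow> y \<notin> FVs \<Gamma> \<union> FV (Exists x \<phi>) \<union> FV \<psi> \<Longrightarrow>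
    derives Ax (fsub \<phi> (sub1 x (PVar y)) # \<Gamma>) \<psi> \<Longrightarrow> derives Ax (Exists x \<phi> # \<Gamma>) \<psi>"
| G: "derives Ax [] \<phi> \<Longrightarrow> derives Ax [] (Box \<alpha> \<phi>)"

definition derivable_C0 :: "fml \<Rightarrow> bool" where
  "derivable_C0 \<phi> \<longleftrightarrow> derives axiom0 [] \<phi>"

definition derivable_C1 :: "fml \<Rightarrow> bool" where
  "derivable_C1 \<phi> \<longleftrightarrow> derives axiom1 [] \<phi>"

end

theory Submission
  imports Defs
begin

text \<open>
  Along a system with a clock, (Cont) makes \<open>p > 0\<close> hold for a while if it holds initially, and
  differential induction lifts this from the first nonvanishing Lie derivative of \<open>p\<close> down to
  \<open>p \<ge> 0\<close>; if all Lie derivatives below the rank vanish, \<open>p = 0\<close> is a Darboux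
  invariant.  With (Uniq) for conjunctions, \<open>Prog\<close> thus implies local progress into \<open>P\<close>, and
  \<open>\<not> Prog\<close> implies local progress into \<open>\<not> P\<close>, so the flow leaves \<open>P\<close>.  The latter applied to
  \<open>f\<close> and to \<open>-f\<close>, with (Dadj) to turn a run backwards, shows that the progress conditions are
  necessary.  For sufficiency, (RI) asks that \<open>P\<close> makes local progress, which is the first condition, and
  that a run within \<open>P\<close> cannot end outside \<open>P\<close>: otherwise the reversed run starts outside \<open>P\<close>,
  makes local progress in \<open>\<not> P\<close> by the second condition and at the same time runs within
  \<open>P\<close>, contradicting (Uniq).
\<close>

section \<open>Polynomials and Lie derivatives\<close>

text \<open>Derivability is a syntactic goal, and (Cont), (RI) and (Dadj) speak about copies of the
  state vector; two devices make this manageable. Propositional and modal steps are checked in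
  maximal consistent valuations of all formulas, where first-order facts enter as valid arithmetic
  axioms; sequents remain for the rules with side conditions. Facts about an endpoint of a run are
  restated in a fresh copy of the state vector, since such formulas are constant along the run and
  can be carried through every modality. A rank is defined as a least number, so its existence has
  to be proved: it is the Hilbert basis theorem for the sequence of Lie derivatives, which share
  finitely many variables. Ranks refer to the given system, whereas (Cont) and (RI) need clocks. The
  clocks are chosen outside the polynomials, so that the Lie derivatives, and with them the relation
  at the rank, carry over to the clocked system. (Dadj) reverses a flow but also moves it to another
  vector, so a run is reversed by three uses along a cycle of vectors.\<close>

lemma poly_mapping_expansion:
  fixes p :: "'a \<Rightarrow>\<^sub>0 'b::comm_monoid_add"
  shows "p = (\<Sum>m\<in>Poly_Mapping.keys p. Poly_Mapping.single m (Poly_Mapping.lookup p m))"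
proof (rule poly_mapping_eqI)
  fix k
  have "Poly_Mapping.lookup (\<Sum>m\<in>Poly_Mapping.keys p. Poly_Mapping.single m (Poly_Mapping.lookup p m)) k
     = (\<Sum>m\<in>Poly_Mapping.keys p. if m = k then Poly_Mapping.lookup p m else 0)"
    by (simp add: lookup_sum lookup_single when_def)
  also have "\<dots> = Poly_Mapping.lookup p k"
    by (simp add: sum.delta in_keys_iff)
  finally show "Poly_Mapping.lookup p k = Poly_Mapping.lookup
      (\<Sum>m\<in>Poly_Mapping.keys p. Poly_Mapping.single m (Poly_Mapping.lookup p m)) k" ..
qed

lemma poly_mapping_single_add_induct [case_names single add]:
  fixes p :: "'a \<Rightarrow>\<^sub>0 'b::comm_monoid_add"
  assumes single: "\<And>m c. P (Poly_Mapping.single m c)"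
    and add: "\<And>p q. P p \<Longrightarrow> P q \<Longrightarrow> P (p + q)"
  shows "P p"
proof -
  have "P (\<Sum>m\<in>A. Poly_Mapping.single m (Poly_Mapping.lookup p m))" if "finite A" for A
    using that
  proof (induction A)
    case empty
    \<comment> \<open>The empty sum is \<open>single m 0\<close> for an arbitrary
      \<open>m\<close>.\<close>
    show ?case using single[of undefined 0] by simp
  next
    case (insert m A)
    then show ?case by (simp add: single add)
  qed
  then show ?thesis by (metis poly_mapping_expansion finite_keys)
qed

section \<open>Evaluation of monomials and polynomials\<close>

definition meval :: "(var \<Rightarrow> 'a::comm_semiring_1) \<Rightarrow> (var \<Rightarrow>\<^sub>0 nat) \<Rightarrow> 'a" where
  "meval \<sigma> m = (\<Prod>x\<in>Poly_Mapping.keys m. \<sigma> x ^ Poly_Mapping.lookup m x)"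

lemma meval_superset:
  assumes "finite V" "Poly_Mapping.keys m \<subseteq> V"
  shows "meval \<sigma> m = (\<Prod>x\<in>V. \<sigma> x ^ Poly_Mapping.lookup m x)"
  unfolding meval_def
  by (rule prod.mono_neutral_left) (use assms in \<open>auto simp: in_keys_iff\<close>)

lemma meval_add: "meval \<sigma> (m + n) = meval \<sigma> m * meval \<sigma> n"
proof -
  let ?V = "Poly_Mapping.keys m \<union> Poly_Mapping.keys n"
  have "meval \<sigma> (m + n) = (\<Prod>x\<in>?V. \<sigma> x ^ Poly_Mapping.lookup (m + n) x)"
    by (rule meval_superset) (auto simp: keys_add)
  also have "\<dots> = (\<Prod>x\<in>?V. \<sigma> x ^ Poly_Mapping.lookup m x) * (\<Prod>x\<in>?V. \<sigma> x ^ Poly_Mapping.lookup n x)"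
    by (simp add: lookup_add power_add prod.distrib)
  also have "\<dots> = meval \<sigma> m * meval \<sigma> n"
    by (subst (1 2) meval_superset[where V = ?V]) auto
  finally show ?thesis .
qed

text \<open>Real evaluation and substitution of terms both extend a ring homomorphism on the
  coefficients by values for the variables. One set of laws thus covers \<open>peval\<close>, with
  \<open>of_rat\<close>, and \<open>psubst\<close>, with \<open>PConst\<close>.\<close>

locale rat_coeff_hom =
  fixes h :: "rat \<Rightarrow> 'a::comm_ring_1"
  assumes h_add: "h (a + b) = h a + h b" and h_mult: "h (a * b) = h a * h b" and h_1: "h 1 = 1"
begin

definition pev :: "(var \<Rightarrow> 'a) \<Rightarrow> trm \<Rightarrow> 'a" where
  "pev \<sigma> p = (\<Sum>m\<in>Poly_Mapping.keys p. h (Poly_Mapping.lookup p m) * meval \<sigma> m)"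

lemma h_0: "h 0 = 0"
  using h_add[of 0 0] by simp

lemma pev_0: "pev \<sigma> 0 = 0"
  by (simp add: pev_def)

lemma pev_single: "pev \<sigma> (Poly_Mapping.single m c) = h c * meval \<sigma> m"
  by (cases "c = 0") (simp_all add: pev_def h_0)

lemma pev_add: "pev \<sigma> (p + q) = pev \<sigma> p + pev \<sigma> q"
  unfolding pev_def
  by (rule setsum_keys_plus_distrib) (simp_all add: h_0 h_add distrib_right)

lemma pev_mult: "pev \<sigma> (p * q) = pev \<sigma> p * pev \<sigma> q"
proof (induction p rule: poly_mapping_single_add_induct)
  case (single m c)
  show ?case
    by (induction q rule: poly_mapping_single_add_induct)
       (simp_all add: mult_single pev_single pev_add meval_add h_mult algebra_simps)
qed (simp add: pev_add algebra_simps)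

lemma pev_1: "pev \<sigma> 1 = 1"
  by (simp add: pev_single h_1 meval_def flip: single_one)

lemma pev_uminus: "pev \<sigma> (- p) = - pev \<sigma> p"
  using pev_add[of \<sigma> p "- p"] by (simp add: pev_0 eq_neg_iff_add_eq_0 add.commute)

lemma pev_diff: "pev \<sigma> (p - q) = pev \<sigma> p - pev \<sigma> q"
  using pev_add[of \<sigma> p "- q"] by (simp add: pev_uminus)

lemma pev_sum: "pev \<sigma> (sum f A) = (\<Sum>i\<in>A. pev \<sigma> (f i))"
  by (induction A rule: infinite_finite_induct) (simp_all add: pev_0 pev_add)

lemma pev_prod: "pev \<sigma> (prod f A) = (\<Prod>i\<in>A. pev \<sigma> (f i))"
  by (induction A rule: infinite_finite_induct) (simp_all add: pev_1 pev_mult)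

lemma pev_power: "pev \<sigma> (p ^ n) = pev \<sigma> p ^ n"
  by (induction n) (simp_all add: pev_1 pev_mult)

lemma pev_PVar: "pev \<sigma> (PVar x) = \<sigma> x"
  by (simp add: PVar_def pev_single h_1 meval_def)

lemma pev_PConst: "pev \<sigma> (PConst c) = h c"
  by (simp add: PConst_def pev_single meval_def)

lemma pev_of_nat: "pev \<sigma> (of_nat n) = of_nat n"
  by (induction n) (simp_all add: pev_0 pev_1 pev_add)

lemma pev_numeral: "pev \<sigma> (numeral n) = numeral n"
  using pev_of_nat[of \<sigma> "numeral n"] by simp

lemma pev_cong: "(\<And>x. x \<in> pvars p \<Longrightarrow> \<sigma> x = \<tau> x) \<Longrightarrow> pev \<sigma> p = pev \<tau> p"
  unfolding pev_def meval_def pvars_def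
  by (intro sum.cong refl arg_cong2[where f = "(*)"] prod.cong) (metis UN_iff)

end

interpretation peval: rat_coeff_hom "of_rat :: rat \<Rightarrow> real"
  by unfold_locales (simp_all add: of_rat_add of_rat_mult)

lemma PConst_add: "PConst (a + b) = PConst a + PConst b"
  by (simp add: PConst_def single_add)

lemma PConst_mult: "PConst (a * b) = PConst a * PConst b"
  by (simp add: PConst_def mult_single)

lemma PConst_1: "PConst 1 = 1"
  by (simp add: PConst_def)

interpretation psubst: rat_coeff_hom PConst
  by unfold_locales (simp_all add: PConst_add PConst_mult PConst_1)

lemma peval_eq_pev: "peval \<omega> p = peval.pev \<omega> p"
  by (simp add: peval_def peval.pev_def meval_def)

lemma psubst_eq_pev: "psubst \<sigma> p = psubst.pev \<sigma> p"
  by (simp add: psubst_def psubst.pev_def meval_def)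

lemmas peval_simps [simp] =
  peval.pev_0 [folded peval_eq_pev] peval.pev_1 [folded peval_eq_pev]
  peval.pev_add [folded peval_eq_pev] peval.pev_mult [folded peval_eq_pev]
  peval.pev_uminus [folded peval_eq_pev] peval.pev_diff [folded peval_eq_pev]
  peval.pev_sum [folded peval_eq_pev] peval.pev_prod [folded peval_eq_pev]
  peval.pev_power [folded peval_eq_pev]
  peval.pev_PVar [folded peval_eq_pev] peval.pev_PConst [folded peval_eq_pev]
  peval.pev_of_nat [folded peval_eq_pev] peval.pev_numeral [folded peval_eq_pev]

lemmas psubst_simps [simp] =
  psubst.pev_0 [folded psubst_eq_pev] psubst.pev_1 [folded psubst_eq_pev]
  psubst.pev_add [folded psubst_eq_pev] psubst.pev_mult [folded psubst_eq_pev]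
  psubst.pev_uminus [folded psubst_eq_pev] psubst.pev_diff [folded psubst_eq_pev]
  psubst.pev_sum [folded psubst_eq_pev] psubst.pev_prod [folded psubst_eq_pev]
  psubst.pev_power [folded psubst_eq_pev]
  psubst.pev_PVar [folded psubst_eq_pev] psubst.pev_PConst [folded psubst_eq_pev]
  psubst.pev_of_nat [folded psubst_eq_pev] psubst.pev_numeral [folded psubst_eq_pev]

lemmas peval_cong = peval.pev_cong [folded peval_eq_pev]
lemmas psubst_cong = psubst.pev_cong [folded psubst_eq_pev]

lemma peval_psubst [simp]: "peval \<omega> (psubst \<sigma> p) = peval (\<lambda>x. peval \<omega> (\<sigma> x)) p"
  by (simp add: psubst_def peval_def[of _ p])

lemma psubst_psubst [simp]: "psubst \<tau> (psubst \<sigma> p) = psubst (\<lambda>x. psubst \<tau> (\<sigma> x)) p"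
  by (simp add: psubst_def[of _ p])

lemma meval_PVar: "meval PVar m = Poly_Mapping.single m 1"
proof -
  have pw: "PVar x ^ k = Poly_Mapping.single (Poly_Mapping.single x k) 1" for x k
    by (induction k) (simp_all add: PVar_def mult_single flip: single_add)
  have "(\<Prod>x\<in>A. PVar x ^ Poly_Mapping.lookup m x) =
      Poly_Mapping.single (\<Sum>x\<in>A. Poly_Mapping.single x (Poly_Mapping.lookup m x)) 1" for A
    by (induction A rule: infinite_finite_induct) (simp_all add: pw mult_single)
  then show ?thesis
    by (simp add: meval_def flip: poly_mapping_expansion)
qed

lemma psubst_PVar [simp]: "psubst PVar p = p"
  by (induction p rule: poly_mapping_single_add_induct)
     (simp_all add: psubst_eq_pev psubst.pev_single psubst.pev_add meval_PVar PConst_def mult_single)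

lemma psubst_ident: "(\<And>x. x \<in> pvars p \<Longrightarrow> \<sigma> x = PVar x) \<Longrightarrow> psubst \<sigma> p = p"
  by (metis psubst_PVar psubst_cong)

section \<open>Variables of polynomials\<close>

lemma pvars_0 [simp]: "pvars 0 = {}"
  by (simp add: pvars_def)

lemma pvars_1 [simp]: "pvars 1 = {}"
  by (simp add: pvars_def)

lemma pvars_PVar [simp]: "pvars (PVar x) = {x}"
  by (simp add: pvars_def PVar_def)

lemma pvars_PConst [simp]: "pvars (PConst c) = {}"
  by (auto simp: pvars_def PConst_def keys_single split: if_splits)

lemma pvars_add: "pvars (p + q) \<subseteq> pvars p \<union> pvars q"
  using keys_add[of p q] by (auto simp: pvars_def)

lemma keys_uminus_trm: "Poly_Mapping.keys (- p) = Poly_Mapping.keys (p :: trm)"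
  by (auto simp: in_keys_iff)

lemma pvars_uminus [simp]: "pvars (- p) = pvars p"
  by (simp add: pvars_def keys_uminus_trm)

lemma pvars_diff: "pvars (p - q) \<subseteq> pvars p \<union> pvars q"
  using pvars_add[of p "- q"] by simp

lemma pvars_mult: "pvars (p * q) \<subseteq> pvars p \<union> pvars q"
proof -
  have "Poly_Mapping.keys (a + b) \<subseteq> Poly_Mapping.keys a \<union> Poly_Mapping.keys b" for a b :: "var \<Rightarrow>\<^sub>0 nat"
    by (rule keys_add)
  then show ?thesis
    using keys_mult[of p q] by (fastforce simp: pvars_def)
qed

lemma pvars_sum: "pvars (sum f A) \<subseteq> (\<Union>i\<in>A. pvars (f i))"
proof (induction A rule: infinite_finite_induct)
  case (insert x A)
  then show ?case using pvars_add[of "f x" "sum f A"] by auto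
qed simp_all

lemma pvars_power: "pvars (p ^ n) \<subseteq> pvars p"
proof (induction n)
  case (Suc n)
  then show ?case using pvars_mult[of p "p ^ n"] by auto
qed simp

lemma pvars_of_nat [simp]: "pvars (of_nat n) = {}"
  using pvars_add[of 1] by (induction n) auto

lemma pvars_numeral [simp]: "pvars (numeral n) = {}"
  using pvars_of_nat[of "numeral n"] by simp

section \<open>Partial and Lie derivatives\<close>

lemma pdiff_0 [simp]: "pdiff x 0 = 0"
  by (simp add: pdiff_def)

lemma pdiff_single: "pdiff x (Poly_Mapping.single m c) =
    Poly_Mapping.single (m - Poly_Mapping.single x 1) (of_nat (Poly_Mapping.lookup m x) * c)"
  by (cases "c = 0") (simp_all add: pdiff_def)

lemma pdiff_add [simp]: "pdiff x (p + q) = pdiff x p + pdiff x q"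
  unfolding pdiff_def
  by (rule setsum_keys_plus_distrib) (simp_all add: single_add distrib_left)

text \<open>Both sides are additive in \<open>p\<close> and in \<open>q\<close>, which leaves the
  case of two monomials.\<close>

lemma pdiff_mult: "pdiff x (p * q) = pdiff x p * q + p * pdiff x q"
proof (induction p rule: poly_mapping_single_add_induct)
  case (single m c)
  show ?case
  proof (induction q rule: poly_mapping_single_add_induct)
    case (single n d)
    let ?e = "Poly_Mapping.single x 1 :: var \<Rightarrow>\<^sub>0 nat"
    \<comment> \<open>Truncated subtraction commutes with addition only if \<open>x\<close> occurs
      in \<open>a\<close>; otherwise the coefficient in \<open>l\<close> and \<open>r\<close> below
      is 0.\<close>
    have shift: "a - ?e + b = a + b - ?e" if "Poly_Mapping.lookup a x \<noteq> 0" for a b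
      by (rule poly_mapping_eqI) (use that in \<open>auto simp: lookup_add lookup_minus lookup_single when_def\<close>)
    have l: "Poly_Mapping.single (m - ?e + n) (of_nat (Poly_Mapping.lookup m x) * (c * d)) =
        Poly_Mapping.single (m + n - ?e) (of_nat (Poly_Mapping.lookup m x) * (c * d))"
      by (cases "Poly_Mapping.lookup m x = 0") (simp_all add: shift del: One_nat_def)
    have r: "Poly_Mapping.single (m + (n - ?e)) (of_nat (Poly_Mapping.lookup n x) * (c * d)) =
        Poly_Mapping.single (m + n - ?e) (of_nat (Poly_Mapping.lookup n x) * (c * d))"
      using shift[of n m] by (cases "Poly_Mapping.lookup n x = 0") (simp_all add: add.commute del: One_nat_def)
    show ?case
      using l r
      by (simp add: mult_single pdiff_single lookup_add distrib_right distrib_left single_add mult.assoc mult.left_commute)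
  qed (simp add: algebra_simps)
qed (simp add: algebra_simps)

lemma pdiff_notin: "x \<notin> pvars p \<Longrightarrow> pdiff x p = 0"
  unfolding pdiff_def pvars_def
  by (rule sum.neutral) (auto simp: in_keys_iff)

lemma pdiff_1 [simp]: "pdiff x 1 = 0"
  by (simp add: pdiff_notin)

lemma pdiff_PVar: "pdiff x (PVar y) = (if x = y then 1 else 0)"
  by (auto simp: pdiff_notin) (simp add: PVar_def pdiff_single)

lemma pdiff_uminus [simp]: "pdiff x (- p) = - pdiff x p"
  using pdiff_add[of x p "- p"] by (simp add: eq_neg_iff_add_eq_0 add.commute)

lemma pvars_pdiff: "pvars (pdiff x p) \<subseteq> pvars p"
proof -
  have "pvars (Poly_Mapping.single (m - Poly_Mapping.single x 1) c) \<subseteq> pvars p"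
    if "m \<in> Poly_Mapping.keys p" for m and c :: rat
  proof -
    have "Poly_Mapping.keys (m - Poly_Mapping.single x 1) \<subseteq> Poly_Mapping.keys m"
      by (auto simp: in_keys_iff lookup_minus)
    then show ?thesis using that by (auto simp: pvars_def keys_single split: if_splits)
  qed
  then show ?thesis
    unfolding pdiff_def by (intro order.trans[OF pvars_sum] UN_least) auto
qed

lemma lie_add [simp]: "lie F (p + q) = lie F p + lie F q"
  by (simp add: lie_def distrib_right sum_list_addf split_def)

lemma lie_mult: "lie F (p * q) = lie F p * q + p * lie F q"
  by (simp add: lie_def pdiff_mult distrib_right sum_list_addf split_def algebra_simps
      flip: sum_list_const_mult)

lemma lie_0 [simp]: "lie F 0 = 0"
  by (simp add: lie_def split_def)

lemma lie_1 [simp]: "lie F 1 = 0"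
  by (simp add: lie_def split_def)

lemma lie_uminus [simp]: "lie F (- p) = - lie F p"
  using lie_add[of F p "- p"] by (simp add: eq_neg_iff_add_eq_0 add.commute)

lemma lie_diff [simp]: "lie F (p - q) = lie F p - lie F q"
  using lie_add[of F p "- q"] by simp

lemma lie_sum: "lie F (sum f A) = (\<Sum>i\<in>A. lie F (f i))"
  by (induction A rule: infinite_finite_induct) simp_all

lemma lie_PVar:
  assumes "distinct (map fst F)" "(x, f) \<in> set F"
  shows "lie F (PVar x) = f"
  using assms
proof (induction F)
  case (Cons a F)
  have notin: "lie F (PVar x) = 0" if "x \<notin> fst ` set F" for F :: ode
    using that by (induction F) (auto simp: lie_def pdiff_PVar)
  show ?case
  proof (cases "a = (x, f)")
    case True
    then show ?thesis using Cons.prems notin[of F] by (simp add: lie_def pdiff_PVar)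
  next
    case False
    then have "fst a \<noteq> x" using Cons.prems by (auto simp: rev_image_eqI)
    then show ?thesis using Cons False by (simp add: lie_def pdiff_PVar split_def)
  qed
qed simp

lemma lie_append: "lie (F @ G) p = lie F p + lie G p"
  by (simp add: lie_def)

lemma lie_notin: "ode_vars F \<inter> pvars p = {} \<Longrightarrow> lie F p = 0"
  by (induction F) (auto simp: lie_def ode_vars_def pdiff_notin split_def)

lemma pvars_lie: "pvars (lie F p) \<subseteq> pvars p \<union> (\<Union>(x, f)\<in>set F. pvars f)"
proof (induction F)
  case (Cons a F)
  then show ?case
    using pvars_add[of "pdiff (fst a) p * snd a" "lie F p"] pvars_mult[of "pdiff (fst a) p" "snd a"]
      pvars_pdiff[of "fst a" p]
    by (simp add: lie_def split_def) blast
qed (simp add: lie_def)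

lemma lie_pow_0 [simp]: "lie_pow F 0 p = p"
  by (simp add: lie_pow_def)

lemma lie_pow_Suc: "lie_pow F (Suc i) p = lie F (lie_pow F i p)"
  by (simp add: lie_pow_def)

lemma lie_pow_Suc2: "lie_pow F (Suc i) p = lie_pow F i (lie F p)"
  by (simp add: lie_pow_def funpow_Suc_right del: funpow.simps)

lemma pvars_lie_pow: "pvars (lie_pow F i p) \<subseteq> pvars p \<union> (\<Union>(x, f)\<in>set F. pvars f)"
proof (induction i)
  case (Suc i)
  then show ?case using pvars_lie[of F "lie_pow F i p"] by (auto simp: lie_pow_Suc)
qed simp

lemma lie_pow_uminus [simp]: "lie_pow F i (- p) = - lie_pow F i p"
  by (induction i) (simp_all add: lie_pow_Suc)

lemma lie_pow_diff: "lie_pow F i (p - q) = lie_pow F i p - lie_pow F i q"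
  by (induction i) (simp_all add: lie_pow_Suc)

text \<open>By the Leibniz rule each derivative removes at most one factor \<open>u\<close>. Hence
  all Lie derivatives of \<open>u ^ M\<close> of order below \<open>M\<close> vanish where
  \<open>u\<close> does.\<close>

lemma lie_pow_power:
  "i \<le> M \<Longrightarrow> \<exists>c. lie_pow F i (u ^ M) = c * u ^ (M - i)"
proof (induction i)
  case 0
  show ?case by (rule exI[of _ 1]) simp
next
  case (Suc i)
  then obtain c where c: "lie_pow F i (u ^ M) = c * u ^ (M - i)" by auto
  have pw: "\<exists>d. lie F (u ^ Suc m) = d * u ^ m" for m
  proof (induction m)
    case (Suc m)
    then obtain d where "lie F (u ^ Suc m) = d * u ^ m" by blast
    then have "lie F (u ^ Suc (Suc m)) = (lie F u + d) * u ^ Suc m"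
      by (simp only: power_Suc[of u "Suc m"] lie_mult[of F u "u ^ Suc m"]) (simp add: algebra_simps)
    then show ?case by blast
  qed (auto simp: mult.commute)
  obtain m where m: "M - i = Suc m" "M - Suc i = m" using Suc.prems by (metis Suc_diff_Suc Suc_le_lessD)
  obtain d where d: "lie F (u ^ Suc m) = d * u ^ m" using pw by blast
  have "lie_pow F (Suc i) (u ^ M) = (lie F c * u + c * d) * u ^ m"
    by (simp add: lie_pow_Suc c m(1) lie_mult[of F c] d del: power_Suc) (simp add: algebra_simps)
  then show ?case by (auto simp: m(2))
qed

section \<open>Existence of ranks\<close>

lemma nat_seq_incseq_subseq:
  fixes f :: "nat \<Rightarrow> nat"
  shows "\<exists>s :: nat \<Rightarrow> nat. strict_mono s \<and> mono (f \<circ> s)"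
proof -
  obtain s where s: "strict_mono s" "monoseq (f \<circ> s)"
    using seq_monosub[of f] by (auto simp: o_def)
  show ?thesis
  proof (cases "mono (f \<circ> s)")
    case False
    then have dec: "(f \<circ> s) j \<le> (f \<circ> s) i" if "i \<le> j" for i j
      using s(2) that unfolding monoseq_def mono_def by blast
    \<comment> \<open>A decreasing sequence of naturals is constant from the index of its least
      value on, so that its tail is monotone.\<close>
    obtain n where n: "\<And>i. (f \<circ> s) n \<le> (f \<circ> s) i"
      using ex_has_least_nat[of "\<lambda>_. True" 0 "f \<circ> s"] by auto
    have "(f \<circ> s) (n + i) = (f \<circ> s) n" for i
      using dec[of n "n + i"] n[of "n + i"] by simp
    then have "mono (f \<circ> (s \<circ> (+) n))" by (simp add: mono_def)
    moreover have "strict_mono (s \<circ> (+) n)" using s(1) by (simp add: strict_mono_def)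
    moreover have "f \<circ> (s \<circ> (+) n) = f \<circ> s \<circ> (+) n" by (simp add: o_assoc)
    ultimately show ?thesis by metis
  qed (use s in blast)
qed

text \<open>The subsequence is refined once for each coordinate in \<open>V\<close>; refining
  preserves monotonicity in the coordinates already treated.\<close>

lemma dickson_subseq:
  fixes m :: "nat \<Rightarrow> 'a \<Rightarrow> nat"
  assumes "finite V"
  shows "\<exists>s :: nat \<Rightarrow> nat. strict_mono s \<and> (\<forall>x\<in>V. incseq (\<lambda>i. m (s i) x))"
  using assms
proof (induction V)
  case empty
  show ?case by (auto intro: exI[of _ id] simp: strict_mono_def)
next
  case (insert x V)
  then obtain s where s: "strict_mono s" "\<forall>y\<in>V. incseq (\<lambda>i. m (s i) y)" by blast
  obtain r where r: "strict_mono r" "incseq ((\<lambda>i. m (s i) x) \<circ> r)"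
    using nat_seq_incseq_subseq[of "\<lambda>i. m (s i) x"] by blast
  have "strict_mono (s \<circ> r)" using s r by (simp add: strict_mono_def)
  moreover have "incseq (\<lambda>i. m ((s \<circ> r) i) y)" if "y \<in> insert x V" for y
    using that s(2) r by (auto simp: mono_def o_def strict_mono_less_eq)
  ultimately show ?case by blast
qed

text \<open>The first two members of the monotone subsequence are comparable on \<open>V\<close>,
  and outside \<open>V\<close> the exponents of the earlier one are 0.\<close>

lemma dickson:
  fixes m :: "nat \<Rightarrow> (var \<Rightarrow>\<^sub>0 nat)"
  assumes "finite V" "\<And>i. Poly_Mapping.keys (m i) \<subseteq> V"
  shows "\<exists>i j. i < j \<and> (\<forall>x. Poly_Mapping.lookup (m i) x \<le> Poly_Mapping.lookup (m j) x)"
proof -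
  obtain s where s: "strict_mono s" "\<forall>x\<in>V. incseq (\<lambda>i. Poly_Mapping.lookup (m (s i)) x)"
    using dickson_subseq[OF assms(1), of "\<lambda>i. Poly_Mapping.lookup (m i)"] by blast
  have "Poly_Mapping.lookup (m (s 0)) x \<le> Poly_Mapping.lookup (m (s 1)) x" for x
  proof (cases "x \<in> V")
    case True
    then show ?thesis using s(2) by (simp add: mono_def)
  next
    case False
    then have "x \<notin> Poly_Mapping.keys (m (s 0))" using assms(2) by blast
    then show ?thesis by (simp add: in_keys_iff)
  qed
  moreover have "s 0 < s 1" using s(1) by (simp add: strict_mono_def)
  ultimately show ?thesis by blast
qed

text \<open>Monomials are compared by the lexicographic order that the library puts on
  \<^type>\<open>poly_mapping\<close>; it extends the divisibility order.\<close>

lemma divides_imp_le: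
  fixes m n :: "var \<Rightarrow>\<^sub>0 nat"
  assumes "\<And>x. Poly_Mapping.lookup m x \<le> Poly_Mapping.lookup n x"
  shows "m \<le> n"
proof -
  have "\<not> n < m"
    unfolding less_poly_mapping.rep_eq less_fun_def using assms by (meson leD)
  then show ?thesis by simp
qed

text \<open>In a descending chain some member would divide a later one by Dickson's lemma and hence
  lie below it. The finite set \<open>V\<close> matters: with infinitely many variables, the single
  variables in increasing order form a descending chain.\<close>

lemma wf_monomials:
  assumes "finite V"
  shows "wf {(m, n :: var \<Rightarrow>\<^sub>0 nat). m < n \<and> Poly_Mapping.keys m \<subseteq> V \<and> Poly_Mapping.keys n \<subseteq> V}"
  unfolding wf_iff_no_infinite_down_chain
proof
  assume "\<exists>m. \<forall>i. (m (Suc i), m i) \<in> {(m, n :: var \<Rightarrow>\<^sub>0 nat). m < n \<and> Poly_Mapping.keys m \<subseteq> V \<and> Poly_Mapping.keys n \<subseteq> V}"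
  then obtain m :: "nat \<Rightarrow> var \<Rightarrow>\<^sub>0 nat"
    where m: "\<And>i. m (Suc i) < m i" "\<And>i. Poly_Mapping.keys (m i) \<subseteq> V" by blast
  obtain i j where ij: "i < j" "\<forall>x. Poly_Mapping.lookup (m i) x \<le> Poly_Mapping.lookup (m j) x"
    using dickson[OF assms m(2)] by blast
  have "m j < m i" using ij(1) m(1)
    by (induction j) (auto simp: less_Suc_eq intro: less_trans)
  then show False using divides_imp_le ij(2) leD by blast
qed

lemma lookup_single_mult:
  fixes q :: trm
  shows "Poly_Mapping.lookup (Poly_Mapping.single d c * q) (d + k) = c * Poly_Mapping.lookup q k"
  by (induction q rule: poly_mapping_single_add_induct)
     (simp_all add: mult_single lookup_single lookup_add distrib_left when_def)

lemma pvars_single_subset: "pvars (Poly_Mapping.single d c) \<subseteq> Poly_Mapping.keys d"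
  by (auto simp: pvars_def keys_single split: if_splits)

text \<open>Choose in each nonempty difference of consecutive ideals an element with the least
  leading monomial.  By Dickson's lemma one of these leading monomials divides a later one, which
  can therefore be cancelled.\<close>

theorem hilbert_basis_sequence:
  fixes p :: "nat \<Rightarrow> trm"
  assumes V: "finite V" and p: "\<And>i. pvars (p i) \<subseteq> V"
  shows "\<exists>N\<ge>1. \<exists>g. p N = (\<Sum>i<N. g i * p i)"
proof (rule ccontr)
  assume neg: "\<not> ?thesis"
  \<comment> \<open>\<open>J n\<close> is the ideal generated by the first \<open>n\<close>
    polynomials, with multipliers over \<open>V\<close> only, so that every monomial that occurs
    stays over \<open>V\<close>, where Dickson's lemma applies.\<close>
  define J where "J n = {(\<Sum>i<n. g i * p i) | g. \<forall>i. pvars (g i) \<subseteq> V}" for n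
  have J_V: "pvars q \<subseteq> V" if q: "q \<in> J n" for q n
  proof -
    obtain g where g: "\<forall>i. pvars (g i) \<subseteq> V" "q = (\<Sum>i<n. g i * p i)" using q unfolding J_def by blast
    have "pvars (g i * p i) \<subseteq> V" for i using pvars_mult[of "g i" "p i"] g(1) p[of i] by blast
    then show ?thesis using pvars_sum[of "\<lambda>i. g i * p i" "{..<n}"] g(2) by blast
  qed
  have J_sub: "q - a * r \<in> J n" if "q \<in> J n" "r \<in> J n" "pvars a \<subseteq> V" for q a r n
  proof -
    obtain g where g: "\<forall>i. pvars (g i) \<subseteq> V" "q = (\<Sum>i<n. g i * p i)" using \<open>q \<in> J n\<close> unfolding J_def by blast
    obtain k where k: "\<forall>i. pvars (k i) \<subseteq> V" "r = (\<Sum>i<n. k i * p i)" using \<open>r \<in> J n\<close> unfolding J_def by blast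
    have "pvars (g i - a * k i) \<subseteq> V" for i
      using pvars_diff[of "g i" "a * k i"] pvars_mult[of a "k i"] g k that(3) by blast
    moreover have "q - a * r = (\<Sum>i<n. (g i - a * k i) * p i)"
      by (simp add: g k sum_distrib_left left_diff_distrib sum_subtractf mult.assoc)
    ultimately show ?thesis unfolding J_def mem_Collect_eq
      by (intro exI[of _ "\<lambda>i. g i - a * k i"]) blast
  qed
  have J_Suc: "J n \<subseteq> J (Suc n)" for n
  proof
    fix q assume "q \<in> J n"
    then obtain g where g: "\<forall>i. pvars (g i) \<subseteq> V" "q = (\<Sum>i<n. g i * p i)" unfolding J_def by blast
    then have "q = (\<Sum>i<Suc n. (g(n := 0)) i * p i)" "\<forall>i. pvars ((g(n := 0)) i) \<subseteq> V"
      by (auto intro: sum.cong)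
    then show "q \<in> J (Suc n)" unfolding J_def by blast
  qed
  have J_mono: "J i \<subseteq> J j" if "i \<le> j" for i j
    using that by (rule lift_Suc_mono_le[of J, OF J_Suc])
  have J_0: "0 \<in> J n" for n
    unfolding J_def by (auto intro!: exI[of _ "\<lambda>_. 0"])
  have p_J: "p n \<in> J (Suc n)" for n
  proof -
    have "p n = (\<Sum>i<Suc n. (if i = n then 1 else 0) * p i)" by simp
    moreover have "\<forall>i. pvars (if i = n then 1 else 0 :: trm) \<subseteq> V" by simp
    ultimately show ?thesis unfolding J_def mem_Collect_eq
      by (intro exI[of _ "\<lambda>i. if i = n then 1 else 0"]) blast
  qed
  \<comment> \<open>The differences start at \<open>J 1\<close>, because the negated claim excludes
    \<open>p N\<close> from \<open>J N\<close> only for \<open>N \<ge> 1\<close>.\<close>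
  define S where "S n = J (Suc (Suc n)) - J (Suc n)" for n
  define lm where "lm q = Max (Poly_Mapping.keys q)" for q :: trm
  have S_ne: "p (Suc n) \<in> S n" for n
  proof -
    have "p (Suc n) \<notin> J (Suc n)"
    proof
      assume "p (Suc n) \<in> J (Suc n)"
      then obtain g where "p (Suc n) = (\<Sum>i<Suc n. g i * p i)" unfolding J_def by blast
      then show False using neg by (metis le_add1 plus_1_eq_Suc)
    qed
    then show ?thesis using p_J[of "Suc n"] by (simp add: S_def)
  qed
  have S_nz: "Poly_Mapping.keys q \<noteq> {}" if "q \<in> S n" for q n
  proof
    assume "Poly_Mapping.keys q = {}"
    then have "q = 0" using in_keys_iff[of _ q] by (intro poly_mapping_eqI) auto
    then show False using that J_0 by (simp add: S_def)
  qed
  have lm_in: "lm q \<in> Poly_Mapping.keys q" if "q \<in> S n" for q n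
    unfolding lm_def using S_nz[OF that] by simp
  have lm_V: "Poly_Mapping.keys (lm q) \<subseteq> V" if "q \<in> S n" for q n
    using lm_in[OF that] J_V[of q] that unfolding S_def pvars_def by blast
  let ?R = "{(m, n :: var \<Rightarrow>\<^sub>0 nat). m < n \<and> Poly_Mapping.keys m \<subseteq> V \<and> Poly_Mapping.keys n \<subseteq> V}"
  have "\<exists>r\<in>S n. \<forall>q\<in>S n. \<not> lm q < lm r" for n
  proof -
    have "wf (inv_image ?R lm)" using wf_monomials[OF V] by (rule wf_inv_image)
    then obtain r where r: "r \<in> S n" "\<And>q. (q, r) \<in> inv_image ?R lm \<Longrightarrow> q \<notin> S n"
      using S_ne[of n] by (rule wfE_min) blast
    then have "\<not> lm q < lm r" if "q \<in> S n" for q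
      using that lm_V[OF that] lm_V[OF r(1)] by (auto simp: inv_image_def)
    then show ?thesis using r(1) by blast
  qed
  then obtain r where r: "\<And>n. r n \<in> S n" "\<And>n q. q \<in> S n \<Longrightarrow> \<not> lm q < lm (r n)" by metis
  obtain i j where ij: "i < j" "\<forall>x. Poly_Mapping.lookup (lm (r i)) x \<le> Poly_Mapping.lookup (lm (r j)) x"
    using dickson[OF V, of "\<lambda>n. lm (r n)"] lm_V[OF r(1)] by blast
  define d where "d = lm (r j) - lm (r i)"
  have d: "lm (r j) = d + lm (r i)"
    using ij(2) by (intro poly_mapping_eqI) (simp add: d_def lookup_add lookup_minus)
  have d_V: "Poly_Mapping.keys d \<subseteq> V"
    using lm_V[OF r(1)[of j]] by (auto simp: d_def in_keys_iff lookup_minus)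
  \<comment> \<open>The quotient of the leading coefficients, so that \<open>q\<close> loses the
    leading monomial of \<open>r j\<close>. As \<open>r i\<close> lies in \<open>J (Suc j)\<close>,
    \<open>q\<close> stays in \<open>S j\<close> and contradicts the minimality of
    \<open>r j\<close>.\<close>
  define c where "c = Poly_Mapping.lookup (r j) (lm (r j)) / Poly_Mapping.lookup (r i) (lm (r i))"
  define q where "q = r j - Poly_Mapping.single d c * r i"
  have ri: "r i \<in> J (Suc j)"
    using r(1)[of i] J_mono[of "Suc (Suc i)" "Suc j"] ij(1) unfolding S_def by auto
  have sV: "pvars (Poly_Mapping.single d c) \<subseteq> V" using pvars_single_subset[of d c] d_V by blast
  have "q \<in> J (Suc (Suc j))"
    unfolding q_def using r(1)[of j] ri J_Suc sV by (intro J_sub) (auto simp: S_def)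
  moreover have "q \<notin> J (Suc j)"
  proof
    assume "q \<in> J (Suc j)"
    then have "q - (- Poly_Mapping.single d c) * r i \<in> J (Suc j)" using ri sV by (intro J_sub) auto
    then show False using r(1)[of j] by (simp add: q_def S_def)
  qed
  ultimately have qS: "q \<in> S j" by (simp add: S_def)
  have "k \<le> lm (r j)" if "k \<in> Poly_Mapping.keys q" for k
  proof -
    have "k \<in> Poly_Mapping.keys (r j) \<or> k \<in> Poly_Mapping.keys (Poly_Mapping.single d c * r i)"
      using that by (auto simp: q_def in_keys_iff lookup_minus)
    then show ?thesis
    proof
      assume "k \<in> Poly_Mapping.keys (r j)"
      then show ?thesis by (simp add: lm_def)
    next
      assume "k \<in> Poly_Mapping.keys (Poly_Mapping.single d c * r i)"
      then obtain l where l: "k = d + l" "l \<in> Poly_Mapping.keys (r i)"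
        using keys_mult[of "Poly_Mapping.single d c" "r i"] by (auto split: if_splits)
      then have "l \<le> lm (r i)" by (simp add: lm_def)
      then show ?thesis using l(1) d by (simp add: add_left_mono)
    qed
  qed
  moreover have "lm (r j) \<notin> Poly_Mapping.keys q"
    using lm_in[OF r(1)[of i]]
    by (simp add: q_def in_keys_iff lookup_minus c_def) (simp add: d lookup_single_mult)
  ultimately have "lm q < lm (r j)" using lm_in[OF qS] by (metis order.not_eq_order_implies_strict)
  then show False using r(2)[OF qS] by blast
qed

lemma pvars_finite [simp]: "finite (pvars p)"
  by (simp add: pvars_def)

text \<open>Repeated Lie derivatives introduce no variables beyond those of \<open>p\<close> and of
  the right-hand sides, so the basis theorem applies to their sequence.\<close>

lemma rank_exists:
  "\<exists>N. N \<ge> 1 \<and> (\<exists>g :: nat \<Rightarrow> trm. lie_pow F N p = (\<Sum>i<N. g i * lie_pow F i p))"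
  using hilbert_basis_sequence[of "pvars p \<union> (\<Union>(x, f)\<in>set F. pvars f)" "\<lambda>i. lie_pow F i p"]
    pvars_lie_pow[of F _ p] by (auto simp: split_def)

lemma rank_ge_1: "rank F p \<ge> 1"
  and rank_relation: "\<exists>g :: nat \<Rightarrow> trm. lie_pow F (rank F p) p = (\<Sum>i<rank F p. g i * lie_pow F i p)"
  using LeastI_ex[OF rank_exists, of F p] unfolding rank_def by auto

section \<open>Maximal consistent valuations\<close>

abbreviation der :: "fml list \<Rightarrow> fml \<Rightarrow> bool" where
  "der \<equiv> derives axiom1"

definition cons_set :: "fml set \<Rightarrow> bool" where
  "cons_set S \<longleftrightarrow> (\<forall>\<Gamma>. set \<Gamma> \<subseteq> S \<longrightarrow> \<not> der \<Gamma> FF)"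

lemma der_assm: "\<phi> \<in> set \<Gamma> \<Longrightarrow> der \<Gamma> \<phi>"
  by (rule Weaken[OF Id]) auto

lemma der_axiom1: "axiom1 \<phi> \<Longrightarrow> der \<Gamma> \<phi>"
  by (rule Weaken[OF Axiom]) auto

lemma der_valid: "is_fol \<phi> \<Longrightarrow> valid \<phi> \<Longrightarrow> der \<Gamma> \<phi>"
  by (intro der_axiom1 Base Arith)

lemma der_FF: "der \<Gamma> FF \<Longrightarrow> der \<Gamma> \<phi>"
  by (rule Cut[of _ _ "Not FF"]) (auto intro: der_valid NotL simp: valid_def)

text \<open>A valuation of all formulas, modal ones included, by truth values.  Sequents are
  derivable iff all such valuations satisfy them, so propositional reasoning in the calculus
  becomes reasoning about truth values.\<close>

locale valuation =
  fixes v :: "fml \<Rightarrow> bool"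
  assumes v_der: "der \<Gamma> \<phi> \<Longrightarrow> \<forall>\<psi>\<in>set \<Gamma>. v \<psi> \<Longrightarrow> v \<phi>"
    and v_Not [simp]: "v (Not \<phi>) \<longleftrightarrow> \<not> v \<phi>"

text \<open>A derivation has finitely many premises, so unions of chains of consistent sets are
  consistent and Zorn's lemma gives a maximal one. Membership in it is the valuation.\<close>

lemma lindenbaum:
  assumes "cons_set S"
  shows "\<exists>v. valuation v \<and> (\<forall>\<psi>\<in>S. v \<psi>)"
proof -
  have "\<exists>M. cons_set M \<and> S \<subseteq> M \<and> (\<forall>X. cons_set X \<and> M \<subseteq> X \<longrightarrow> X = M)"
  proof -
    let ?A = "{X. cons_set X \<and> S \<subseteq> X}"
    have "\<exists>M\<in>?A. \<forall>X\<in>?A. M \<subseteq> X \<longrightarrow> X = M"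
    proof (rule subset_Zorn_nonempty)
      show "?A \<noteq> {}" using assms by blast
      fix C assume C: "C \<noteq> {}" "subset.chain ?A C"
      have "cons_set (\<Union>C)"
        unfolding cons_set_def
      proof (intro allI impI)
        fix \<Gamma> assume "set \<Gamma> \<subseteq> \<Union>C"
        then obtain X where "X \<in> C" "set \<Gamma> \<subseteq> X"
          using finite_subset_Union_chain[of "set \<Gamma>" C ?A] C by auto
        then show "\<not> der \<Gamma> FF" using C(2) unfolding subset.chain_def cons_set_def by blast
      qed
      then show "\<Union>C \<in> ?A" using C unfolding subset.chain_def by blast
    qed
    then obtain M where M: "M \<in> ?A" "\<forall>X\<in>?A. M \<subseteq> X \<longrightarrow> X = M" ..
    show ?thesis
    proof (intro exI[of _ M] conjI allI impI)
      fix X assume "cons_set X \<and> M \<subseteq> X"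
      then have "X \<in> ?A" "M \<subseteq> X" using M(1) by auto
      then show "X = M" using M(2) by metis
    qed (use M(1) in simp_all)
  qed
  then obtain M where M: "cons_set M" "S \<subseteq> M" "\<And>X. cons_set X \<Longrightarrow> M \<subseteq> X \<Longrightarrow> X = M" by metis
  have incons: "\<exists>\<Gamma>. set \<Gamma> \<subseteq> M \<and> der (\<phi> # \<Gamma>) FF" if "\<phi> \<notin> M" for \<phi>
  proof -
    have "\<not> cons_set (insert \<phi> M)" using M(3)[of "insert \<phi> M"] that by blast
    then obtain \<Gamma> where \<Gamma>: "set \<Gamma> \<subseteq> insert \<phi> M" "der \<Gamma> FF" unfolding cons_set_def by blast
    have "der (\<phi> # filter (\<lambda>\<psi>. \<psi> \<noteq> \<phi>) \<Gamma>) FF" by (rule Weaken[OF \<Gamma>(2)]) auto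
    then show ?thesis using \<Gamma>(1) by (intro exI[of _ "filter (\<lambda>\<psi>. \<psi> \<noteq> \<phi>) \<Gamma>"]) auto
  qed
  have closed: "\<phi> \<in> M" if "der \<Gamma> \<phi>" "set \<Gamma> \<subseteq> M" for \<Gamma> \<phi>
  proof (rule ccontr)
    assume "\<phi> \<notin> M"
    then obtain \<Delta> where \<Delta>: "set \<Delta> \<subseteq> M" "der (\<phi> # \<Delta>) FF" using incons by blast
    have "der (\<Gamma> @ \<Delta>) FF"
      by (rule Cut[of _ _ \<phi>]) (rule Weaken[OF that(1)] Weaken[OF \<Delta>(2)], force)+
    moreover have "set (\<Gamma> @ \<Delta>) \<subseteq> M" using that(2) \<Delta>(1) by simp
    ultimately show False using M(1) unfolding cons_set_def by blast
  qed
  have "valuation (\<lambda>\<phi>. \<phi> \<in> M)"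
  proof
    fix \<phi>
    show "Not \<phi> \<in> M \<longleftrightarrow> \<phi> \<notin> M"
    proof
      assume "Not \<phi> \<in> M"
      show "\<phi> \<notin> M"
      proof
        assume "\<phi> \<in> M"
        have "der [Not \<phi>, \<phi>] FF" by (rule NotL) (rule Id)
        then show False using M(1) \<open>Not \<phi> \<in> M\<close> \<open>\<phi> \<in> M\<close> unfolding cons_set_def
          by (auto dest: spec[of _ "[Not \<phi>, \<phi>]"])
      qed
    next
      assume "\<phi> \<notin> M"
      then obtain \<Gamma> where "set \<Gamma> \<subseteq> M" "der (\<phi> # \<Gamma>) FF" using incons by blast
      then show "Not \<phi> \<in> M" using NotR closed by blast
    qed
  qed (use closed in blast)
  then show ?thesis using M(2) by blast
qed

text \<open>If \<open>\<phi>\<close> is not derivable, \<open>Not \<phi>\<close> is consistent with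
  \<open>\<Gamma>\<close>, since \<open>Classical\<close> would turn a refutation into a derivation
  of \<open>\<phi>\<close>. The valuation from \<open>lindenbaum\<close> is then a
  counterexample.\<close>

lemma derI:
  assumes "\<And>v. valuation v \<Longrightarrow> \<forall>\<psi>\<in>set \<Gamma>. v \<psi> \<Longrightarrow> v \<phi>"
  shows "der \<Gamma> \<phi>"
proof (rule ccontr)
  assume neg: "\<not> der \<Gamma> \<phi>"
  have "cons_set (set (Not \<phi> # \<Gamma>))"
    unfolding cons_set_def
  proof (intro allI impI notI)
    fix \<Delta> assume "set \<Delta> \<subseteq> set (Not \<phi> # \<Gamma>)" "der \<Delta> FF"
    then have "der (Not \<phi> # \<Gamma>) FF" by (blast intro: Weaken)
    then show False using neg Classical der_FF by blast
  qed
  then obtain v where v: "valuation v" "\<forall>\<psi>\<in>set (Not \<phi> # \<Gamma>). v \<psi>"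
    using lindenbaum by blast
  then show False using assms[OF v(1)] valuation.v_Not[OF v(1), of \<phi>] by auto
qed

lemma fsem_Conj [simp]: "fsem (Conj \<Gamma>) = {\<omega>. \<forall>\<phi>\<in>set \<Gamma>. \<omega> \<in> fsem \<phi>}"
  by (induction \<Gamma> rule: Conj.induct) auto

lemma fsem_Disj [simp]: "fsem (Disj \<Gamma>) = {\<omega>. \<exists>\<phi>\<in>set \<Gamma>. \<omega> \<in> fsem \<phi>}"
  by (induction \<Gamma> rule: Disj.induct) auto

lemma is_fol_Conj [simp]: "is_fol (Conj \<Gamma>) \<longleftrightarrow> (\<forall>\<phi>\<in>set \<Gamma>. is_fol \<phi>)"
  by (induction \<Gamma> rule: Conj.induct) auto

lemma is_fol_Disj [simp]: "is_fol (Disj \<Gamma>) \<longleftrightarrow> (\<forall>\<phi>\<in>set \<Gamma>. is_fol \<phi>)"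
  by (induction \<Gamma> rule: Disj.induct) auto

lemma FV_Conj [simp]: "FV (Conj \<Gamma>) = FVs \<Gamma>"
  by (induction \<Gamma> rule: Conj.induct) (auto simp: FVs_def)

lemma FV_Disj [simp]: "FV (Disj \<Gamma>) = FVs \<Gamma>"
  by (induction \<Gamma> rule: Disj.induct) (auto simp: FVs_def)

lemma FVs_simps [simp]: "FVs [] = {}" "FVs (\<phi> # \<Gamma>) = FV \<phi> \<union> FVs \<Gamma>" "FVs (\<Gamma> @ \<Delta>) = FVs \<Gamma> \<union> FVs \<Delta>"
  by (auto simp: FVs_def)

section \<open>Propositional and modal laws inside a valuation\<close>

context valuation
begin

lemma v_der1: "der [\<phi>] \<psi> \<Longrightarrow> v \<phi> \<Longrightarrow> v \<psi>"
  using v_der[of "[\<phi>]"] by simp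

lemma v_axiom1: "axiom1 \<phi> \<Longrightarrow> v \<phi>"
  using v_der[of "[]"] by (simp add: der_axiom1)

lemma v_axiom0: "axiom0 \<phi> \<Longrightarrow> v \<phi>"
  by (simp add: v_axiom1 Base)

lemma v_And [simp]: "v (And \<phi> \<psi>) \<longleftrightarrow> v \<phi> \<and> v \<psi>"
proof -
  have "der [And \<phi> \<psi>] \<phi>" by (intro AndL der_assm) simp
  moreover have "der [And \<phi> \<psi>] \<psi>" by (intro AndL der_assm) simp
  moreover have "der [\<phi>, \<psi>] (And \<phi> \<psi>)" by (intro AndR der_assm) simp_all
  ultimately show ?thesis
    using v_der1 v_der[of "[\<phi>, \<psi>]"] by (metis empty_iff empty_set set_ConsD)
qed

lemma v_Or [simp]: "v (Or \<phi> \<psi>) \<longleftrightarrow> v \<phi> \<or> v \<psi>"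
proof -
  have "der [\<phi>] (Or \<phi> \<psi>)" by (intro OrR1 der_assm) simp
  moreover have "der [\<psi>] (Or \<phi> \<psi>)" by (intro OrR2 der_assm) simp
  moreover have "der [Or \<phi> \<psi>, Not \<phi>] \<psi>"
    by (rule OrL, rule Weaken[OF NotL[OF Id[of _ \<phi>]]]) (auto intro: der_assm)
  ultimately show ?thesis
    using v_der1 v_der[of "[Or \<phi> \<psi>, Not \<phi>]" \<psi>] by (metis empty_iff empty_set set_ConsD v_Not)
qed

lemma v_Imp [simp]: "v (Imp \<phi> \<psi>) \<longleftrightarrow> (v \<phi> \<longrightarrow> v \<psi>)"
proof -
  have "der [Imp \<phi> \<psi>, \<phi>] \<psi>" by (rule ImpL) (auto intro: der_assm)
  moreover have "der [\<psi>] (Imp \<phi> \<psi>)" by (intro ImpR der_assm) simp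
  moreover have "der [Not \<phi>] (Imp \<phi> \<psi>)"
    by (rule ImpR, rule Weaken[OF NotL[OF Id[of _ \<phi>]]]) auto
  ultimately show ?thesis
    using v_der1 v_der[of "[Imp \<phi> \<psi>, \<phi>]" \<psi>] by (metis empty_iff empty_set set_ConsD v_Not)
qed

lemma v_Iff [simp]: "v (Iff \<phi> \<psi>) \<longleftrightarrow> (v \<phi> \<longleftrightarrow> v \<psi>)"
proof -
  have "der [Iff \<phi> \<psi>] (And (Imp \<phi> \<psi>) (Imp \<psi> \<phi>))"
    by (intro IffL AndR der_assm) simp_all
  moreover have "der [And (Imp \<phi> \<psi>) (Imp \<psi> \<phi>)] (Iff \<phi> \<psi>)"
  proof (intro AndL IffR)
    have a: "der [Imp a b, a] b" for a b by (rule ImpL) (auto intro: der_assm)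
    show "der [\<phi>, Imp \<phi> \<psi>, Imp \<psi> \<phi>] \<psi>" "der [\<psi>, Imp \<phi> \<psi>, Imp \<psi> \<phi>] \<phi>"
      by (auto intro: Weaken[OF a])
  qed
  ultimately show ?thesis using v_der1 by (metis v_And v_Imp)
qed

lemma v_foldr_Imp: "v (foldr Imp \<Gamma> \<phi>) \<longleftrightarrow> ((\<forall>\<psi>\<in>set \<Gamma>. v \<psi>) \<longrightarrow> v \<phi>)"
  by (induction \<Gamma>) auto

text \<open>The gate for semantic reasoning: the premises are folded into one implication, which is
  a valid arithmetic formula and therefore an axiom.\<close>

lemma v_fol:
  assumes "is_fol \<phi>" "\<And>\<psi>. \<psi> \<in> set \<Gamma> \<Longrightarrow> is_fol \<psi>" "\<And>\<psi>. \<psi> \<in> set \<Gamma> \<Longrightarrow> v \<psi>"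
    and "\<And>\<omega>. \<forall>\<psi>\<in>set \<Gamma>. \<omega> \<in> fsem \<psi> \<Longrightarrow> \<omega> \<in> fsem \<phi>"
  shows "v \<phi>"
proof -
  have "is_fol (foldr Imp \<Gamma> \<phi>)" using assms(1,2) by (induction \<Gamma>) auto
  moreover have "\<omega> \<in> fsem (foldr Imp \<Gamma> \<phi>) \<longleftrightarrow> ((\<forall>\<psi>\<in>set \<Gamma>. \<omega> \<in> fsem \<psi>) \<longrightarrow> \<omega> \<in> fsem \<phi>)" for \<omega>
    by (induction \<Gamma>) auto
  ultimately have "v (foldr Imp \<Gamma> \<phi>)"
    using assms(4) by (intro v_axiom0 Arith) (auto simp: valid_def)
  then show ?thesis using assms(3) by (simp add: v_foldr_Imp)
qed

lemma v_Conj [simp]: "v (Conj \<Gamma>) \<longleftrightarrow> (\<forall>\<phi>\<in>set \<Gamma>. v \<phi>)"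
  by (induction \<Gamma> rule: Conj.induct) (auto intro: v_fol[of _ "[]"])

lemma v_Disj [simp]: "v (Disj \<Gamma>) \<longleftrightarrow> (\<exists>\<phi>\<in>set \<Gamma>. v \<phi>)"
proof (induction \<Gamma> rule: Disj.induct)
  case 1
  have "v (Not FF)" by (rule v_fol[of _ "[]"]) auto
  then show ?case by simp
qed auto

lemma nec: "der [] \<phi> \<Longrightarrow> v (Box \<alpha> \<phi>)"
  using v_der[of "[]" "Box \<alpha> \<phi>"] by (simp add: G)

lemma box_K: "v (Box \<alpha> (Imp \<phi> \<psi>)) \<Longrightarrow> v (Box \<alpha> \<phi>) \<Longrightarrow> v (Box \<alpha> \<psi>)"
  using v_axiom0[OF K[of \<alpha> \<phi> \<psi>]] by simp

text \<open>\<open>G\<close> boxes the sequent, written as a nested implication, and (K) distributes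
  the box over it. Boxed premises must come from (V) or from the domain, because a valuation
  describes the initial state only.\<close>

lemma box_der:
  assumes "der \<Gamma> \<phi>" "\<And>\<psi>. \<psi> \<in> set \<Gamma> \<Longrightarrow> v (Box \<alpha> \<psi>)"
  shows "v (Box \<alpha> \<phi>)"
proof -
  have "v (Box \<alpha> (foldr Imp \<Gamma> \<phi>))"
    by (intro nec derI) (use assms(1) in \<open>auto simp: valuation.v_foldr_Imp valuation.v_der\<close>)
  then show ?thesis using assms(2)
  proof (induction \<Gamma>)
    case (Cons \<psi> \<Gamma>)
    have "v (Box \<alpha> (foldr Imp \<Gamma> \<phi>))"
      by (rule box_K[of _ \<psi>]) (use Cons.prems in simp_all)
    then show ?case by (rule Cons.IH) (simp add: Cons.prems(2))
  qed simp
qed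

lemma box_mono: "der [\<phi>] \<psi> \<Longrightarrow> v (Box \<alpha> \<phi>) \<Longrightarrow> v (Box \<alpha> \<psi>)"
  using box_der[of "[\<phi>]"] by simp

lemma dia_iff: "v (Dia \<alpha> \<phi>) \<longleftrightarrow> \<not> v (Box \<alpha> (Not \<phi>))"
  using v_axiom0[OF Diamond] by simp

text \<open>The contrapositive of \<open>box_der\<close>, with \<open>Not \<psi>\<close> added to
  the boxed premises.\<close>

lemma dia_der:
  assumes "der (\<phi> # \<Gamma>) \<psi>" "\<And>\<chi>. \<chi> \<in> set \<Gamma> \<Longrightarrow> v (Box \<alpha> \<chi>)" "v (Dia \<alpha> \<phi>)"
  shows "v (Dia \<alpha> \<psi>)"
proof (rule ccontr)
  assume "\<not> v (Dia \<alpha> \<psi>)"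
  then have n: "v (Box \<alpha> (Not \<psi>))" by (simp add: dia_iff)
  have "der (Not \<psi> # \<Gamma>) (Not \<phi>)"
  proof (rule derI)
    fix w assume w: "valuation w" "\<forall>\<chi>\<in>set (Not \<psi> # \<Gamma>). w \<chi>"
    interpret w: valuation w by fact
    have "\<not> w \<psi>" "\<And>\<chi>. \<chi> \<in> set \<Gamma> \<Longrightarrow> w \<chi>" using w(2) by auto
    then show "w (Not \<phi>)" using w.v_der[OF assms(1)] by auto
  qed
  then have "v (Box \<alpha> (Not \<phi>))" by (rule box_der) (use n assms(2) in auto)
  then show False using assms(3) by (simp add: dia_iff)
qed

lemma dia_mono: "der [\<phi>] \<psi> \<Longrightarrow> v (Dia \<alpha> \<phi>) \<Longrightarrow> v (Dia \<alpha> \<psi>)"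
  using dia_der[of \<phi> "[]"] by simp

lemma box_const: "FV \<phi> \<inter> BV \<alpha> = {} \<Longrightarrow> v \<phi> \<Longrightarrow> v (Box \<alpha> \<phi>)"
  using v_axiom0[OF V[of \<phi> \<alpha>]] by simp

lemma dia_const:
  assumes "FV \<phi> \<inter> BV \<alpha> = {}" "v (Dia \<alpha> \<phi>)"
  shows "v \<phi>"
  using box_const[of "Not \<phi>" \<alpha>] assms by (auto simp: dia_iff)

lemma box_domain: "wf_ode F \<Longrightarrow> v (Box (ODE F Q) Q)"
  by (intro v_axiom0 DW)

lemma box_refine:
  assumes "wf_ode F" "v (Box (ODE F Q) R)" "v (Box (ODE F R) \<phi>)"
  shows "v (Box (ODE F Q) \<phi>)"
proof -
  have "der [R] (Imp Q R)" by (intro ImpR der_assm) simp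
  then have "v (Box (ODE F Q) (Imp Q R))" using assms(2) by (rule box_mono)
  then show ?thesis using v_axiom0[OF DMP[OF assms(1), of Q R \<phi>]] assms(3) by simp
qed

lemma dia_refine:
  assumes "wf_ode F" "v (Box (ODE F Q) R)" "v (Dia (ODE F Q) \<phi>)"
  shows "v (Dia (ODE F R) \<phi>)"
  using assms box_refine[of F Q R "Not \<phi>"] by (auto simp: dia_iff)

end

lemma der_fol:
  assumes "is_fol \<phi>" "\<And>\<psi>. \<psi> \<in> set \<Gamma> \<Longrightarrow> is_fol \<psi>"
    and "\<And>\<omega>. \<forall>\<psi>\<in>set \<Gamma>. \<omega> \<in> fsem \<psi> \<Longrightarrow> \<omega> \<in> fsem \<phi>"
  shows "der \<Gamma> \<phi>"
  by (intro derI) (rule valuation.v_fol[OF _ assms(1,2) _ assms(3)]; blast)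

subsection \<open>Quantifiers without renaming\<close>

lemma drop_vars_PVar [simp]: "drop_vars B PVar = PVar"
  by (auto simp: drop_vars_def)

lemma safe_PVar [simp]: "safe PVar S B"
  by (simp add: safe_def)

lemma fsub_PVar [simp]: "fsub \<phi> PVar = \<phi>" and psub_PVar [simp]: "psub \<alpha> PVar = \<alpha>"
  by (induction \<phi> and \<alpha>) (simp_all add: map_idI split_def)

lemma fadm_PVar [simp]: "fadm \<phi> PVar" and padm_PVar [simp]: "padm \<alpha> PVar"
  by (induction \<phi> and \<alpha>) simp_all

lemma sub1_PVar [simp]: "sub1 x (PVar x) = PVar"
  by (auto simp: sub1_def)

text \<open>The bound variable itself serves as eigenvariable, for which the substitution is the
  identity and always admissible.\<close>

lemma der_ExistsE: "der (\<phi> # \<Gamma>) \<psi> \<Longrightarrow> x \<notin> FVs \<Gamma> \<union> FV \<psi> \<Longrightarrow> der (Exists x \<phi> # \<Gamma>) \<psi>"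
  by (rule ExistsL[of _ _ x]) auto

lemma der_ForallI: "der \<Gamma> \<phi> \<Longrightarrow> x \<notin> FVs \<Gamma> \<Longrightarrow> der \<Gamma> (Forall x \<phi>)"
  by (rule ForallR[of _ _ x]) auto

lemma der_ForallsI: "der \<Gamma> \<phi> \<Longrightarrow> set xs \<inter> FVs \<Gamma> = {} \<Longrightarrow> der \<Gamma> (Foralls xs \<phi>)"
  by (induction xs) (auto simp: Foralls_def intro: der_ForallI)

lemma FV_Foralls [simp]: "FV (Foralls xs \<phi>) = FV \<phi> - set xs"
  by (induction xs) (auto simp: Foralls_def)

context valuation
begin

lemma v_ExistsI: "v \<phi> \<Longrightarrow> v (Exists x \<phi>)"
proof -
  have "der [\<phi>] (Exists x \<phi>)" by (rule ExistsR[of _ _ "PVar x"]) (auto intro: der_assm)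
  then show "v \<phi> \<Longrightarrow> v (Exists x \<phi>)" by (rule v_der1)
qed

lemma v_ForallE: "v (Forall x \<phi>) \<Longrightarrow> v \<phi>"
proof -
  have "der [Forall x \<phi>] \<phi>" by (rule ForallL[of _ _ "PVar x"]) (auto intro: der_assm)
  then show "v (Forall x \<phi>) \<Longrightarrow> v \<phi>" by (rule v_der1)
qed

lemma v_ForallsE: "v (Foralls xs \<phi>) \<Longrightarrow> v \<phi>"
  by (induction xs) (auto simp: Foralls_def dest: v_ForallE)

end

lemma peval_upd_notin: "x \<notin> pvars e \<Longrightarrow> peval (\<omega>(x := r)) e = peval \<omega> e"
  by (rule peval_cong) auto

text \<open>A fresh variable may record the current value of \<open>e\<close>: that such a value
  exists is arithmetic, and freshness makes the variable an eigenvariable.\<close>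

lemma der_fresh:
  assumes "der (Eq (PVar x) e # \<Gamma>) \<psi>" "x \<notin> pvars e \<union> FVs \<Gamma> \<union> FV \<psi>"
  shows "der \<Gamma> \<psi>"
proof (rule Cut)
  show "der \<Gamma> (Exists x (Eq (PVar x) e))"
    by (rule der_valid) (use assms(2) in \<open>auto simp: valid_def peval_upd_notin\<close>)
  show "der (Exists x (Eq (PVar x) e) # \<Gamma>) \<psi>"
    using assms by (intro der_ExistsE) auto
qed

lemma is_fol_VecEq [simp]: "is_fol (VecEq xs ys)"
  by (auto simp: VecEq_def)

lemma fsem_VecEq [simp]:
  "length xs = length ys \<Longrightarrow> fsem (VecEq xs ys) = {\<omega>. map \<omega> xs = map \<omega> ys}"
  by (induction xs ys rule: list_induct2) (auto simp: VecEq_def)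

lemma FV_VecEq: "FV (VecEq xs ys) \<subseteq> set xs \<union> set ys"
  by (auto simp: VecEq_def FVs_def dest: set_zip_leftD set_zip_rightD)

lemma der_fresh_vec:
  assumes "der (VecEq xs ys # \<Gamma>) \<psi>" "length xs = length ys" "distinct xs"
    "set xs \<inter> (set ys \<union> FVs \<Gamma> \<union> FV \<psi>) = {}"
  shows "der \<Gamma> \<psi>"
proof -
  \<comment> \<open>With the vector equation split up, \<open>der_fresh\<close> can discharge one
    coordinate at a time; no remaining equation mentions the recorded variable.\<close>
  have "der (map (\<lambda>(x, y). Eq (PVar x) (PVar y)) (zip xs ys) @ \<Gamma>) \<psi>"
  proof (rule derI)
    fix v assume v: "valuation v"
      "\<forall>\<chi>\<in>set (map (\<lambda>(x, y). Eq (PVar x) (PVar y)) (zip xs ys) @ \<Gamma>). v \<chi>"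
    interpret valuation v by fact
    have "v (VecEq xs ys)" unfolding VecEq_def v_Conj using v(2) by simp
    then show "v \<psi>" using v_der[OF assms(1)] v(2) by auto
  qed
  then show ?thesis using assms(2-)
  proof (induction xs ys rule: list_induct2')
    case (4 x xs y ys)
    let ?E = "map (\<lambda>(x, y). Eq (PVar x) (PVar y)) (zip xs ys) :: fml list"
    have "FVs ?E \<subseteq> set xs \<union> set ys"
      by (auto simp: FVs_def dest: set_zip_leftD set_zip_rightD)
    then have "x \<notin> pvars (PVar y) \<union> FVs (?E @ \<Gamma>) \<union> FV \<psi>" using 4(4,5) by auto
    moreover have "der (Eq (PVar x) (PVar y) # ?E @ \<Gamma>) \<psi>" using 4(2) by simp
    ultimately have "der (?E @ \<Gamma>) \<psi>" by (rule der_fresh[rotated])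
    then show ?case by (rule 4(1)) (use 4(3-) in auto)
  qed auto
qed

section \<open>Darboux invariants\<close>

lemma finite_FV [simp]: "finite (FV \<phi>)" and finite_FVp [simp]: "finite (FVp \<alpha>)"
  by (induction \<phi> and \<alpha>) (auto simp: ode_vars_def)

lemma ex_fresh_vec:
  assumes "finite (S :: var set)"
  shows "\<exists>ys. length ys = n \<and> distinct ys \<and> set ys \<inter> S = {}"
proof (induction n)
  case (Suc n)
  then obtain ys where ys: "length ys = n" "distinct ys" "set ys \<inter> S = {}" by blast
  obtain y where "y \<notin> S \<union> set ys" using assms ex_new_if_finite[of "S \<union> set ys"] by auto
  then show ?case using ys by (intro exI[of _ "y # ys"]) auto
qed simp

lemma wf_ode_snoc: "wf_ode F \<Longrightarrow> y \<notin> ode_vars F \<Longrightarrow> wf_ode (F @ [(y, e)])"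
  by (auto simp: wf_ode_def ode_vars_def)

context valuation
begin

lemma DI_geq:
  assumes "wf_ode F" "v (Box (ODE F Q) (Geq (lie F p) 0))" "v (Geq p 0)"
  shows "v (Box (ODE F Q) (Geq p 0))"
  using v_axiom0[OF DIgeq[OF assms(1), of Q p]] assms(2,3) by simp

lemma DI_eq:
  assumes "wf_ode F" "v (Box (ODE F Q) (Eq (lie F p) 0))" "v (Eq p 0)"
  shows "v (Box (ODE F Q) (Eq p 0))"
  using v_axiom0[OF DIeq[OF assms(1), of Q p]] assms(2,3) by simp

end

text \<open>(DG) read from right to left leaves the initial value of the ghost open, so it may be
  fixed to any \<open>e\<close>.\<close>

lemma der_ghost:
  assumes "wf_ode F" "y \<notin> FVp (ODE F Q) \<union> FV \<phi> \<union> pvars a \<union> pvars b" "y \<notin> pvars e \<union> FVs \<Gamma>"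
    and "der (Eq (PVar y) e # \<Gamma>) (Box (ODE (F @ [(y, a * PVar y + b)]) Q) \<phi>)"
  shows "der \<Gamma> (Box (ODE F Q) \<phi>)"
proof (rule der_fresh)
  show "der (Eq (PVar y) e # \<Gamma>) (Box (ODE F Q) \<phi>)"
  proof (rule derI)
    fix v assume v: "valuation v" "\<forall>\<psi>\<in>set (Eq (PVar y) e # \<Gamma>). v \<psi>"
    interpret valuation v by fact
    have "v (Box (ODE (F @ [(y, a * PVar y + b)]) Q) \<phi>)" using v_der[OF assms(4)] v(2) by blast
    then have "v (Exists y (Box (ODE (F @ [(y, a * PVar y + b)]) Q) \<phi>))" by (rule v_ExistsI)
    then show "v (Box (ODE F Q) \<phi>)" using v_axiom0[OF DG[OF assms(1,2)]] by simp
  qed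
qed (use assms(2,3) in auto)

text \<open>A ghost \<open>y' = -2hy\<close> makes \<open>py\<close> nondecreasing as long as \<open>y > 0\<close>, and a second
  ghost \<open>z' = hz\<close> keeps \<open>y\<close> positive through the invariant \<open>yz\<^sup>2 = 1\<close>.\<close>

lemma darboux_geq:
  assumes wf: "wf_ode G"
    and ineq: "\<And>\<omega>. peval \<omega> (lie G p) \<ge> 2 * peval \<omega> h * peval \<omega> p"
  shows "der [Geq p 0] (Box (ODE G TT) (Geq p 0))"
proof -
  let ?S = "FVp (ODE G TT) \<union> pvars p \<union> pvars h"
  have fin: "finite ?S" by (intro finite_UnI finite_FVp pvars_finite)
  obtain y where y: "y \<notin> ?S" using ex_new_if_finite[OF _ fin] infinite_UNIV_nat by blast
  obtain z where "z \<notin> insert y ?S"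
    using ex_new_if_finite[of "insert y ?S"] fin infinite_UNIV_nat by blast
  with y have yz: "y \<noteq> z" "y \<notin> ?S" "z \<notin> ?S" by simp_all
  \<comment> \<open>The factor 2 balances the square: \<open>z * z\<close> grows at rate
    \<open>2 * h\<close>, so \<open>y * (z * z)\<close> is constant.\<close>
  define a where "a = - (2 * h)"
  have a_vars: "pvars a \<subseteq> pvars h" using pvars_mult[of 2 h] by (simp add: a_def)
  define G1 where "G1 = G @ [(y, a * PVar y + 0)]"
  define G2 where "G2 = G1 @ [(z, h * PVar z + 0)]"
  have wf1: "wf_ode G1" using wf yz by (simp add: G1_def wf_ode_snoc)
  have wf2: "wf_ode G2" unfolding G2_def
    by (rule wf_ode_snoc[OF wf1]) (use yz in \<open>auto simp: G1_def ode_vars_def\<close>)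
  have lie_y1: "lie G1 (PVar y) = a * PVar y" and lie_y2: "lie G2 (PVar y) = a * PVar y"
    and lie_z: "lie G2 (PVar z) = h * PVar z"
    using wf1 wf2 by (auto simp: G1_def G2_def wf_ode_def intro!: lie_PVar)
  have lie_p: "lie G1 p = lie G p"
    using yz by (simp add: G1_def lie_append lie_notin[of "[(y, _)]"] ode_vars_def)
  have pos: "der [Eq (PVar y) 1] (Box (ODE G1 TT) (Gt (PVar y) 0))"
  proof (rule der_ghost[where y = z and a = h and b = 0 and e = 1])
    have "pvars (a * PVar y) \<subseteq> pvars h \<union> {y}" using pvars_mult[of a "PVar y"] a_vars by auto
    then show "z \<notin> FVp (ODE G1 TT) \<union> FV (Gt (PVar y) 0) \<union> pvars h \<union> pvars 0"
      using yz by (auto simp: G1_def ode_vars_def)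
    show "der [Eq (PVar z) 1, Eq (PVar y) 1] (Box (ODE (G1 @ [(z, h * PVar z + 0)]) TT) (Gt (PVar y) 0))"
      unfolding G2_def[symmetric]
    proof (rule derI)
      fix v assume v: "valuation v" "\<forall>\<psi>\<in>set [Eq (PVar z) 1, Eq (PVar y) 1]. v \<psi>"
      interpret valuation v by fact
      let ?w = "PVar y * (PVar z * PVar z) - 1"
      have "lie G2 ?w = 0"
        by (simp add: lie_mult lie_y2 lie_z a_def algebra_simps)
      then have "v (Box (ODE G2 TT) (Eq (lie G2 ?w) 0))"
        by (intro nec der_valid) (simp_all add: valid_def)
      moreover have "v (Eq ?w 0)"
        by (rule v_fol[of _ "[Eq (PVar z) 1, Eq (PVar y) 1]"]) (use v(2) in auto)
      ultimately have "v (Box (ODE G2 TT) (Eq ?w 0))" by (rule DI_eq[OF wf2])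
      moreover have "der [Eq ?w 0] (Gt (PVar y) 0)"
      proof (rule der_fol)
        fix \<omega> assume "\<forall>\<psi>\<in>set [Eq ?w 0]. \<omega> \<in> fsem \<psi>"
        then have "\<omega> y * (\<omega> z * \<omega> z) = 1" by simp
        then have "\<omega> y > 0" by (metis not_square_less_zero zero_less_mult_iff zero_less_one order.asym)
        then show "\<omega> \<in> fsem (Gt (PVar y) 0)" by simp
      qed auto
      ultimately show "v (Box (ODE G2 TT) (Gt (PVar y) 0))" by (rule box_mono[rotated])
    qed
  qed (use wf1 yz in auto)
  show ?thesis
  proof (rule der_ghost[where y = y and a = a and b = 0 and e = 1])
    show "y \<notin> FVp (ODE G TT) \<union> FV (Geq p 0) \<union> pvars a \<union> pvars 0"
      using yz a_vars by auto
    show "der [Eq (PVar y) 1, Geq p 0] (Box (ODE (G @ [(y, a * PVar y + 0)]) TT) (Geq p 0))"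
      unfolding G1_def[symmetric]
    proof (rule derI)
      fix v assume v: "valuation v" "\<forall>\<psi>\<in>set [Eq (PVar y) 1, Geq p 0]. v \<psi>"
      interpret valuation v by fact
      have y_pos: "v (Box (ODE G1 TT) (Gt (PVar y) 0))"
        using v_der1[OF pos] v(2) by simp
      have "der [Gt (PVar y) 0] (Geq (lie G1 (p * PVar y)) 0)"
      proof (rule der_fol)
        fix \<omega> assume "\<forall>\<psi>\<in>set [Gt (PVar y) 0]. \<omega> \<in> fsem \<psi>"
        then have "\<omega> y > 0" by simp
        \<comment> \<open>The left-hand side is the value of the Lie derivative of
          \<open>p * PVar y\<close> along \<open>G1\<close>.\<close>
        then have "\<omega> y * (peval \<omega> (lie G p) - 2 * peval \<omega> h * peval \<omega> p) \<ge> 0"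
          using ineq[of \<omega>] by simp
        then show "\<omega> \<in> fsem (Geq (lie G1 (p * PVar y)) 0)"
          by (simp add: lie_mult lie_p lie_y1 a_def algebra_simps)
      qed auto
      then have "v (Box (ODE G1 TT) (Geq (lie G1 (p * PVar y)) 0))" using y_pos by (rule box_mono)
      moreover have "v (Geq (p * PVar y) 0)"
        by (rule v_fol[of _ "[Eq (PVar y) 1, Geq p 0]"]) (use v(2) in auto)
      ultimately have py: "v (Box (ODE G1 TT) (Geq (p * PVar y) 0))" by (rule DI_geq[OF wf1])
      have "der [Gt (PVar y) 0, Geq (p * PVar y) 0] (Geq p 0)"
      proof (rule der_fol)
        fix \<omega> assume "\<forall>\<psi>\<in>set [Gt (PVar y) 0, Geq (p * PVar y) 0]. \<omega> \<in> fsem \<psi>"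
        then have "\<omega> y > 0" "peval \<omega> p * \<omega> y \<ge> 0" by auto
        then show "\<omega> \<in> fsem (Geq p 0)" by (simp add: zero_le_mult_iff)
      qed auto
      then show "v (Box (ODE G1 TT) (Geq p 0))" by (rule box_der) (use y_pos py in auto)
    qed
  qed (use wf yz in auto)
qed

lemma is_fol_lie_zero [simp]: "is_fol (lie_zero F n p)"
  by (simp add: lie_zero_def)

lemma fsem_lie_zero [simp]: "fsem (lie_zero F n p) = {\<omega>. \<forall>i<n. peval \<omega> (lie_pow F i p) = 0}"
  by (auto simp: lie_zero_def)

text \<open>The left-hand side is the derivative of a sum of squares \<open>r\<close> whose terms
  are consecutive Lie derivatives. By \<open>2xy \<le> x^2 + y^2\<close> the inner products
  contribute at most \<open>2r\<close> and the last one, after expanding \<open>a N\<close>, at most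
  \<open>r\<close> plus \<open>r\<close> times the sum of the squared \<open>g j\<close>. The
  resulting factor 3 is rounded up to 4 to fit the form \<open>2 * h\<close> of
  \<open>darboux_geq\<close>.\<close>

lemma consecutive_products_le:
  fixes a g :: "nat \<Rightarrow> real"
  assumes "N \<ge> 1" "a N = (\<Sum>j<N. g j * a j)"
  shows "(\<Sum>i<N. 2 * (a i * a (Suc i))) \<le> 2 * (2 + (\<Sum>j<N. g j * g j)) * (\<Sum>i<N. a i * a i)"
proof -
  obtain M where M: "N = Suc M" using assms(1) by (cases N) auto
  define r where "r = (\<Sum>i<N. a i * a i)"
  have amgm: "2 * (x * y) \<le> x * x + y * y" for x y :: real
    using sum_squares_bound[of x y] by (simp add: power2_eq_square)
  have r_eq: "r = (\<Sum>i<M. a i * a i) + a M * a M" "r = a 0 * a 0 + (\<Sum>i<M. a (Suc i) * a (Suc i))"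
    unfolding r_def M by (simp, rule sum.lessThan_Suc_shift)
  have sq: "x * x \<ge> 0" for x :: real by simp
  have aM: "a M * a M \<le> r" unfolding r_eq(1) by (simp add: sum_nonneg)
  have "(\<Sum>i<M. 2 * (a i * a (Suc i))) \<le> (\<Sum>i<M. a i * a i + a (Suc i) * a (Suc i))"
    by (intro sum_mono amgm)
  also have "\<dots> \<le> r + r"
    using r_eq sq[of "a 0"] sq[of "a M"] unfolding sum.distrib by linarith
  finally have lower: "(\<Sum>i<M. 2 * (a i * a (Suc i))) \<le> 2 * r" by simp
  have "2 * (a M * a N) = (\<Sum>j<N. 2 * ((g j * a M) * a j))"
    by (simp add: assms(2) sum_distrib_left mult_ac)
  also have "\<dots> \<le> (\<Sum>j<N. (g j * a M) * (g j * a M) + a j * a j)"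
    by (intro sum_mono amgm)
  also have "\<dots> = (\<Sum>j<N. g j * g j) * (a M * a M) + r"
    by (simp add: sum.distrib r_def sum_distrib_left sum_distrib_right mult_ac)
  also have "\<dots> \<le> (\<Sum>j<N. g j * g j) * r + r"
    using aM by (simp add: mult_left_mono sum_nonneg)
  finally have "(\<Sum>i<N. 2 * (a i * a (Suc i))) \<le> (3 + (\<Sum>j<N. g j * g j)) * r"
    using lower M by (simp add: algebra_simps)
  also have "\<dots> \<le> 2 * (2 + (\<Sum>j<N. g j * g j)) * r"
    by (rule mult_right_mono) (simp_all add: sum_nonneg r_def)
  finally show ?thesis by (simp add: r_def)
qed

text \<open>The negated sum of squares of the first \<open>N\<close> Lie derivatives satisfies a scalar Darboux
  inequality.\<close>

lemma rad_invariant: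
  assumes wf: "wf_ode G" and N: "N \<ge> 1" and rel: "lie_pow G N p = (\<Sum>i<N. g i * lie_pow G i p)"
  shows "der [lie_zero G N p] (Box (ODE G TT) (Eq p 0))"
proof -
  define r where "r = (\<Sum>i<N. lie_pow G i p * lie_pow G i p)"
  define h where "h = 2 + (\<Sum>j<N. g j * g j)"
  have darboux: "peval \<omega> (lie G (- r)) \<ge> 2 * peval \<omega> h * peval \<omega> (- r)" for \<omega>
  proof -
    let ?a = "\<lambda>i. peval \<omega> (lie_pow G i p)"
    have "lie G r = (\<Sum>i<N. 2 * (lie_pow G i p * lie_pow G (Suc i) p))"
      unfolding r_def lie_sum lie_mult lie_pow_Suc
      by (rule sum.cong) (simp_all only: mult_2 mult.commute)
    then have "peval \<omega> (lie G r) = (\<Sum>i<N. 2 * (?a i * ?a (Suc i)))" by simp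
    moreover have "?a N = (\<Sum>j<N. peval \<omega> (g j) * ?a j)" by (simp add: rel)
    ultimately show ?thesis
      using consecutive_products_le[OF N, of ?a "\<lambda>j. peval \<omega> (g j)"] by (simp add: r_def h_def)
  qed
  show ?thesis
  proof (rule derI)
    fix v assume v: "valuation v" "\<forall>\<psi>\<in>set [lie_zero G N p]. v \<psi>"
    interpret valuation v by fact
    have "v (Geq (- r) 0)"
      by (rule v_fol[of _ "[lie_zero G N p]"]) (use v(2) in \<open>auto simp: r_def\<close>)
    then have "v (Box (ODE G TT) (Geq (- r) 0))"
      using v_der1[OF darboux_geq[OF wf darboux]] by simp
    moreover have "der [Geq (- r) 0] (Eq p 0)"
    proof (rule der_fol)
      fix \<omega> assume "\<forall>\<psi>\<in>set [Geq (- r) 0]. \<omega> \<in> fsem \<psi>"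
      then have "(\<Sum>i<N. peval \<omega> (lie_pow G i p) * peval \<omega> (lie_pow G i p)) \<le> 0" by (simp add: r_def)
      then have "\<forall>i\<in>{..<N}. peval \<omega> (lie_pow G i p) * peval \<omega> (lie_pow G i p) = 0"
        by (subst sum_nonneg_eq_0_iff[symmetric]) (auto intro!: antisym sum_nonneg)
      then have "peval \<omega> (lie_pow G 0 p) = 0" using N by (metis lessThan_iff mult_eq_0_iff Suc_le_eq One_nat_def)
      then show "\<omega> \<in> fsem (Eq p 0)" by simp
    qed auto
    ultimately show "v (Box (ODE G TT) (Eq p 0))" by (rule box_mono[rotated])
  qed
qed

section \<open>Local progress\<close>

text \<open>A disjunctive form of \<open>Prog_gt\<close>, suited to case distinctions. The bound
  \<open>N\<close> is a parameter because the formula is also applied to \<open>- p\<close> and to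
  perturbations of \<open>p\<close>, with the bound still taken from \<open>p\<close>.\<close>

definition first_pos :: "ode \<Rightarrow> nat \<Rightarrow> trm \<Rightarrow> fml" where
  "first_pos F N p = Disj (map (\<lambda>k. And (lie_zero F k p) (Gt (lie_pow F k p) 0)) [0..<N])"

lemma is_fol_first_pos [simp]: "is_fol (first_pos F N p)"
  by (simp add: first_pos_def)

lemma fsem_first_pos [simp]: "fsem (first_pos F N p) =
    {\<omega>. \<exists>k<N. (\<forall>i<k. peval \<omega> (lie_pow F i p) = 0) \<and> peval \<omega> (lie_pow F k p) > 0}"
  by (auto simp: first_pos_def)

locale clocked_ode =
  fixes G :: ode and xs :: "var list"
  assumes wf: "wf_ode G" and clock: "has_clock G" and xs: "xs = map fst G"
begin

lemma set_xs: "set xs = ode_vars G"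
  by (simp add: xs ode_vars_def)

text \<open>As \<open>fresh_vec\<close>, but relative to any set of variables instead of one domain,
  so that one vector serves several domains.\<close>

definition fresh :: "var list \<Rightarrow> var set \<Rightarrow> bool" where
  "fresh ys S \<longleftrightarrow> distinct ys \<and> length ys = length G \<and> set ys \<inter> (FVp (ODE G TT) \<union> S) = {}"

lemma fresh_length: "fresh ys S \<Longrightarrow> length xs = length ys"
  by (simp add: fresh_def xs)

lemma fresh_subset: "fresh ys S \<Longrightarrow> T \<subseteq> S \<Longrightarrow> fresh ys T"
  by (auto simp: fresh_def)

lemma cont:
  assumes "valuation v" "fresh ys (pvars p)" "v (VecEq xs ys)" "v (Gt p 0)"
  shows "v (Dia (ODE G (Gt p 0)) (VecNeq xs ys))"
proof -
  interpret valuation v by fact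
  have "fresh_vec ys G (Gt p 0)" using assms(2) by (auto simp: fresh_def fresh_vec_def)
  then show ?thesis using v_axiom1[OF Cont[OF wf clock xs]] assms(3,4) by simp
qed

text \<open>The induction varies \<open>p\<close>: the Lie derivatives of \<open>lie G p\<close> are
  those of \<open>p\<close> with the order shifted by one. (Cont) is used at order 0, (DI) in each
  step, where \<open>p\<close> is 0 initially.\<close>

lemma local_progress_order:
  assumes "fresh ys (pvars p)"
  shows "der [VecEq xs ys, lie_zero G k p, Gt (lie_pow G k p) 0] (Dia (ODE G (Geq p 0)) (VecNeq xs ys))"
  using assms
proof (induction k arbitrary: p)
  case 0
  show ?case
  proof (rule derI)
    fix v assume v: "valuation v"
      "\<forall>\<psi>\<in>set [VecEq xs ys, lie_zero G 0 p, Gt (lie_pow G 0 p) 0]. v \<psi>"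
    interpret valuation v by fact
    have "v (Dia (ODE G (Gt p 0)) (VecNeq xs ys))" using cont[OF v(1) 0] v(2) by simp
    moreover have "v (Box (ODE G (Gt p 0)) (Geq p 0))"
      by (rule box_mono[OF der_fol box_domain[OF wf]]) auto
    ultimately show "v (Dia (ODE G (Geq p 0)) (VecNeq xs ys))" using dia_refine wf by blast
  qed
next
  case (Suc k)
  show ?case
  proof (rule derI)
    fix v assume v: "valuation v"
      "\<forall>\<psi>\<in>set [VecEq xs ys, lie_zero G (Suc k) p, Gt (lie_pow G (Suc k) p) 0]. v \<psi>"
    interpret valuation v by fact
    have "fresh ys (pvars (lie G p))" using Suc.prems pvars_lie[of G p] by (auto simp: fresh_def)
    note IH = Suc.IH[OF this]
    have z: "v (lie_zero G (Suc k) p)" using v(2) by simp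
    have "v (lie_zero G k (lie G p))"
      by (rule v_fol[of _ "[lie_zero G (Suc k) p]"]) (use z in \<open>auto simp flip: lie_pow_Suc2\<close>)
    then have "v (Dia (ODE G (Geq (lie G p) 0)) (VecNeq xs ys))"
      using v(2) by (intro v_der[OF IH]) (auto simp flip: lie_pow_Suc2)
    moreover have "v (Geq p 0)"
    proof (rule v_fol[of _ "[lie_zero G (Suc k) p]"])
      fix \<omega> assume "\<forall>\<psi>\<in>set [lie_zero G (Suc k) p]. \<omega> \<in> fsem \<psi>"
      then have "peval \<omega> (lie_pow G 0 p) = 0" by (simp del: lie_pow_0)
      then show "\<omega> \<in> fsem (Geq p 0)" by simp
    qed (use z in auto)
    then have "v (Box (ODE G (Geq (lie G p) 0)) (Geq p 0))"
      by (rule DI_geq[OF wf box_domain[OF wf]])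
    ultimately show "v (Dia (ODE G (Geq p 0)) (VecNeq xs ys))" using dia_refine wf by blast
  qed
qed

lemma local_progress_first_pos:
  assumes "fresh ys (pvars p)"
  shows "der [VecEq xs ys, first_pos G N p] (Dia (ODE G (Geq p 0)) (VecNeq xs ys))"
proof (rule derI)
  fix v assume v: "valuation v" "\<forall>\<psi>\<in>set [VecEq xs ys, first_pos G N p]. v \<psi>"
  interpret valuation v by fact
  have "v (first_pos G N p)" using v(2) by simp
  then obtain k where "v (lie_zero G k p)" "v (Gt (lie_pow G k p) 0)"
    unfolding first_pos_def v_Disj by auto
  then show "v (Dia (ODE G (Geq p 0)) (VecNeq xs ys))"
    using v(2) by (intro v_der[OF local_progress_order[OF assms]]) auto
qed

text \<open>The disjunct \<open>VecEq xs ys\<close> exempts the initial state, where a strict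
  \<open>Q\<close> may still fail. It is also the shape of the domain in (RI).\<close>

definition local_progress :: "var list \<Rightarrow> fml \<Rightarrow> fml \<Rightarrow> bool" where
  "local_progress ys \<phi> Q \<longleftrightarrow>
     der [VecEq xs ys, \<phi>] (Dia (ODE G (Or Q (VecEq xs ys))) (VecNeq xs ys))"

lemma local_progressD:
  assumes "valuation v" "local_progress ys \<phi> Q" "v (VecEq xs ys)" "v \<phi>"
  shows "v (Dia (ODE G (Or Q (VecEq xs ys))) (VecNeq xs ys))"
proof -
  interpret valuation v by fact
  show ?thesis using assms(2-) unfolding local_progress_def by (elim v_der) auto
qed

lemma local_progress_mono:
  assumes "local_progress ys \<phi> Q" "is_fol \<phi>" "is_fol \<phi>'" "fsem \<phi>' \<subseteq> fsem \<phi>" "der [Q] Q'"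
  shows "local_progress ys \<phi>' Q'"
  unfolding local_progress_def
proof (rule derI)
  fix v assume v: "valuation v" "\<forall>\<psi>\<in>set [VecEq xs ys, \<phi>']. v \<psi>"
  interpret valuation v by fact
  have "v \<phi>" by (rule v_fol[of _ "[\<phi>']"]) (use assms v(2) in auto)
  then have "v (Dia (ODE G (Or Q (VecEq xs ys))) (VecNeq xs ys))"
    using v(2) by (intro local_progressD[OF v(1) assms(1)]) simp_all
  moreover have "der [Or Q (VecEq xs ys)] (Or Q' (VecEq xs ys))"
  proof (rule derI)
    fix w assume w: "valuation w" "\<forall>\<psi>\<in>set [Or Q (VecEq xs ys)]. w \<psi>"
    interpret w: valuation w by fact
    show "w (Or Q' (VecEq xs ys))" using w(2) w.v_der1[OF assms(5)] by auto
  qed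
  then have "v (Box (ODE G (Or Q (VecEq xs ys))) (Or Q' (VecEq xs ys)))"
    by (rule box_mono[OF _ box_domain[OF wf]])
  ultimately show "v (Dia (ODE G (Or Q' (VecEq xs ys))) (VecNeq xs ys))" using dia_refine wf by blast
qed

lemma local_progress_And:
  assumes "local_progress ys \<phi>1 Q1" "local_progress ys \<phi>2 Q2"
  shows "local_progress ys (And \<phi>1 \<phi>2) (And Q1 Q2)"
  unfolding local_progress_def
proof (rule derI)
  fix v assume v: "valuation v" "\<forall>\<psi>\<in>set [VecEq xs ys, And \<phi>1 \<phi>2]. v \<psi>"
  interpret valuation v by fact
  let ?E = "VecEq xs ys"
  have "v (And \<phi>1 \<phi>2)" using v(2) by simp
  then have "v (Dia (ODE G (Or Q1 ?E)) (Not ?E))" "v (Dia (ODE G (Or Q2 ?E)) (Not ?E))"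
    using local_progressD[OF v(1) assms(1)] local_progressD[OF v(1) assms(2)] v(2) by simp_all
  then have d: "v (Dia (ODE G (And (Or Q1 ?E) (Or Q2 ?E))) (Or (Not ?E) (Not ?E)))"
    using v_axiom1[OF Uniq[OF wf]] by simp
  have "der [Or (Not ?E) (Not ?E)] (Not ?E)"
    by (rule derI) (auto simp: valuation.v_Or valuation.v_Not)
  then have "v (Dia (ODE G (And (Or Q1 ?E) (Or Q2 ?E))) (Not ?E))" using d by (rule dia_mono)
  moreover have "der [And (Or Q1 ?E) (Or Q2 ?E)] (Or (And Q1 Q2) ?E)"
    by (rule derI) (auto simp: valuation.v_Or valuation.v_And)
  then have "v (Box (ODE G (And (Or Q1 ?E) (Or Q2 ?E))) (Or (And Q1 Q2) ?E))"
    by (rule box_mono[OF _ box_domain[OF wf]])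
  ultimately show "v (Dia (ODE G (Or (And Q1 Q2) ?E)) (Not ?E))" using dia_refine wf by blast
qed

lemma local_progress_Or:
  assumes "local_progress ys \<phi>1 Q1" "is_fol \<phi>1" "local_progress ys \<phi>2 Q2" "is_fol \<phi>2"
  shows "local_progress ys (Or \<phi>1 \<phi>2) (Or Q1 Q2)"
proof -
  have "der [Q1] (Or Q1 Q2)" by (intro OrR1 der_assm) simp
  then have 1: "local_progress ys \<phi>1 (Or Q1 Q2)" using assms by (blast intro: local_progress_mono)
  have "der [Q2] (Or Q1 Q2)" by (intro OrR2 der_assm) simp
  then have 2: "local_progress ys \<phi>2 (Or Q1 Q2)" using assms by (blast intro: local_progress_mono)
  show ?thesis
    unfolding local_progress_def
  proof (rule derI)
    fix v assume v: "valuation v" "\<forall>\<psi>\<in>set [VecEq xs ys, Or \<phi>1 \<phi>2]. v \<psi>"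
    interpret valuation v by fact
    have "v (Or \<phi>1 \<phi>2)" "v (VecEq xs ys)" using v(2) by simp_all
    then show "v (Dia (ODE G (Or (Or Q1 Q2) (VecEq xs ys))) (VecNeq xs ys))"
      using 1 2 v(1) local_progressD by (metis v_Or)
  qed
qed

text \<open>(Cont) for the constant polynomial 1 yields a run that leaves its start.\<close>

lemma local_progress_TT:
  assumes "fresh ys {}"
  shows "local_progress ys TT TT"
  unfolding local_progress_def
proof (rule derI)
  fix v assume v: "valuation v" "\<forall>\<psi>\<in>set [VecEq xs ys, TT]. v \<psi>"
  interpret valuation v by fact
  have "v (Gt 1 0)" by (rule v_fol[of _ "[]"]) auto
  then have "v (Dia (ODE G (Gt 1 0)) (VecNeq xs ys))" using cont[OF v(1), of ys 1] v(2) assms by simp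
  moreover have "der [Gt 1 0] (Or TT (VecEq xs ys))"
    by (rule der_fol) auto
  then have "v (Box (ODE G (Gt 1 0)) (Or TT (VecEq xs ys)))" by (rule box_mono[OF _ box_domain[OF wf]])
  ultimately show "v (Dia (ODE G (Or TT (VecEq xs ys))) (VecNeq xs ys))" using dia_refine wf by blast
qed

lemma local_progress_FF: "local_progress ys FF Q"
  unfolding local_progress_def by (rule der_FF, rule der_assm) simp

lemma local_progress_Conj:
  assumes "fresh ys {}" "\<And>i. i \<in> set l \<Longrightarrow> local_progress ys (f i) (g i)"
  shows "local_progress ys (Conj (map f l)) (Conj (map g l))"
  using assms(2)
proof (induction l rule: induct_list012)
  case 1
  show ?case using local_progress_TT[OF assms(1)] by simp
qed (simp_all add: local_progress_And)

lemma local_progress_Disj: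
  assumes "\<And>i. i \<in> set l \<Longrightarrow> local_progress ys (f i) (g i) \<and> is_fol (f i)"
  shows "local_progress ys (Disj (map f l)) (Disj (map g l))"
  using assms
proof (induction l rule: induct_list012)
  case 1
  show ?case using local_progress_FF by simp
next
  case (3 i j l)
  have "is_fol (Disj (f j # map f l))" using 3(3) by simp
  then show ?case using 3 by (simp add: local_progress_Or)
qed simp_all

lemma local_progress_Geq:
  assumes ys: "fresh ys (pvars p)" and N: "N \<ge> 1"
    and rel: "lie_pow G N p = (\<Sum>i<N. g i * lie_pow G i p)"
  shows "local_progress ys (Or (first_pos G N p) (lie_zero G N p)) (Geq p 0)"
  unfolding local_progress_def
proof (rule derI)
  fix v assume v: "valuation v"
    "\<forall>\<psi>\<in>set [VecEq xs ys, Or (first_pos G N p) (lie_zero G N p)]. v \<psi>"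
  interpret valuation v by fact
  have E: "v (VecEq xs ys)" using v(2) by simp
  \<comment> \<open>Both cases provide a domain \<open>Q\<close> with a run that leaves its start
    and with \<open>p \<ge> 0\<close> along it: \<open>Geq p 0\<close> itself, or the trivial domain
    \<open>Gt 1 0\<close>, on which the radical keeps \<open>p = 0\<close>.\<close>
  have "\<exists>Q. der [Q] (Geq p 0) \<and> v (Dia (ODE G Q) (VecNeq xs ys)) \<or>
      v (Box (ODE G Q) (Geq p 0)) \<and> v (Dia (ODE G Q) (VecNeq xs ys))"
  proof (cases "v (first_pos G N p)")
    case True
    then have "v (Dia (ODE G (Geq p 0)) (VecNeq xs ys))"
      using E by (intro v_der[OF local_progress_first_pos[OF ys, of N]]) auto
    then show ?thesis using der_assm[of "Geq p 0" "[Geq p 0]"] by auto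
  next
    case False
    then have "v (lie_zero G N p)" using v(2) by simp
    then have "v (Box (ODE G TT) (Eq p 0))" by (rule v_der1[OF rad_invariant[OF wf N rel]])
    then have "v (Box (ODE G TT) (Geq p 0))" by (rule box_mono[rotated]) (auto intro!: der_fol)
    moreover have "v (Box (ODE G (Gt 1 0)) TT)" by (intro nec der_valid) (simp_all add: valid_def)
    ultimately have "v (Box (ODE G (Gt 1 0)) (Geq p 0))" using box_refine wf by blast
    moreover have "v (Gt 1 0)" by (rule v_fol[of _ "[]"]) auto
    then have "v (Dia (ODE G (Gt 1 0)) (VecNeq xs ys))"
      using cont[OF v(1), of ys 1] E fresh_subset[OF ys, of "{}"] by simp
    ultimately show ?thesis by blast
  qed
  then obtain Q where Q: "v (Box (ODE G Q) (Geq p 0))" "v (Dia (ODE G Q) (VecNeq xs ys))"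
    using box_mono box_domain[OF wf] by blast
  have "der [Geq p 0] (Or (Geq p 0) (VecEq xs ys))" by (intro OrR1 der_assm) simp
  then have "v (Box (ODE G Q) (Or (Geq p 0) (VecEq xs ys)))" using Q(1) by (rule box_mono)
  then show "v (Dia (ODE G (Or (Geq p 0) (VecEq xs ys))) (VecNeq xs ys))"
    using Q(2) dia_refine wf by blast
qed

text \<open>The polynomial \<open>q = p - \<parallel>x - y\<parallel>\<^sup>2\<^sup>N\<close> has the same Lie derivatives as
  \<open>p\<close> of order below \<open>N\<close> where \<open>x = y\<close>, and \<open>q \<ge> 0\<close> implies \<open>p > 0\<close> elsewhere.  The
  vector \<open>ws\<close> is a copy of \<open>ys\<close> that does not occur in \<open>q\<close>.\<close>

lemma local_progress_Gt:
  assumes ys: "fresh ys (pvars p)"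
  shows "local_progress ys (first_pos G N p) (Gt p 0)"
proof -
  define u where "u = (\<Sum>i<length xs. (PVar (xs ! i) - PVar (ys ! i)) * (PVar (xs ! i) - PVar (ys ! i)))"
  define q where "q = p - u ^ N"
  have len: "length xs = length ys" using fresh_length[OF ys] .
  have u_eval: "peval \<omega> u = (\<Sum>i<length xs. (\<omega> (xs ! i) - \<omega> (ys ! i)) * (\<omega> (xs ! i) - \<omega> (ys ! i)))" for \<omega>
    by (simp add: u_def)
  have u_nonneg: "peval \<omega> u \<ge> 0" for \<omega> by (simp add: u_eval sum_nonneg)
  have u_0: "peval \<omega> u = 0 \<longleftrightarrow> map \<omega> xs = map \<omega> ys" for \<omega>
    by (auto simp: u_eval sum_nonneg_eq_0_iff list_eq_iff_nth_eq len)
  let ?S = "FVp (ODE G TT) \<union> pvars p \<union> pvars q \<union> set ys \<union> set xs \<union> FV (first_pos G N p)"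
  obtain ws where ws: "length ws = length xs" "distinct ws" "set ws \<inter> ?S = {}"
    using ex_fresh_vec[of ?S "length xs"] finite_FVp finite_FV pvars_finite
    by (metis finite_UnI finite_set)
  have ws_fresh: "fresh ws (pvars q)" using ws by (auto simp: fresh_def xs)
  have first: "\<omega> \<in> fsem (first_pos G N q)"
    if eq: "map \<omega> xs = map \<omega> ys" and pos: "\<omega> \<in> fsem (first_pos G N p)" for \<omega>
  proof -
    have "peval \<omega> (lie_pow G i q) = peval \<omega> (lie_pow G i p)" if i: "i < N" for i
    proof -
      \<comment> \<open>The factor \<open>u ^ (N - i)\<close> vanishes at \<open>x = y\<close>,
        since \<open>i < N\<close>.\<close>
      obtain c where "lie_pow G i (u ^ N) = c * u ^ (N - i)" using lie_pow_power[of i N G u] i by auto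
      then show ?thesis using i eq u_0[of \<omega>] by (simp add: q_def lie_pow_diff)
    qed
    then show ?thesis using pos by auto
  qed
  have strict: "\<omega> \<in> fsem (Gt p 0) \<union> fsem (VecEq xs ys)" if "\<omega> \<in> fsem (Geq q 0)" for \<omega>
  proof (cases "map \<omega> xs = map \<omega> ys")
    case False
    then have "peval \<omega> u > 0" using u_0[of \<omega>] u_nonneg[of \<omega>] by linarith
    then have "peval \<omega> u ^ N > 0" by simp
    then show ?thesis using that by (simp add: q_def)
  qed (simp add: len)
  show ?thesis
    unfolding local_progress_def
  proof (rule der_fresh_vec[of ws xs])
    show "der [VecEq ws xs, VecEq xs ys, first_pos G N p]
        (Dia (ODE G (Or (Gt p 0) (VecEq xs ys))) (VecNeq xs ys))"
    proof (rule derI)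
      fix v assume v: "valuation v"
        "\<forall>\<psi>\<in>set [VecEq ws xs, VecEq xs ys, first_pos G N p]. v \<psi>"
      interpret valuation v by fact
      have "v (first_pos G N q)"
        by (rule v_fol[of _ "[VecEq xs ys, first_pos G N p]"])
           (use v(2) first len in \<open>auto simp del: fsem_first_pos\<close>)
      moreover have "v (VecEq xs ws)"
        by (rule v_fol[of _ "[VecEq ws xs]"]) (use v(2) ws in auto)
      ultimately have "v (Dia (ODE G (Geq q 0)) (VecNeq xs ws))"
        by (intro v_der[OF local_progress_first_pos[OF ws_fresh, of N]]) auto
      moreover have "der [Geq q 0] (Or (Gt p 0) (VecEq xs ys))"
        by (rule der_fol) (use strict in auto)
      then have "v (Box (ODE G (Geq q 0)) (Or (Gt p 0) (VecEq xs ys)))"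
        by (rule box_mono[OF _ box_domain[OF wf]])
      ultimately have d: "v (Dia (ODE G (Or (Gt p 0) (VecEq xs ys))) (VecNeq xs ws))"
        using dia_refine wf by blast
      \<comment> \<open>Both vectors equal the initial state and neither changes along the run, so
        leaving \<open>ws\<close> means leaving \<open>ys\<close>.\<close>
      have "v (VecEq ws ys)"
        by (rule v_fol[of _ "[VecEq ws xs, VecEq xs ys]"]) (use v(2) ws len in auto)
      moreover have "FV (VecEq ws ys) \<inter> BV (ODE G Q) = {}" for Q
        using FV_VecEq[of ws ys] ws ys by (auto simp: fresh_def set_xs)
      ultimately have c: "v (Box (ODE G Q) (VecEq ws ys))" for Q by (rule box_const[rotated])
      have "der [VecNeq xs ws, VecEq ws ys] (VecNeq xs ys)"
        by (rule der_fol) (use ws len in auto)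
      then show "v (Dia (ODE G (Or (Gt p 0) (VecEq xs ys))) (VecNeq xs ys))"
        by (rule dia_der) (use c d in auto)
    qed
    show "set ws \<inter> (set xs \<union> FVs [VecEq xs ys, first_pos G N p] \<union>
        FV (Dia (ODE G (Or (Gt p 0) (VecEq xs ys))) (VecNeq xs ys))) = {}"
      using ws FV_VecEq[of xs ys] by auto
  qed (use ws in auto)
qed

end

section \<open>Semantics of the progress formulas and of their negations\<close>

lemma fsem_Prog_gt: "fsem (Prog_gt F p) = fsem (first_pos F (rank F p) p)"
proof -
  define N where "N = rank F p"
  have N: "N \<ge> 1" unfolding N_def by (rule rank_ge_1)
  show ?thesis
  proof (cases "N = 1")
    case True
    then show ?thesis by (auto simp: Prog_gt_def N_def[symmetric])
  next
    case False
    then have N2: "N \<ge> 2" using N by simp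
    have "\<omega> \<in> fsem (Prog_gt F p) \<longleftrightarrow> (\<exists>k<N. (\<forall>i<k. peval \<omega> (lie_pow F i p) = 0) \<and> peval \<omega> (lie_pow F k p) > 0)"
      for \<omega>
    proof -
      define a where "a i = peval \<omega> (lie_pow F i p)" for i
      have "\<omega> \<in> fsem (Prog_gt F p) \<longleftrightarrow>
          (a 0 \<ge> 0 \<and> (\<forall>k\<in>{1..<N - 1}. (\<forall>i<k. a i = 0) \<longrightarrow> a k \<ge> 0)
            \<and> ((\<forall>i<N - 1. a i = 0) \<longrightarrow> a (N - 1) > 0))"
        using False by (auto simp: Prog_gt_def N_def[symmetric] Let_def a_def)
      also have "\<dots> \<longleftrightarrow> (\<exists>k<N. (\<forall>i<k. a i = 0) \<and> a k > 0)"
      proof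
        assume L: "a 0 \<ge> 0 \<and> (\<forall>k\<in>{1..<N - 1}. (\<forall>i<k. a i = 0) \<longrightarrow> a k \<ge> 0)
            \<and> ((\<forall>i<N - 1. a i = 0) \<longrightarrow> a (N - 1) > 0)"
        show "\<exists>k<N. (\<forall>i<k. a i = 0) \<and> a k > 0"
        proof (cases "\<forall>i<N - 1. a i = 0")
          case True
          then show ?thesis using L N by (intro exI[of _ "N - 1"]) auto
        next
          case False
          define k where "k = (LEAST i. i < N - 1 \<and> a i \<noteq> 0)"
          have k: "k < N - 1" "a k \<noteq> 0"
            using LeastI_ex[of "\<lambda>i. i < N - 1 \<and> a i \<noteq> 0"] False by (auto simp: k_def)
          have below: "a i = 0" if "i < k" for i
            using not_less_Least[of i "\<lambda>i. i < N - 1 \<and> a i \<noteq> 0"] that k(1) by (auto simp: k_def)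
          \<comment> \<open>Order 0 has a conjunct of its own; the implications start at order
            1.\<close>
          have "a k \<ge> 0" using L k below by (cases "k = 0") auto
          then show ?thesis using k below by (intro exI[of _ k]) auto
        qed
      next
        assume "\<exists>k<N. (\<forall>i<k. a i = 0) \<and> a k > 0"
        then obtain k where k: "k < N" "\<forall>i<k. a i = 0" "a k > 0" by blast
        \<comment> \<open>All orders below \<open>j\<close> vanish, so \<open>j \<le> k\<close>, and
          \<open>a j\<close> is either 0 or the positive \<open>a k\<close>.\<close>
        have ge: "a j \<ge> 0" if "\<forall>i<j. a i = 0" for j
          using k that by (metis less_irrefl linorder_neqE_nat order.strict_implies_order order_refl)
        moreover have "a (N - 1) > 0" if "\<forall>i<N - 1. a i = 0"
        proof -
          have "k = N - 1" using k that by (metis One_nat_def Suc_pred less_antisym less_irrefl N Suc_le_eq)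
          then show ?thesis using k by simp
        qed
        ultimately show "a 0 \<ge> 0 \<and> (\<forall>k\<in>{1..<N - 1}. (\<forall>i<k. a i = 0) \<longrightarrow> a k \<ge> 0)
            \<and> ((\<forall>i<N - 1. a i = 0) \<longrightarrow> a (N - 1) > 0)" by auto
      qed
      finally show ?thesis by (simp add: a_def)
    qed
    then show ?thesis by (auto simp: N_def)
  qed
qed

lemma is_fol_Prog_gt [simp]: "is_fol (Prog_gt F p)"
  by (simp add: Prog_gt_def Let_def)

lemma is_fol_Prog_ge [simp]: "is_fol (Prog_ge F p)"
  by (simp add: Prog_ge_def Rad_def)

lemma is_fol_Prog [simp]: "is_fol (Prog F P)"
  by (auto simp: Prog_def)

lemma is_fol_nf_fml [simp]: "is_fol (nf_fml P)"
  by (auto simp: nf_fml_def)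

lemma fsem_Prog_ge: "fsem (Prog_ge F p) = fsem (Or (first_pos F (rank F p) p) (lie_zero F (rank F p) p))"
  by (simp add: Prog_ge_def fsem_Prog_gt Rad_def del: fsem_first_pos)

text \<open>Either the first \<open>rank F p\<close> Lie derivatives all vanish or the first nonzero
  one has a sign. Keeping the bound \<open>rank F p\<close> for \<open>- p\<close> avoids comparing
  two ranks.\<close>

lemma fsem_not_Prog_gt: "- fsem (Prog_gt F p) = fsem (Or (first_pos F (rank F p) (- p)) (lie_zero F (rank F p) (- p)))"
  (is "?L = ?R")
proof (rule set_eqI)
  fix \<omega>
  define a where "a i = peval \<omega> (lie_pow F i p)" for i
  define N where "N = rank F p"
  have "\<not> (\<exists>k<N. (\<forall>i<k. a i = 0) \<and> a k > 0) \<longleftrightarrow> (\<exists>k<N. (\<forall>i<k. a i = 0) \<and> a k < 0) \<or> (\<forall>i<N. a i = 0)"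
  proof (cases "\<forall>i<N. a i = 0")
    case False
    define k where "k = (LEAST i. i < N \<and> a i \<noteq> 0)"
    have k: "k < N" "a k \<noteq> 0"
      using LeastI_ex[of "\<lambda>i. i < N \<and> a i \<noteq> 0"] False by (auto simp: k_def)
    have below: "a i = 0" if "i < k" for i
      using not_less_Least[of i "\<lambda>i. i < N \<and> a i \<noteq> 0"] that k(1) by (auto simp: k_def)
    have "(\<forall>i<j. a i = 0) \<and> a j \<noteq> 0 \<longleftrightarrow> j = k" for j
      using k below by (metis linorder_neqE_nat)
    then have "(\<exists>j<N. (\<forall>i<j. a i = 0) \<and> R (a j) \<and> a j \<noteq> 0) \<longleftrightarrow> R (a k)" for R
      using k by metis
    from this[of "\<lambda>x. x > 0"] this[of "\<lambda>x. x < 0"] show ?thesis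
      using False k by (smt (verit))
  qed auto
  then show "\<omega> \<in> ?L \<longleftrightarrow> \<omega> \<in> ?R"
    by (simp add: fsem_Prog_gt a_def N_def)
qed

text \<open>Failure of \<open>Rad\<close> removes the case where all Lie derivatives vanish, so what
  remains is progress into the strict inequality \<open>- p > 0\<close>.\<close>

lemma fsem_not_Prog_ge: "- fsem (Prog_ge F p) \<subseteq> fsem (first_pos F (rank F p) (- p))"
proof
  fix \<omega> assume "\<omega> \<in> - fsem (Prog_ge F p)"
  then have "\<omega> \<in> - fsem (Prog_gt F p)" "\<omega> \<notin> fsem (lie_zero F (rank F p) p)"
    by (auto simp: fsem_Prog_ge fsem_Prog_gt)
  then show "\<omega> \<in> fsem (first_pos F (rank F p) (- p))"
    unfolding fsem_not_Prog_gt by auto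
qed

definition nf_polys :: "nform \<Rightarrow> trm set" where
  "nf_polys P = (\<Union>(ps, qs)\<in>set P. set ps \<union> set qs)"

lemma FV_nf_fml: "FV (nf_fml P) = (\<Union>p\<in>nf_polys P. pvars p)"
  by (auto simp: nf_fml_def nf_polys_def FVs_def split_def)

lemma first_pos_cong: "(\<And>i. lie_pow G i p = lie_pow F i p) \<Longrightarrow> first_pos G N p = first_pos F N p"
  and lie_zero_cong: "(\<And>i. lie_pow G i p = lie_pow F i p) \<Longrightarrow> lie_zero G N p = lie_zero F N p"
  by (simp_all add: first_pos_def lie_zero_def)

context clocked_ode
begin

text \<open>The Lie derivatives may also be those of a system \<open>F\<close> that agrees with \<open>G\<close> on the
  polynomials at hand, such as \<open>G\<close> without its clocks.\<close>

context
  fixes F :: ode and P :: nform and ys :: "var list"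
  assumes ys: "fresh ys (FV (nf_fml P))"
    and agree: "\<And>p i. p \<in> nf_polys P \<Longrightarrow> lie_pow G i p = lie_pow F i p"
begin

lemma fresh_poly: "p \<in> nf_polys P \<Longrightarrow> fresh ys (pvars p)"
  by (rule fresh_subset[OF ys]) (auto simp: FV_nf_fml)

lemma local_progress_Prog_gt:
  assumes "p \<in> nf_polys P"
  shows "local_progress ys (Prog_gt F p) (Gt p 0)"
proof (rule local_progress_mono[OF local_progress_Gt[OF fresh_poly[OF assms], of "rank F p"]])
  show "fsem (Prog_gt F p) \<subseteq> fsem (first_pos G (rank F p) p)"
    unfolding fsem_Prog_gt first_pos_cong[OF agree[OF assms]] ..
qed (auto intro: der_assm)

lemma rank_rel_agree:
  assumes "p \<in> nf_polys P"
  shows "\<exists>g. lie_pow G (rank F p) p = (\<Sum>i<rank F p. g i * lie_pow G i p)"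
  using rank_relation[of F p] agree[OF assms] by simp

lemma local_progress_Prog_ge:
  assumes "p \<in> nf_polys P"
  shows "local_progress ys (Prog_ge F p) (Geq p 0)"
proof -
  obtain g where g: "lie_pow G (rank F p) p = (\<Sum>i<rank F p. g i * lie_pow G i p)"
    using rank_rel_agree[OF assms] by blast
  show ?thesis
  proof (rule local_progress_mono[OF local_progress_Geq[OF fresh_poly[OF assms] rank_ge_1 g]])
    show "fsem (Prog_ge F p) \<subseteq> fsem (Or (first_pos G (rank F p) p) (lie_zero G (rank F p) p))"
      unfolding fsem_Prog_ge first_pos_cong[OF agree[OF assms]] lie_zero_cong[OF agree[OF assms]] ..
  qed (auto intro: der_assm)
qed

lemma local_progress_not_Prog_ge:
  assumes "p \<in> nf_polys P"
  shows "local_progress ys (Not (Prog_ge F p)) (Gt (- p) 0)"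
proof (rule local_progress_mono[OF local_progress_Gt[of ys "- p" "rank F p"]])
  show "fsem (Not (Prog_ge F p)) \<subseteq> fsem (first_pos G (rank F p) (- p))"
    using fsem_not_Prog_ge first_pos_cong[of G "- p" F] agree[OF assms] by simp
qed (use fresh_poly[OF assms] in \<open>auto intro: der_assm\<close>)

lemma local_progress_not_Prog_gt:
  assumes "p \<in> nf_polys P"
  shows "local_progress ys (Not (Prog_gt F p)) (Geq (- p) 0)"
proof -
  obtain g where "lie_pow G (rank F p) p = (\<Sum>i<rank F p. g i * lie_pow G i p)"
    using rank_rel_agree[OF assms] by blast
  then have g: "lie_pow G (rank F p) (- p) = (\<Sum>i<rank F p. g i * lie_pow G i (- p))"
    by (simp add: sum_negf)
  have f: "fresh ys (pvars (- p))" using fresh_poly[OF assms] by simp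
  show ?thesis
  proof (rule local_progress_mono[OF local_progress_Geq[OF f rank_ge_1 g]])
    show "fsem (Not (Prog_gt F p)) \<subseteq> fsem (Or (first_pos G (rank F p) (- p)) (lie_zero G (rank F p) (- p)))"
      using fsem_not_Prog_gt[of F p] first_pos_cong[of G "- p" F] lie_zero_cong[of G "- p" F] agree[OF assms]
      by simp
  qed (auto intro: der_assm)
qed

lemma fresh_ys: "fresh ys {}"
  by (rule fresh_subset[OF ys]) simp

theorem local_progress_Prog: "local_progress ys (Prog F P) (nf_fml P)"
  unfolding Prog_def nf_fml_def
proof (intro local_progress_Disj)
  fix d assume d: "d \<in> set P"
  obtain ps qs where pq: "d = (ps, qs)" by fastforce
  then have mem: "p \<in> nf_polys P" if "p \<in> set ps \<union> set qs" for p
    using d that by (auto simp: nf_polys_def)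
  show "local_progress ys (case d of (ps, qs) \<Rightarrow> And (Conj (map (Prog_ge F) ps)) (Conj (map (Prog_gt F) qs)))
      (case d of (ps, qs) \<Rightarrow> And (Conj (map (\<lambda>p. Geq p 0) ps)) (Conj (map (\<lambda>q. Gt q 0) qs)))
    \<and> is_fol (case d of (ps, qs) \<Rightarrow> And (Conj (map (Prog_ge F) ps)) (Conj (map (Prog_gt F) qs)))"
    by (auto simp: pq intro!: local_progress_And local_progress_Conj fresh_ys
        local_progress_Prog_ge local_progress_Prog_gt mem)
qed

text \<open>By De Morgan the negated normal form is a conjunction of disjunctions of the literals
  \<open>- p > 0\<close> and \<open>- q \<ge> 0\<close>, to which the same combination lemmas apply
  with the connectives exchanged.\<close>

theorem local_progress_not_Prog: "local_progress ys (Not (Prog F P)) (Not (nf_fml P))"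
proof -
  define \<phi> where "\<phi> = (\<lambda>(ps, qs). Or (Disj (map (\<lambda>p. Not (Prog_ge F p)) ps)) (Disj (map (\<lambda>q. Not (Prog_gt F q)) qs)))"
  define \<psi> where "\<psi> = (\<lambda>(ps :: trm list, qs :: trm list). Or (Disj (map (\<lambda>p. Gt (- p) 0) ps)) (Disj (map (\<lambda>q. Geq (- q) 0) qs)))"
  have "local_progress ys (Conj (map \<phi> P)) (Conj (map \<psi> P))"
  proof (intro local_progress_Conj fresh_ys)
    fix d assume d: "d \<in> set P"
    obtain ps qs where pq: "d = (ps, qs)" by fastforce
    then have mem: "p \<in> nf_polys P" if "p \<in> set ps \<union> set qs" for p
      using d that by (auto simp: nf_polys_def)
    show "local_progress ys (\<phi> d) (\<psi> d)"
      by (auto simp: pq \<phi>_def \<psi>_def intro!: local_progress_Or local_progress_Disj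
          local_progress_not_Prog_ge local_progress_not_Prog_gt mem)
  qed
  then show ?thesis
  proof (rule local_progress_mono)
    show "is_fol (Conj (map \<phi> P))" by (auto simp: \<phi>_def)
    show "fsem (Not (Prog F P)) \<subseteq> fsem (Conj (map \<phi> P))"
      by (fastforce simp: \<phi>_def Prog_def split_def)
    show "der [Conj (map \<psi> P)] (Not (nf_fml P))"
    proof (rule der_fol)
      fix \<omega> assume "\<forall>\<chi>\<in>set [Conj (map \<psi> P)]. \<omega> \<in> fsem \<chi>"
      then show "\<omega> \<in> fsem (Not (nf_fml P))"
        by (fastforce simp: \<psi>_def nf_fml_def split_def)
    qed (auto simp: \<psi>_def)
  qed simp
qed

end

end

section \<open>Renaming and reversal of differential equations\<close>

text \<open>Without binders nothing can be captured: every substitution is admissible, and its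
  semantics and free variables are computed directly. All domains to be renamed are of this
  kind.\<close>

primrec qf :: "fml \<Rightarrow> bool" where
  "qf (Eq a b) = True"
| "qf (Geq a b) = True"
| "qf (Gt a b) = True"
| "qf (Not \<phi>) = qf \<phi>"
| "qf (And \<phi> \<psi>) = (qf \<phi> \<and> qf \<psi>)"
| "qf (Or \<phi> \<psi>) = (qf \<phi> \<and> qf \<psi>)"
| "qf (Imp \<phi> \<psi>) = (qf \<phi> \<and> qf \<psi>)"
| "qf (Iff \<phi> \<psi>) = (qf \<phi> \<and> qf \<psi>)"
| "qf (Forall x \<phi>) = False"
| "qf (Exists x \<phi>) = False"
| "qf (Box \<alpha> \<phi>) = False"
| "qf (Dia \<alpha> \<phi>) = False"

text \<open>The trivial predicate on programs turns the mutual induction into one on formulas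
  alone.\<close>

lemmas fml_only_induct = fml.induct[of _ "\<lambda>_. True",
  case_names Eq Geq Gt Not And Or Imp Iff Forall Exists Box Dia Assign Test ODE Choice Seq Loop]

lemma qf_is_fol: "qf \<phi> \<Longrightarrow> is_fol \<phi>"
  by (induction \<phi> rule: fml_only_induct) auto

lemma qf_fadm: "qf \<phi> \<Longrightarrow> fadm \<phi> \<sigma>"
  by (induction \<phi> rule: fml_only_induct) auto

lemma qf_fsub: "qf \<phi> \<Longrightarrow> qf (fsub \<phi> \<sigma>)"
  by (induction \<phi> rule: fml_only_induct) auto

lemma fsem_fsub_qf: "qf \<phi> \<Longrightarrow> \<omega> \<in> fsem (fsub \<phi> \<sigma>) \<longleftrightarrow> (\<lambda>x. peval \<omega> (\<sigma> x)) \<in> fsem \<phi>"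
  by (induction \<phi> rule: fml_only_induct) auto

lemma fsem_qf_cong:
  "qf \<phi> \<Longrightarrow> (\<And>x. x \<in> FV \<phi> \<Longrightarrow> \<omega> x = \<omega>' x) \<Longrightarrow> \<omega> \<in> fsem \<phi> \<longleftrightarrow> \<omega>' \<in> fsem \<phi>"
proof (induction \<phi> rule: fml_only_induct)
  case (Eq a b)
  then show ?case using peval_cong[of a \<omega> \<omega>'] peval_cong[of b \<omega> \<omega>'] by simp
next
  case (Geq a b)
  then show ?case using peval_cong[of a \<omega> \<omega>'] peval_cong[of b \<omega> \<omega>'] by simp
next
  case (Gt a b)
  then show ?case using peval_cong[of a \<omega> \<omega>'] peval_cong[of b \<omega> \<omega>'] by simp
qed auto

lemma pvars_psubst: "pvars (psubst \<sigma> p) \<subseteq> (\<Union>x\<in>pvars p. pvars (\<sigma> x))"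
proof -
  have prod: "pvars (prod f A) \<subseteq> (\<Union>i\<in>A. pvars (f i))" for f :: "var \<Rightarrow> trm" and A
  proof (induction A rule: infinite_finite_induct)
    case (insert x A)
    then show ?case using pvars_mult[of "f x" "prod f A"] by auto
  qed simp_all
  have "pvars (PConst (Poly_Mapping.lookup p m) * (\<Prod>x\<in>Poly_Mapping.keys m. \<sigma> x ^ Poly_Mapping.lookup m x))
      \<subseteq> (\<Union>x\<in>pvars p. pvars (\<sigma> x))" if "m \<in> Poly_Mapping.keys p" for m
  proof -
    have "pvars (\<Prod>x\<in>Poly_Mapping.keys m. \<sigma> x ^ Poly_Mapping.lookup m x)
        \<subseteq> (\<Union>x\<in>Poly_Mapping.keys m. pvars (\<sigma> x ^ Poly_Mapping.lookup m x))" by (rule prod)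
    also have "\<dots> \<subseteq> (\<Union>x\<in>Poly_Mapping.keys m. pvars (\<sigma> x))"
      by (intro UN_mono order.refl pvars_power)
    also have "\<dots> \<subseteq> (\<Union>x\<in>pvars p. pvars (\<sigma> x))" using that by (auto simp: pvars_def)
    finally show ?thesis
      by (intro order.trans[OF pvars_mult]) simp
  qed
  then show ?thesis
    unfolding psubst_def by (intro order.trans[OF pvars_sum] UN_least)
qed

lemma FV_fsub_qf: "qf \<phi> \<Longrightarrow> FV (fsub \<phi> \<sigma>) \<subseteq> (\<Union>x\<in>FV \<phi>. pvars (\<sigma> x))"
proof (induction \<phi> rule: fml_only_induct)
  case (Eq a b)
  then show ?case using pvars_psubst[of \<sigma> a] pvars_psubst[of \<sigma> b] by auto
next
  case (Geq a b)
  then show ?case using pvars_psubst[of \<sigma> a] pvars_psubst[of \<sigma> b] by auto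
next
  case (Gt a b)
  then show ?case using pvars_psubst[of \<sigma> a] pvars_psubst[of \<sigma> b] by auto
qed auto

lemma qf_Conj [simp]: "qf (Conj \<Gamma>) \<longleftrightarrow> (\<forall>\<phi>\<in>set \<Gamma>. qf \<phi>)"
  by (induction \<Gamma> rule: Conj.induct) auto

lemma qf_Disj [simp]: "qf (Disj \<Gamma>) \<longleftrightarrow> (\<forall>\<phi>\<in>set \<Gamma>. qf \<phi>)"
  by (induction \<Gamma> rule: Disj.induct) auto

lemma qf_VecEq [simp]: "qf (VecEq xs ys)"
  by (auto simp: VecEq_def)

lemma qf_nf_fml [simp]: "qf (nf_fml P)"
  by (auto simp: nf_fml_def)

section \<open>Renaming along vectors of variables\<close>

lemma subvec_notin: "z \<notin> set xs \<Longrightarrow> subvec xs ys z = PVar z"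
  by (auto simp: subvec_def split: option.split dest!: map_of_SomeD set_zip_leftD)

lemma subvec_nth:
  "distinct xs \<Longrightarrow> length xs = length ys \<Longrightarrow> i < length xs \<Longrightarrow> subvec xs ys (xs ! i) = PVar (ys ! i)"
  by (simp add: subvec_def map_of_zip_nth)

lemma pvars_subvec: "length xs = length ys \<Longrightarrow> pvars (subvec xs ys z) \<subseteq> ({z} - set xs) \<union> set ys"
proof (cases "map_of (zip xs ys) z")
  case None
  assume "length xs = length ys"
  then have "z \<notin> set xs" using None by (metis map_of_zip_is_None)
  then show ?thesis by (simp add: subvec_notin)
next
  case (Some y)
  then show ?thesis by (auto simp: subvec_def dest: map_of_SomeD set_zip_rightD)
qed

lemma peval_subvec:
  assumes "length xs = length ys" "map \<omega> xs = map \<omega> ys"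
  shows "peval \<omega> (subvec xs ys z) = \<omega> z"
proof (cases "map_of (zip xs ys) z")
  case (Some y)
  then have "(z, y) \<in> set (zip xs ys)" by (rule map_of_SomeD)
  then have "\<omega> z = \<omega> y" using assms by (auto simp: in_set_zip list_eq_iff_nth_eq)
  then show ?thesis using Some by (simp add: subvec_def)
qed (simp add: subvec_def)

lemma fsem_fsub_subvec:
  assumes "qf \<phi>" "length xs = length ys" "map \<omega> xs = map \<omega> ys"
  shows "\<omega> \<in> fsem (fsub \<phi> (subvec xs ys)) \<longleftrightarrow> \<omega> \<in> fsem \<phi>"
  using assms by (simp add: fsem_fsub_qf peval_subvec)

lemma FV_fsub_subvec:
  assumes "qf \<phi>" "length xs = length ys"
  shows "FV (fsub \<phi> (subvec xs ys)) \<subseteq> (FV \<phi> - set xs) \<union> set ys"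
  using FV_fsub_qf[OF assms(1), of "subvec xs ys"] pvars_subvec[OF assms(2)] by fastforce

text \<open>Three uses of (Dadj) rename \<open>xs\<close> to \<open>ys\<close>, \<open>ys\<close> to
  \<open>ws\<close> and \<open>ws\<close> back to \<open>xs\<close>; on variables outside the
  auxiliary vectors this is the identity.\<close>

lemma subvec_cycle:
  assumes "distinct xs" "distinct ys" "distinct ws" "length ys = length xs" "length ws = length xs"
    and "z \<notin> set ys \<union> set ws"
  shows "psubst (subvec ws xs) (psubst (subvec ys ws) (subvec xs ys z)) = PVar z"
proof (cases "z \<in> set xs")
  case True
  then obtain i where "i < length xs" "z = xs ! i" by (metis in_set_conv_nth)
  then show ?thesis using assms by (simp add: subvec_nth)
next
  case False
  then show ?thesis using assms by (simp add: subvec_notin)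
qed

text \<open>The right-hand sides of \<open>reverse_ode\<close> as a bare list, so that reversals
  along changing vectors can be iterated.\<close>

definition rev_rhs :: "var list \<Rightarrow> var list \<Rightarrow> trm list \<Rightarrow> trm list" where
  "rev_rhs xs ys fs = map (\<lambda>f. - psubst (subvec xs ys) f) fs"

lemma length_rev_rhs [simp]: "length (rev_rhs xs ys fs) = length fs"
  by (simp add: rev_rhs_def)

lemma reverse_ode_zip:
  assumes "length fs = length xs"
  shows "reverse_ode (zip xs fs) ys = zip ys (rev_rhs xs ys fs)"
proof -
  have "map (\<lambda>(x, f). - psubst (subvec xs ys) f) (zip xs fs) = rev_rhs xs ys fs"
    using assms by (simp add: rev_rhs_def list_eq_iff_nth_eq)
  then show ?thesis using assms by (simp add: reverse_ode_def)
qed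

lemma pvars_rev_rhs:
  assumes "length xs = length ys"
  shows "(\<Union>f\<in>set (rev_rhs xs ys fs). pvars f) \<subseteq> ((\<Union>f\<in>set fs. pvars f) - set xs) \<union> set ys"
proof -
  have "pvars (psubst (subvec xs ys) f) \<subseteq> (pvars f - set xs) \<union> set ys" for f
    using pvars_psubst[of "subvec xs ys" f] pvars_subvec[OF assms] by fastforce
  then show ?thesis by (fastforce simp: rev_rhs_def)
qed

text \<open>The renamings cancel, and three sign changes leave one.\<close>

lemma rev_rhs_cycle:
  assumes "distinct xs" "distinct ys" "distinct ws" "length ys = length xs" "length ws = length xs"
    and "(\<Union>f\<in>set fs. pvars f) \<inter> (set ys \<union> set ws) = {}"
  shows "rev_rhs ws xs (rev_rhs ys ws (rev_rhs xs ys fs)) = map uminus fs"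
proof -
  have "psubst (subvec ws xs) (psubst (subvec ys ws) (psubst (subvec xs ys) f)) = f"
    if "f \<in> set fs" for f
    unfolding psubst_psubst
    by (rule psubst_ident) (use subvec_cycle[OF assms(1-5)] assms(6) that in auto)
  then show ?thesis by (simp add: rev_rhs_def del: psubst_psubst)
qed

lemma ode_vars_zip: "length fs = length xs \<Longrightarrow> ode_vars (zip xs fs) = set xs"
  unfolding ode_vars_def by (metis list.set_map map_fst_zip)

lemma FVp_zip:
  assumes "length fs = length xs"
  shows "FVp (ODE (zip xs fs) Q) = set xs \<union> (\<Union>f\<in>set fs. pvars f) \<union> FV Q"
proof -
  have "(\<Union>(x, f)\<in>set (zip xs fs). pvars f) = (\<Union>f\<in>snd ` set (zip xs fs). pvars f)" by auto
  also have "snd ` set (zip xs fs) = set fs"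
    using assms by (metis list.set_map map_snd_zip)
  finally show ?thesis using assms by (simp add: ode_vars_zip)
qed

lemma wf_ode_zip: "length fs = length xs \<Longrightarrow> distinct xs \<Longrightarrow> wf_ode (zip xs fs)"
  by (simp add: wf_ode_def)

lemma BV_zip: "length fs = length xs \<Longrightarrow> BV (ODE (zip xs fs) Q) = set xs"
  by (simp add: ode_vars_zip)

context valuation
begin

lemma not_v_FF: "\<not> v FF"
  using v_Disj[of "[]"] by simp

lemma dadj:
  assumes "length fs = length xs" "distinct xs" "distinct ys" "length ys = length xs" "qf Q"
    and "set ys \<inter> FVp (ODE (zip xs fs) Q) = {}"
    and "v (Dia (ODE (zip xs fs) Q) (VecEq xs ys))"
  shows "v (Dia (ODE (zip ys (rev_rhs xs ys fs)) (fsub Q (subvec xs ys))) (VecEq ys xs))"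
proof -
  have "xs = map fst (zip xs fs)" using assms(1) by simp
  moreover have "fresh_vec ys (zip xs fs) Q" using assms by (simp add: fresh_vec_def del: FVp.simps)
  ultimately show ?thesis
    using v_axiom1[OF Dadj[OF wf_ode_zip[OF assms(1,2)] _ _ qf_fadm[OF assms(5)]]] assms(7)
    by (simp add: reverse_ode_zip[OF assms(1)])
qed

end

text \<open>(Dadj) turns the run of \<open>xs\<close> to \<open>ys\<close> into a backward run of
  \<open>ys\<close> to \<open>xs\<close>, whose value \<open>ws\<close> shares; a second use gives a
  forward run of \<open>ws\<close> to \<open>ys\<close>. With \<open>xs\<close> now set to
  \<open>ys\<close>, a third use gives a backward run of \<open>xs\<close> to \<open>ws\<close>. An
  odd number of uses reverses the flow, and a single one would not return to
  \<open>xs\<close>.\<close>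

lemma der_reverse:
  assumes fs: "length fs = length xs" and dist: "distinct xs" "distinct (ys @ ws)"
    and len: "length ys = length xs" "length ws = length xs" and Q: "qf Q"
    and fresh: "(set ys \<union> set ws) \<inter> FVp (ODE (zip xs fs) Q) = {}"
    and der: "der (VecEq xs ys # Dia (ODE (zip xs (map uminus fs)) Q) (VecEq xs ws) # \<Gamma>) \<psi>"
    and free: "set xs \<inter> (FVs \<Gamma> \<union> FV \<psi>) = {}"
  shows "der (VecEq xs ws # Dia (ODE (zip xs fs) Q) (VecEq xs ys) # \<Gamma>) \<psi>"
proof -
  define f1 where "f1 = rev_rhs xs ys fs"
  define f2 where "f2 = rev_rhs ys ws f1"
  define Q1 where "Q1 = fsub Q (subvec xs ys)"
  define Q2 where "Q2 = fsub Q1 (subvec ys ws)"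
  define Q3 where "Q3 = fsub Q2 (subvec ws xs)"
  have lf: "length f1 = length ys" "length f2 = length ws" using fs len by (simp_all add: f1_def f2_def)
  have dy: "distinct ys" and dw: "distinct ws" and yw: "set ys \<inter> set ws = {}" using dist by auto
  have qf: "qf Q1" "qf Q2" using Q by (simp_all add: Q1_def Q2_def qf_fsub)
  have xs_yw: "set xs \<inter> set ys = {}" "set xs \<inter> set ws = {}"
    and fs_yw: "(\<Union>f\<in>set fs. pvars f) \<inter> (set ys \<union> set ws) = {}"
    and Q_yw: "FV Q \<inter> (set ys \<union> set ws) = {}"
    using fresh unfolding FVp_zip[OF fs] by auto
  have f3: "rev_rhs ws xs f2 = map uminus fs"
    unfolding f2_def f1_def using rev_rhs_cycle dist(1) dy dw len fs_yw by blast
  have v1: "(\<Union>f\<in>set f1. pvars f) \<subseteq> ((\<Union>f\<in>set fs. pvars f) - set xs) \<union> set ys"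
    and v2: "(\<Union>f\<in>set f2. pvars f) \<subseteq> ((\<Union>f\<in>set f1. pvars f) - set ys) \<union> set ws"
    using pvars_rev_rhs len unfolding f1_def f2_def by simp_all
  have q1: "FV Q1 \<subseteq> (FV Q - set xs) \<union> set ys" and q2: "FV Q2 \<subseteq> (FV Q1 - set ys) \<union> set ws"
    using FV_fsub_subvec Q qf(1) len unfolding Q1_def Q2_def by simp_all
  define U where "U gs = (\<Union>f\<in>set gs. pvars f)" for gs :: "trm list"
  have ws1: "set ws \<inter> FVp (ODE (zip ys f1) Q1) = {}"
    using v1 q1 yw fs_yw Q_yw unfolding FVp_zip[OF lf(1)] U_def[symmetric] by blast
  have xs2: "set xs \<inter> FVp (ODE (zip ws f2) Q2) = {}"
    using v1 v2 q1 q2 xs_yw unfolding FVp_zip[OF lf(2)] U_def[symmetric] by blast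
  \<comment> \<open>No formula of this sequent mentions \<open>xs\<close> freely, so
    \<open>xs\<close> can be reintroduced as a fresh copy of \<open>ys\<close>: the state moves from
    the start of the run to its end.\<close>
  have fin: "der (Dia (ODE (zip ws f2) Q2) (VecEq ws ys) # \<Gamma>) \<psi>"
  proof (rule der_fresh_vec[of xs ys])
    show "der (VecEq xs ys # Dia (ODE (zip ws f2) Q2) (VecEq ws ys) # \<Gamma>) \<psi>"
    proof (rule derI)
      fix v assume v: "valuation v"
        "\<forall>\<psi>\<in>set (VecEq xs ys # Dia (ODE (zip ws f2) Q2) (VecEq ws ys) # \<Gamma>). v \<psi>"
      interpret valuation v by fact
      have "FV (VecEq xs ys) \<inter> BV (ODE (zip ws f2) Q2) = {}"
        unfolding BV_zip[OF lf(2)] using FV_VecEq[of xs ys] xs_yw yw by blast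
      then have "v (Box (ODE (zip ws f2) Q2) (VecEq xs ys))" using v(2) by (intro box_const) auto
      moreover have "der [VecEq ws ys, VecEq xs ys] (VecEq ws xs)"
        by (rule der_fol) (use len in auto)
      ultimately have "v (Dia (ODE (zip ws f2) Q2) (VecEq ws xs))"
        using v(2) by - (rule dia_der[of "VecEq ws ys" "[VecEq xs ys]"], auto)
      then have "v (Dia (ODE (zip xs (map uminus fs)) Q3) (VecEq xs ws))"
        using dadj[OF lf(2) dw dist(1) _ qf(2) xs2] len f3 by (simp add: Q3_def)
      \<comment> \<open>The threefold renaming of the domain agrees with \<open>Q\<close> by
        evaluating the cycle on the free variables of \<open>Q\<close>.\<close>
      moreover have "der [Q3] Q"
      proof (rule der_fol)
        fix \<omega> assume "\<forall>\<psi>\<in>set [Q3]. \<omega> \<in> fsem \<psi>"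
        then have Q3: "(\<lambda>x. peval (\<lambda>y. peval (\<lambda>z. peval \<omega> (subvec ws xs z)) (subvec ys ws y)) (subvec xs ys x)) \<in> fsem Q"
          using Q qf by (simp add: Q3_def Q2_def Q1_def fsem_fsub_qf)
        have "peval (\<lambda>y. peval (\<lambda>z. peval \<omega> (subvec ws xs z)) (subvec ys ws y)) (subvec xs ys x) = \<omega> x"
          if "x \<in> FV Q" for x
          using arg_cong[OF subvec_cycle[OF dist(1) dy dw len, of x], of "peval \<omega>"] that Q_yw by auto
        then show "\<omega> \<in> fsem Q" using Q3 fsem_qf_cong[OF Q] by (metis (no_types, lifting))
      qed (use Q qf in \<open>auto simp: Q3_def intro!: qf_is_fol qf_fsub\<close>)
      then have "v (Box (ODE (zip xs (map uminus fs)) Q3) Q)"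
        using fs dist(1) by (intro box_mono[OF _ box_domain] wf_ode_zip) auto
      ultimately have "v (Dia (ODE (zip xs (map uminus fs)) Q) (VecEq xs ws))"
        using fs dist(1) by - (rule dia_refine[of _ Q3], auto intro: wf_ode_zip)
      then show "v \<psi>" using v(2) by (intro v_der[OF der]) auto
    qed
    have "FV (Dia (ODE (zip ws f2) Q2) (VecEq ws ys)) \<subseteq> FVp (ODE (zip ws f2) Q2) \<union> set ws \<union> set ys"
      using FV_VecEq[of ws ys] by auto
    then show "set xs \<inter> (set ys \<union> FVs (Dia (ODE (zip ws f2) Q2) (VecEq ws ys) # \<Gamma>) \<union> FV \<psi>) = {}"
      using xs2 xs_yw free by (simp del: FV.simps FVp.simps) blast
  qed (use len dist in auto)
  show ?thesis
  proof (rule derI)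
    fix v assume v: "valuation v"
      "\<forall>\<psi>\<in>set (VecEq xs ws # Dia (ODE (zip xs fs) Q) (VecEq xs ys) # \<Gamma>). v \<psi>"
    interpret valuation v by fact
    have "set ys \<inter> FVp (ODE (zip xs fs) Q) = {}" using fresh by blast
    then have "v (Dia (ODE (zip ys f1) Q1) (VecEq ys xs))"
      unfolding f1_def Q1_def using v(2) by (intro dadj[OF fs dist(1) dy len(1) Q]) auto
    moreover have "FV (VecEq xs ws) \<inter> BV (ODE (zip ys f1) Q1) = {}"
      unfolding BV_zip[OF lf(1)] using FV_VecEq[of xs ws] xs_yw yw by blast
    then have "v (Box (ODE (zip ys f1) Q1) (VecEq xs ws))" using v(2) by (intro box_const) auto
    moreover have "der [VecEq ys xs, VecEq xs ws] (VecEq ys ws)"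
      by (rule der_fol) (use len in auto)
    ultimately have "v (Dia (ODE (zip ys f1) Q1) (VecEq ys ws))"
      by - (rule dia_der[of "VecEq ys xs" "[VecEq xs ws]"], auto)
    then have "v (Dia (ODE (zip ws f2) Q2) (VecEq ws ys))"
      unfolding f2_def Q2_def using len by (intro dadj[OF lf(1) dy dw _ qf(1) ws1]) auto
    then show "v \<psi>" using v(2) by (intro v_der[OF fin]) auto
  qed
qed

text \<open>Names the final values of \<open>zs\<close> in a run. Each final value exists trivially
  after the run, and (B') moves the quantifier in front of the modality, where it is
  eliminated.\<close>

lemma der_Dia_witness:
  assumes "wf_ode F" "distinct ys" "length ys = length zs"
    and "set ys \<inter> (FVp (ODE F Q) \<union> FV \<phi> \<union> set zs \<union> FVs \<Gamma> \<union> FV \<psi>) = {}"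
    and "der (Dia (ODE F Q) (And \<phi> (VecEq zs ys)) # \<Gamma>) \<psi>"
  shows "der (Dia (ODE F Q) \<phi> # \<Gamma>) \<psi>"
proof -
  \<comment> \<open>The equation of the head pair is outermost, so that (B') can remove the entries
    of \<open>ys\<close> from the front.\<close>
  define \<chi> where "\<chi> ps = foldr (\<lambda>(y, z) \<phi>. And \<phi> (Eq (PVar y) (PVar z))) ps \<phi>" for ps :: "(var \<times> var) list"
  have "der [\<chi> (zip ys zs)] (And \<phi> (VecEq zs ys))"
  proof (rule derI)
    fix v assume v: "valuation v" "\<forall>\<psi>\<in>set [\<chi> (zip ys zs)]. v \<psi>"
    interpret valuation v by fact
    have "v (\<chi> ps) \<Longrightarrow> v \<phi> \<and> (\<forall>(y, z)\<in>set ps. v (Eq (PVar y) (PVar z)))" for ps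
      by (induction ps) (auto simp: \<chi>_def)
    then have *: "v \<phi>" "\<forall>(y, z)\<in>set (zip ys zs). v (Eq (PVar y) (PVar z))" using v(2) by auto
    then have "v (VecEq ys zs)" by (auto simp: VecEq_def)
    then have "v (VecEq zs ys)"
      using assms(3) by - (rule v_fol[of _ "[VecEq ys zs]"], auto)
    then show "v (And \<phi> (VecEq zs ys))" using *(1) by simp
  qed
  then have "der (Dia (ODE F Q) (\<chi> (zip ys zs)) # \<Gamma>) \<psi>"
  proof (intro derI)
    fix v assume c: "der [\<chi> (zip ys zs)] (And \<phi> (VecEq zs ys))"
      and v: "valuation v" "\<forall>\<psi>\<in>set (Dia (ODE F Q) (\<chi> (zip ys zs)) # \<Gamma>). v \<psi>"
    interpret valuation v by fact
    have "v (Dia (ODE F Q) (And \<phi> (VecEq zs ys)))" using v(2) by - (rule dia_mono[OF c], simp)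
    then show "v \<psi>" using v(2) by - (rule v_der[OF assms(5)], auto)
  qed
  with assms(3,2,4) show ?thesis
  proof (induction ys zs rule: list_induct2)
    case Nil
    then show ?case by (simp add: \<chi>_def)
  next
    case (Cons y ys z zs)
    let ?\<chi> = "\<chi> (zip ys zs)"
    have "FV (\<chi> ps) \<subseteq> FV \<phi> \<union> fst ` set ps \<union> snd ` set ps" for ps
      by (induction ps) (auto simp: \<chi>_def)
    then have FV: "FV ?\<chi> \<subseteq> FV \<phi> \<union> set ys \<union> set zs"
      using Cons.hyps by (metis list.set_map map_fst_zip map_snd_zip)
    have y: "y \<notin> FVp (ODE F Q)" "y \<notin> FV ?\<chi> \<union> {z} \<union> FVs \<Gamma> \<union> FV \<psi>"
      using Cons.prems FV by auto
    have ex: "der [?\<chi>] (Exists y (And ?\<chi> (Eq (PVar y) (PVar z))))"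
    proof (rule der_fresh[of y "PVar z"])
      show "der [Eq (PVar y) (PVar z), ?\<chi>] (Exists y (And ?\<chi> (Eq (PVar y) (PVar z))))"
      proof (rule derI)
        fix v assume v: "valuation v" "\<forall>\<psi>\<in>set [Eq (PVar y) (PVar z), ?\<chi>]. v \<psi>"
        interpret valuation v by fact
        show "v (Exists y (And ?\<chi> (Eq (PVar y) (PVar z))))"
          by (rule v_ExistsI) (use v(2) in simp)
      qed
    qed (use y(2) in auto)
    have der: "der (Dia (ODE F Q) (And ?\<chi> (Eq (PVar y) (PVar z))) # \<Gamma>) \<psi>"
      using Cons.prems(3) by (simp add: \<chi>_def)
    have der_ex: "der (Exists y (Dia (ODE F Q) (And ?\<chi> (Eq (PVar y) (PVar z)))) # \<Gamma>) \<psi>"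
      by (rule der_ExistsE[OF der]) (use y(2) in auto)
    have "der (Dia (ODE F Q) ?\<chi> # \<Gamma>) \<psi>"
    proof (rule derI)
      fix v assume v: "valuation v" "\<forall>\<psi>\<in>set (Dia (ODE F Q) ?\<chi> # \<Gamma>). v \<psi>"
      interpret valuation v by fact
      have "v (Dia (ODE F Q) (Exists y (And ?\<chi> (Eq (PVar y) (PVar z)))))"
        using v(2) by (intro dia_mono[OF ex]) auto
      then have "v (Exists y (Dia (ODE F Q) (And ?\<chi> (Eq (PVar y) (PVar z)))))"
        using v_axiom0[OF BarcanD[OF assms(1) y(1)]] by simp
      then show "v \<psi>" using v(2) by (intro v_der[OF der_ex]) auto
    qed
    then show ?case using Cons.prems by (intro Cons.IH) auto
  qed
qed

section \<open>Clocks\<close>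

text \<open>One clock runs forward and one backward, so that the reversed system has a clock as well.\<close>

definition add_clocks :: "ode \<Rightarrow> var \<Rightarrow> var \<Rightarrow> ode" where
  "add_clocks F t s = F @ [(t, 1), (s, -1)]"

lemma clocks_iff:
  assumes "wf_ode F" "t \<noteq> s" "{t, s} \<inter> (FVp (ODE F TT) \<union> FV \<phi>) = {}" "valuation v"
  shows "v (Box (ODE F TT) \<phi>) \<longleftrightarrow> v (Exists t (Box (ODE (F @ [(t, 1)]) TT) \<phi>))"
    and "v (Box (ODE (F @ [(t, 1)]) TT) \<phi>) \<longleftrightarrow> v (Exists s (Box (ODE (add_clocks F t s) TT) \<phi>))"
proof -
  interpret valuation v by fact
  have wf: "wf_ode (F @ [(t, 1)])" using assms by (intro wf_ode_snoc) auto
  have "t \<notin> FVp (ODE F TT) \<union> FV \<phi> \<union> pvars 0 \<union> pvars 1" using assms(3) by auto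
  from v_axiom0[OF DG[OF assms(1) this]]
  show "v (Box (ODE F TT) \<phi>) \<longleftrightarrow> v (Exists t (Box (ODE (F @ [(t, 1)]) TT) \<phi>))" by simp
  have "s \<notin> FVp (ODE (F @ [(t, 1)]) TT) \<union> FV \<phi> \<union> pvars 0 \<union> pvars (- 1)"
    using assms(2,3) by (auto simp: ode_vars_def)
  from v_axiom0[OF DG[OF wf this]]
  show "v (Box (ODE (F @ [(t, 1)]) TT) \<phi>) \<longleftrightarrow> v (Exists s (Box (ODE (add_clocks F t s) TT) \<phi>))"
    by (simp add: add_clocks_def)
qed

lemma clocksI:
  assumes "wf_ode F" "t \<noteq> s" "{t, s} \<inter> (FVp (ODE F TT) \<union> FV \<phi>) = {}" "valuation v"
    and "v (Box (ODE (add_clocks F t s) TT) \<phi>)"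
  shows "v (Box (ODE F TT) \<phi>)"
  using clocks_iff[OF assms(1-4)] valuation.v_ExistsI[OF assms(4)] assms(5) by blast

lemma der_clocksE:
  assumes "wf_ode F" "t \<noteq> s" "{t, s} \<inter> (FVp (ODE F TT) \<union> FV \<phi> \<union> FVs \<Gamma> \<union> FV \<psi>) = {}"
    and "der (Box (ODE (add_clocks F t s) TT) \<phi> # \<Gamma>) \<psi>"
  shows "der (Box (ODE F TT) \<phi> # \<Gamma>) \<psi>"
proof -
  have fr: "{t, s} \<inter> (FVp (ODE F TT) \<union> FV \<phi>) = {}" using assms(3) by auto
  have 1: "der (Exists s (Box (ODE (add_clocks F t s) TT) \<phi>) # \<Gamma>) \<psi>"
    by (rule der_ExistsE[OF assms(4)]) (use assms(3) in auto)
  have "der (Box (ODE (F @ [(t, 1)]) TT) \<phi> # \<Gamma>) \<psi>"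
    by (rule derI, rule valuation.v_der[OF _ 1])
       (use clocks_iff(2)[OF assms(1,2) fr] in \<open>auto simp del: FVp.simps\<close>)
  then have 2: "der (Exists t (Box (ODE (F @ [(t, 1)]) TT) \<phi>) # \<Gamma>) \<psi>"
    by (rule der_ExistsE) (use assms(3) in auto)
  show ?thesis
    by (rule derI, rule valuation.v_der[OF _ 2])
       (use clocks_iff(1)[OF assms(1,2) fr] in \<open>auto simp del: FVp.simps\<close>)
qed

lemma lie_pow_clocks:
  assumes "{t, s} \<inter> (pvars p \<union> (\<Union>(x, f)\<in>set F. pvars f)) = {}"
  shows "lie_pow (F @ [(t, a), (s, b)]) i p = lie_pow F i p"
proof (induction i)
  case (Suc i)
  have "lie [(t, a), (s, b)] (lie_pow F i p) = 0"
    by (rule lie_notin) (use assms pvars_lie_pow[of F i p] in \<open>auto simp: ode_vars_def\<close>)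
  then show ?case by (simp add: lie_pow_Suc Suc lie_append)
qed simp

text \<open>It suffices to refute the box of \<open>nf_fml P\<close> along the clocked system,
  because fresh clocks are eliminated from a premise by (DG).\<close>

lemma der_escape:
  assumes wfF: "wf_ode F"
  shows "der [Not (Prog F P)] (Dia (ODE F TT) (Not (nf_fml P)))"
proof -
  let ?S = "FVp (ODE F TT) \<union> FV (nf_fml P) \<union> FV (Prog F P)"
  have fin: "finite ?S" by (intro finite_UnI finite_FVp finite_FV)
  obtain t where t: "t \<notin> ?S" using ex_new_if_finite[OF _ fin] infinite_UNIV_nat by blast
  obtain s where s: "s \<notin> insert t ?S"
    using ex_new_if_finite[of "insert t ?S"] fin infinite_UNIV_nat by blast
  define G where "G = add_clocks F t s"
  have wfG: "wf_ode G"
    using wfF t s by (auto simp: G_def add_clocks_def wf_ode_def ode_vars_def)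
  interpret clocked_ode G "map fst G"
    by unfold_locales (use wfG in \<open>auto simp: G_def add_clocks_def has_clock_def\<close>)
  let ?T = "FVp (ODE G TT) \<union> FV (nf_fml P) \<union> FV (Prog F P)"
  have finT: "finite ?T" by (intro finite_UnI finite_FVp finite_FV)
  obtain ys where ys: "length ys = length G" "distinct ys" "set ys \<inter> ?T = {}"
    using ex_fresh_vec[OF finT] by blast
  have fresh: "fresh ys (FV (nf_fml P))" using ys by (auto simp: fresh_def)
  have agree: "lie_pow G i p = lie_pow F i p" if "p \<in> nf_polys P" for p i
    unfolding G_def add_clocks_def
    by (rule lie_pow_clocks) (use t s that in \<open>auto simp: FV_nf_fml\<close>)
  let ?E = "VecEq (map fst G) ys"
  let ?D = "Or (Not (nf_fml P)) ?E"
  have clocked: "der [Box (ODE G TT) (nf_fml P), Not (Prog F P)] FF"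
  proof (rule der_fresh_vec[of ys "map fst G"])
    show "der [VecEq ys (map fst G), Box (ODE G TT) (nf_fml P), Not (Prog F P)] FF"
    proof (rule derI)
      fix v assume v: "valuation v"
        "\<forall>\<psi>\<in>set [VecEq ys (map fst G), Box (ODE G TT) (nf_fml P), Not (Prog F P)]. v \<psi>"
      interpret valuation v by fact
      have "v ?E" using v(2) ys by - (rule v_fol[of _ "[VecEq ys (map fst G)]"], auto)
      then have d: "v (Dia (ODE G ?D) (Not ?E))"
        using v(2) by (intro local_progressD[OF v(1) local_progress_not_Prog[OF fresh agree]]) auto
      have "v (Box (ODE G ?D) TT)" by (intro nec der_valid) (simp_all add: valid_def)
      then have "v (Box (ODE G ?D) (nf_fml P))" using v(2) box_refine[OF wfG] by auto
      \<comment> \<open>Along the run \<open>nf_fml P\<close> holds, so its domain permits only the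
        start, but it ends elsewhere.\<close>
      moreover have "der [Not ?E, ?D, nf_fml P] FF"
        by (rule der_fol) (use ys in auto)
      ultimately have "v (Dia (ODE G ?D) FF)"
        using d box_domain[OF wfG] by - (rule dia_der[of "Not ?E" "[?D, nf_fml P]"], auto)
      \<comment> \<open>A closed formula is constant along the run, so falsity at its end refutes
        the initial state.\<close>
      then show "v FF" by (rule dia_const[rotated]) simp
    qed
    show "set ys \<inter> (set (map fst G) \<union> FVs [Box (ODE G TT) (nf_fml P), Not (Prog F P)] \<union> FV FF) = {}"
      using ys by (auto simp: ode_vars_def)
  qed (use ys in auto)
  have "t \<noteq> s" "{t, s} \<inter> (FVp (ODE F TT) \<union> FV (nf_fml P) \<union> FVs [Not (Prog F P)] \<union> FV FF) = {}"
    using t s by auto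
  from der_clocksE[OF wfF this clocked[unfolded G_def]]
  have "der [Box (ODE F TT) (nf_fml P), Not (Prog F P)] FF" .
  then have "der [Box (ODE F TT) (Not (Not (nf_fml P))), Not (Prog F P)] FF"
  proof (intro derI)
    fix v assume d: "der [Box (ODE F TT) (nf_fml P), Not (Prog F P)] FF"
      and v: "valuation v" "\<forall>\<psi>\<in>set [Box (ODE F TT) (Not (Not (nf_fml P))), Not (Prog F P)]. v \<psi>"
    interpret valuation v by fact
    have "der [Not (Not (nf_fml P))] (nf_fml P)" by (rule der_fol) auto
    then have "v (Box (ODE F TT) (nf_fml P))" by (rule box_mono) (use v(2) in simp)
    then show "v FF" using v(2) by (intro v_der[OF d]) auto
  qed
  then show ?thesis
  proof (intro derI)
    fix v assume d: "der [Box (ODE F TT) (Not (Not (nf_fml P))), Not (Prog F P)] FF"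
      and v: "valuation v" "\<forall>\<psi>\<in>set [Not (Prog F P)]. v \<psi>"
    interpret valuation v by fact
    show "v (Dia (ODE F TT) (Not (nf_fml P)))"
      using v_der[OF d] not_v_FF v(2) by (auto simp: dia_iff)
  qed
qed

section \<open>Invariants\<close>

context
  fixes xs :: "var list" and fs :: "trm list" and P N :: nform
  assumes dist: "distinct xs" and len: "length fs = length xs"
    and fs_vars: "\<forall>f\<in>set fs. pvars f \<subseteq> set xs"
    and compl: "valid (Iff (nf_fml N) (Not (nf_fml P)))"
begin

abbreviation (input) "sys \<equiv> zip xs fs"
abbreviation (input) "rev_sys \<equiv> zip xs (map uminus fs)"
abbreviation (input) "\<Phi> \<equiv> nf_fml P"
abbreviation (input) "fwd_progress \<equiv> Foralls xs (Imp \<Phi> (Prog sys P))"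
abbreviation (input) "bwd_progress \<equiv> Foralls xs (Imp (Not \<Phi>) (Prog rev_sys N))"
abbreviation (input) "invariant \<equiv> Foralls xs (Imp \<Phi> (Box (ODE sys TT) \<Phi>))"

lemma fsem_N: "\<omega> \<in> fsem (nf_fml N) \<longleftrightarrow> \<omega> \<notin> fsem \<Phi>"
  using compl by (simp add: valid_def)

lemma wf_F: "wf_ode sys" and wf_F_neg: "wf_ode rev_sys"
  using dist len by (simp_all add: wf_ode_zip)

lemma FVp_F: "FVp (ODE sys TT) = set xs" and FVp_F_neg: "FVp (ODE rev_sys TT) = set xs"
  using fs_vars len by (auto simp: FVp_zip simp del: FVp.simps)

lemma inv_imp_fwd: "der [invariant] fwd_progress"
proof (rule der_ForallsI)
  show "der [invariant] (Imp \<Phi> (Prog sys P))"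
  proof (rule derI)
    fix v assume v: "valuation v" "\<forall>\<psi>\<in>set [invariant]. v \<psi>"
    interpret valuation v by fact
    have invariant: "v (Imp \<Phi> (Box (ODE sys TT) \<Phi>))" by (rule v_ForallsE[of xs]) (use v(2) in simp)
    show "v (Imp \<Phi> (Prog sys P))"
    proof (rule ccontr)
      assume "\<not> v (Imp \<Phi> (Prog sys P))"
      then have "v (Box (ODE sys TT) \<Phi>)" "v (Not (Prog sys P))" using invariant by auto
      then have "v (Dia (ODE sys TT) (Not \<Phi>))" using v_der1[OF der_escape[OF wf_F]] by simp
      moreover have "der [\<Phi>] (Not (Not \<Phi>))" by (rule der_fol) auto
      then have "v (Box (ODE sys TT) (Not (Not \<Phi>)))"
        using \<open>v (Box (ODE sys TT) \<Phi>)\<close> by (rule box_mono)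
      ultimately show False by (simp add: dia_iff)
    qed
  qed
qed auto

text \<open>Name the start \<open>ws\<close> and the end \<open>ys\<close> of the backward run. Its
  reversal leads forward from \<open>ys\<close>, inside P, to \<open>ws\<close>, outside P. The
  quantified invariant is independent of the state and so can be applied at
  \<open>ys\<close>.\<close>

lemma inv_backward: "der [Dia (ODE rev_sys TT) \<Phi>, invariant, Not \<Phi>] FF"
proof -
  let ?S = "set xs \<union> FV \<Phi> \<union> FV invariant"
  have fin: "finite ?S" by (intro finite_UnI finite_FV finite_set)
  obtain ys where ys: "length ys = length xs" "distinct ys" "set ys \<inter> ?S = {}"
    using ex_fresh_vec[OF fin] by blast
  have fin': "finite (?S \<union> set ys)" using fin by simp
  obtain ws where ws: "length ws = length xs" "distinct ws" "set ws \<inter> (?S \<union> set ys) = {}"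
    using ex_fresh_vec[OF fin'] by blast
  \<comment> \<open>Free of \<open>xs\<close>, these formulas state membership of the two endpoints
    in P independently of the current state.\<close>
  let ?Py = "fsub \<Phi> (subvec xs ys)" and ?Pw = "fsub \<Phi> (subvec xs ws)"
  have FV_Py: "FV ?Py \<inter> set xs = {}" and FV_Pw: "FV ?Pw \<inter> set xs = {}"
    using FV_fsub_subvec[of \<Phi> xs ys] FV_fsub_subvec[of \<Phi> xs ws] ys ws by auto
  have fol: "is_fol ?Py" "is_fol ?Pw" by (simp_all add: qf_is_fol qf_fsub)
  have sem_y: "\<omega> \<in> fsem ?Py \<longleftrightarrow> \<omega> \<in> fsem \<Phi>" if "map \<omega> xs = map \<omega> ys" for \<omega>
    using that ys by (intro fsem_fsub_subvec) auto
  have sem_w: "\<omega> \<in> fsem ?Pw \<longleftrightarrow> \<omega> \<in> fsem \<Phi>" if "map \<omega> xs = map \<omega> ws" for \<omega>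
    using that ws by (intro fsem_fsub_subvec) auto
  have uminus_fs: "map uminus (map uminus fs) = fs" by (simp add: o_def)
  have "der (VecEq xs ws # Dia (ODE rev_sys TT) (VecEq xs ys) # [invariant, ?Py, Not ?Pw]) FF"
  proof (rule der_reverse)
    show "der (VecEq xs ys # Dia (ODE (zip xs (map uminus (map uminus fs))) TT) (VecEq xs ws)
        # [invariant, ?Py, Not ?Pw]) FF"
      unfolding uminus_fs
    proof (rule derI)
      fix v assume v: "valuation v"
        "\<forall>\<psi>\<in>set (VecEq xs ys # Dia (ODE sys TT) (VecEq xs ws) # [invariant, ?Py, Not ?Pw]). v \<psi>"
      interpret valuation v by fact
      have "v \<Phi>"
        using v(2) fol sem_y ys by - (rule v_fol[of _ "[VecEq xs ys, ?Py]"], auto)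
      moreover have "v (Imp \<Phi> (Box (ODE sys TT) \<Phi>))" by (rule v_ForallsE[of xs]) (use v(2) in simp)
      ultimately have b: "v (Box (ODE sys TT) \<Phi>)" by simp
      have "der [VecEq xs ws, \<Phi>] ?Pw" by (rule der_fol) (use fol sem_w ws in auto)
      then have "v (Dia (ODE sys TT) ?Pw)" by (rule dia_der) (use b v(2) in auto)
      then have "v ?Pw" by (rule dia_const[rotated]) (use FV_Pw len in \<open>simp add: ode_vars_zip\<close>)
      then show "v FF" using v(2) by simp
    qed
    show "(set ys \<union> set ws) \<inter> FVp (ODE rev_sys TT) = {}"
      unfolding FVp_F_neg using ys ws by auto
    show "set xs \<inter> (FVs [invariant, ?Py, Not ?Pw] \<union> FV FF) = {}" using FV_Py FV_Pw by auto
  qed (use dist len ys ws in auto)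
  note rev = this
  have wit: "der [Dia (ODE rev_sys TT) (And \<Phi> (VecEq xs ys)), invariant, Not \<Phi>] FF"
  proof (rule der_fresh_vec[of ws xs])
    show "der [VecEq ws xs, Dia (ODE rev_sys TT) (And \<Phi> (VecEq xs ys)), invariant, Not \<Phi>] FF"
    proof (rule derI)
      fix v assume v: "valuation v"
        "\<forall>\<psi>\<in>set [VecEq ws xs, Dia (ODE rev_sys TT) (And \<Phi> (VecEq xs ys)), invariant, Not \<Phi>]. v \<psi>"
      interpret valuation v by fact
      have "v (VecEq xs ws)" using v(2) ws by - (rule v_fol[of _ "[VecEq ws xs]"], auto)
      moreover have "v (Not ?Pw)"
        using v(2) fol sem_w ws by - (rule v_fol[of _ "[VecEq ws xs, Not \<Phi>]"], auto)
      moreover have "der [And \<Phi> (VecEq xs ys)] ?Py" by (rule der_fol) (use fol sem_y ys in auto)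
      then have "v (Dia (ODE rev_sys TT) ?Py)" using v(2) by - (rule dia_mono, auto)
      then have "v ?Py" by (rule dia_const[rotated]) (use FV_Py len in \<open>simp add: ode_vars_zip\<close>)
      moreover have "der [And \<Phi> (VecEq xs ys)] (VecEq xs ys)" by (rule derI) (simp add: valuation.v_And)
      then have "v (Dia (ODE rev_sys TT) (VecEq xs ys))" using v(2) by - (rule dia_mono, auto)
      ultimately show "v FF" using v(2) by - (rule v_der[OF rev], auto)
    qed
    have "FV (Dia (ODE rev_sys TT) (And \<Phi> (VecEq xs ys))) \<subseteq> FVp (ODE rev_sys TT) \<union> FV \<Phi> \<union> set xs \<union> set ys"
      using FV_VecEq[of xs ys] by auto
    then show "set ws \<inter> (set xs \<union> FVs [Dia (ODE rev_sys TT) (And \<Phi> (VecEq xs ys)), invariant, Not \<Phi>] \<union> FV FF) = {}"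
      using ws unfolding FVp_F_neg by (auto simp del: FV.simps(12))
  qed (use ws in auto)
  show ?thesis
  proof (rule der_Dia_witness[OF wf_F_neg _ _ _ wit])
    show "set ys \<inter> (FVp (ODE rev_sys TT) \<union> FV \<Phi> \<union> set xs \<union> FVs [invariant, Not \<Phi>] \<union> FV FF) = {}"
      unfolding FVp_F_neg using ys by auto
  qed (use ys in auto)
qed

lemma inv_imp_bwd: "der [invariant] bwd_progress"
proof (rule der_ForallsI)
  show "der [invariant] (Imp (Not \<Phi>) (Prog rev_sys N))"
  proof (rule derI)
    fix v assume v: "valuation v" "\<forall>\<psi>\<in>set [invariant]. v \<psi>"
    interpret valuation v by fact
    show "v (Imp (Not \<Phi>) (Prog rev_sys N))"
    proof (rule ccontr)
      assume neg: "\<not> v (Imp (Not \<Phi>) (Prog rev_sys N))"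
      then have "v (Dia (ODE rev_sys TT) (Not (nf_fml N)))"
        using v_der1[OF der_escape[OF wf_F_neg]] by simp
      moreover have "der [Not (nf_fml N)] \<Phi>" by (rule der_fol) (use fsem_N in auto)
      ultimately have "v (Dia (ODE rev_sys TT) \<Phi>)" by - (rule dia_mono)
      then have "v FF" using v_der[OF inv_backward] v(2) neg by auto
      then show False using not_v_FF by blast
    qed
  qed
qed auto

text \<open>Roles of the vectors: \<open>X\<close> is \<open>xs\<close> with the clocks,
  \<open>ys\<close> is the vector of (RI), \<open>ws\<close> holds the start of a run, and
  \<open>zs\<close> is a copy of \<open>ys\<close>. The quantified progress conditions have no
  member of \<open>X\<close> free and hold at every state of a run.\<close>

lemma progress_imp_inv: "der [fwd_progress, bwd_progress] invariant"
proof -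
  let ?S = "set xs \<union> FV \<Phi> \<union> FV (nf_fml N) \<union> FV fwd_progress \<union> FV bwd_progress"
  have fin: "finite ?S" by (intro finite_UnI finite_FV finite_set)
  obtain ts where ts: "length ts = 2" "distinct ts" "set ts \<inter> ?S = {}"
    using ex_fresh_vec[OF fin] by blast
  then obtain t s where t_s: "ts = [t, s]" by (auto simp: length_Suc_conv numeral_2_eq_2)
  have ts_disj: "t \<noteq> s" "{t, s} \<inter> ?S = {}" using ts t_s by auto
  define X where "X = xs @ [t, s]"
  define fX where "fX = fs @ [1, - 1]"
  define F2 where "F2 = zip X fX"
  define G2 where "G2 = zip X (map uminus fX)"
  have X: "distinct X" "length fX = length X" using dist len ts_disj by (auto simp: X_def fX_def)
  have F2: "F2 = sys @ [(t, 1), (s, - 1)]" and G2: "G2 = rev_sys @ [(t, - 1), (s, 1)]"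
    using len by (simp_all add: F2_def G2_def X_def fX_def)
  have wf2: "wf_ode F2" "wf_ode G2" using X by (simp_all add: F2_def G2_def wf_ode_zip)
  have fX_vars: "(\<Union>f\<in>set fX. pvars f) \<subseteq> set X" using fs_vars by (auto simp: fX_def X_def)
  have FVp2: "FVp (ODE F2 Q) = set X \<union> FV Q" "FVp (ODE G2 Q) = set X \<union> FV Q" for Q
    using fX_vars X(2) by (auto simp: FVp_zip F2_def G2_def simp del: FVp.simps)
  have BV2: "BV (ODE F2 Q) = set X" "BV (ODE G2 Q) = set X" for Q
    using X(2) unfolding F2_def G2_def by (simp_all add: BV_zip del: BV.simps)
  have clock2: "has_clock F2" "has_clock G2" by (auto simp: F2 G2 has_clock_def)
  have fst2: "X = map fst F2" "X = map fst G2" using X(2) by (simp_all add: F2_def G2_def)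
  interpret F2: clocked_ode F2 X by unfold_locales (fact wf2 clock2 fst2)+
  interpret G2: clocked_ode G2 X by unfold_locales (fact wf2 clock2 fst2)+
  have rhs: "(\<Union>(x, f)\<in>set sys. pvars f) \<subseteq> set xs" "(\<Union>(x, f)\<in>set rev_sys. pvars f) \<subseteq> set xs"
    unfolding FVp_F[symmetric] using FVp_F FVp_F_neg by auto
  have agree_F: "lie_pow F2 i p = lie_pow sys i p" if "p \<in> nf_polys P" for p i
    unfolding F2 by (rule lie_pow_clocks) (use ts_disj rhs that in \<open>auto simp: FV_nf_fml\<close>)
  have agree_G: "lie_pow G2 i p = lie_pow rev_sys i p" if "p \<in> nf_polys N" for p i
    unfolding G2 by (rule lie_pow_clocks) (use ts_disj rhs that in \<open>auto simp: FV_nf_fml\<close>)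
  let ?T = "set X \<union> FV \<Phi> \<union> FV (nf_fml N) \<union> FV fwd_progress \<union> FV bwd_progress"
  have finT: "finite ?T" by (intro finite_UnI finite_FV finite_set)
  obtain ys where ys: "length ys = length X" "distinct ys" "set ys \<inter> ?T = {}"
    using ex_fresh_vec[OF finT] by blast
  have finT': "finite (?T \<union> set ys)" using finT by simp
  obtain zs where zs: "length zs = length X" "distinct zs" "set zs \<inter> (?T \<union> set ys) = {}"
    using ex_fresh_vec[OF finT'] by blast
  have finT'': "finite (?T \<union> set ys \<union> set zs)" using finT' by simp
  obtain ws where ws: "length ws = length X" "distinct ws" "set ws \<inter> (?T \<union> set ys \<union> set zs) = {}"
    using ex_fresh_vec[OF finT''] by blast
  have lX: "length F2 = length X" "length G2 = length X" using X(2) by (simp_all add: F2_def G2_def)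
  have fresh_ys: "F2.fresh ys (FV \<Phi>)" and fresh_zs: "G2.fresh zs (FV (nf_fml N))"
    using ys zs lX by (auto simp: F2.fresh_def G2.fresh_def FVp2 simp del: FVp.simps)
  have FV_fwd_bwd: "FV fwd_progress \<inter> set X = {}" "FV bwd_progress \<inter> set X = {}"
    using ts_disj by (auto simp: X_def)
  let ?E = "VecEq X ys" and ?Ez = "VecEq X zs"
  let ?Py = "fsub \<Phi> (subvec X ys)" and ?Pw = "fsub \<Phi> (subvec X ws)"
  have FV_Py: "FV ?Py \<inter> set X = {}" and FV_Pw: "FV ?Pw \<inter> set X = {}"
    using FV_fsub_subvec[of \<Phi> X ys] FV_fsub_subvec[of \<Phi> X ws] ys ws by auto
  have fol: "is_fol ?Py" "is_fol ?Pw" by (simp_all add: qf_is_fol qf_fsub)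
  have sem_y: "\<omega> \<in> fsem ?Py \<longleftrightarrow> \<omega> \<in> fsem \<Phi>" if "map \<omega> X = map \<omega> ys" for \<omega>
    using that ys by (intro fsem_fsub_subvec) auto
  have sem_w: "\<omega> \<in> fsem ?Pw \<longleftrightarrow> \<omega> \<in> fsem \<Phi>" if "map \<omega> X = map \<omega> ws" for \<omega>
    using that ws by (intro fsem_fsub_subvec) auto
  have step: "der [fwd_progress] (Imp (And ?E \<Phi>) (Dia (ODE F2 \<Phi>) (Not ?E)))"
  proof (rule derI)
    fix v assume v: "valuation v" "\<forall>\<psi>\<in>set [fwd_progress]. v \<psi>"
    interpret valuation v by fact
    have fwd_progress: "v (Imp \<Phi> (Prog sys P))" by (rule v_ForallsE[of xs]) (use v(2) in simp)
    have "v (Dia (ODE F2 \<Phi>) (Not ?E))" if "v (And ?E \<Phi>)"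
    proof -
      have d: "v (Dia (ODE F2 (Or \<Phi> ?E)) (Not ?E))"
        using that fwd_progress F2.local_progressD[OF v(1) F2.local_progress_Prog[OF fresh_ys agree_F]] by simp
      have "v ?Py" using that fol sem_y ys by - (rule v_fol[of _ "[And ?E \<Phi>]"], auto)
      then have "v (Box (ODE F2 (Or \<Phi> ?E)) ?Py)"
        using FV_Py by (intro box_const) (auto simp: BV2 simp del: BV.simps)
      moreover have "der [Or \<Phi> ?E, ?Py] \<Phi>" by (rule der_fol) (use fol sem_y ys in auto)
      ultimately have "v (Box (ODE F2 (Or \<Phi> ?E)) \<Phi>)"
        using box_domain[OF wf2(1), of "Or \<Phi> ?E"] by - (rule box_der[of "[Or \<Phi> ?E, ?Py]"], auto)
      then show ?thesis using d dia_refine wf2(1) by blast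
    qed
    then show "v (Imp (And ?E \<Phi>) (Dia (ODE F2 \<Phi>) (Not ?E)))" by simp
  qed
  \<comment> \<open>\<open>der_reverse\<close> needs a domain free of its target vector
    \<open>ys\<close>, hence the copy \<open>zs\<close>.\<close>
  let ?D = "Or \<Phi> ?Ez"
  let ?\<Gamma> = "[bwd_progress, VecEq zs ys, Not ?Py, ?Pw]"
  have rev: "der (VecEq X ws # Dia (ODE (zip X fX) ?D) ?E # ?\<Gamma>) FF"
  proof (rule der_reverse)
    show "der (?E # Dia (ODE (zip X (map uminus fX)) ?D) (VecEq X ws) # ?\<Gamma>) FF"
      unfolding G2_def[symmetric]
    proof (rule derI)
      fix v assume v: "valuation v" "\<forall>\<psi>\<in>set (?E # Dia (ODE G2 ?D) (VecEq X ws) # ?\<Gamma>). v \<psi>"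
      interpret valuation v by fact
      have bwd_progress: "v (Imp (Not \<Phi>) (Prog rev_sys N))" by (rule v_ForallsE[of xs]) (use v(2) in simp)
      have "v (Not \<Phi>)" using v(2) fol sem_y ys by - (rule v_fol[of _ "[?E, Not ?Py]"], auto)
      moreover have "v ?Ez" using v(2) ys zs by - (rule v_fol[of _ "[?E, VecEq zs ys]"], auto)
      ultimately have d1: "v (Dia (ODE G2 (Or (nf_fml N) ?Ez)) (Not ?Ez))"
        using bwd_progress G2.local_progressD[OF v(1) G2.local_progress_Prog[OF fresh_zs agree_G]] by simp
      have c: "v (Box (ODE G2 ?D) \<psi>)" if "\<psi> \<in> {VecEq zs ys, Not ?Py, ?Pw}" for \<psi>
      proof (rule box_const)
        show "FV \<psi> \<inter> BV (ODE G2 ?D) = {}"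
          using that FV_Py FV_Pw FV_VecEq[of zs ys] ys zs by (auto simp: BV2 simp del: BV.simps)
        show "v \<psi>" using v(2) that by auto
      qed
      \<comment> \<open>The backward run ends at \<open>ws\<close>, inside P, whereas
        \<open>zs\<close> equals \<open>ys\<close>, outside P.\<close>
      have "der [VecEq X ws, VecEq zs ys, Not ?Py, ?Pw] (Not ?Ez)"
      proof (rule der_fol)
        fix \<omega> assume "\<forall>\<psi>\<in>set [VecEq X ws, VecEq zs ys, Not ?Py, ?Pw]. \<omega> \<in> fsem \<psi>"
        then have "map \<omega> X = map \<omega> ws" "map \<omega> zs = map \<omega> ys" "\<omega> \<notin> fsem ?Py" "\<omega> \<in> fsem ?Pw"
          using ys zs ws by auto
        then have "map \<omega> X \<noteq> map \<omega> zs" using sem_y sem_w by metis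
        then show "\<omega> \<in> fsem (Not ?Ez)" using zs by simp
      qed (use fol in auto)
      then have d2: "v (Dia (ODE G2 ?D) (Not ?Ez))"
        using v(2) c by - (rule dia_der[of "VecEq X ws" "[VecEq zs ys, Not ?Py, ?Pw]"], auto)
      let ?DD = "And ?D (Or (nf_fml N) ?Ez)"
      have "v (Dia (ODE G2 ?DD) (Or (Not ?Ez) (Not ?Ez)))"
        using v_axiom1[OF Uniq[OF wf2(2)]] d1 d2 by simp
      \<comment> \<open>Away from \<open>zs\<close> the combined domain demands both P and its
        complement.\<close>
      moreover have "der [Or (Not ?Ez) (Not ?Ez), ?DD] FF"
        by (rule der_fol) (use zs fsem_N in auto)
      ultimately have "v (Dia (ODE G2 ?DD) FF)"
        using box_domain[OF wf2(2), of ?DD]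
        by - (rule dia_der[of "Or (Not ?Ez) (Not ?Ez)" "[?DD]"], auto)
      then show "v FF" by (rule dia_const[rotated]) simp
    qed
    have "FV ?D \<subseteq> FV \<Phi> \<union> set X \<union> set zs" using FV_VecEq[of X zs] by auto
    then show "(set ys \<union> set ws) \<inter> FVp (ODE (zip X fX) ?D) = {}"
      using FVp2(1) ys zs ws unfolding F2_def by blast
    show "set X \<inter> (FVs ?\<Gamma> \<union> FV FF) = {}"
      using FV_Py FV_Pw FV_fwd_bwd FV_VecEq[of zs ys] ys zs by auto
  qed (use X ys zs ws in auto)
  have closed: "der [bwd_progress, \<Phi>] (Box (ODE F2 (Or \<Phi> ?E)) (Imp ?E \<Phi>))"
  proof -
    let ?A = "Dia (ODE F2 (Or \<Phi> ?E)) (And ?E (Not \<Phi>))"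
    have FV_A: "FV ?A \<subseteq> set X \<union> FV \<Phi> \<union> set ys"
      using FVp2(1)[of "Or \<Phi> ?E"] FV_VecEq[of X ys] by auto
    \<comment> \<open>Recording the start in \<open>ws\<close> and copying \<open>ys\<close> to
      \<open>zs\<close> brings a run that ends at \<open>ys\<close> outside P into the form refuted
      by \<open>rev\<close>.\<close>
    have "der [VecEq ws X, VecEq zs ys, ?A, bwd_progress, \<Phi>] FF"
    proof (rule derI)
      fix v assume v: "valuation v" "\<forall>\<psi>\<in>set [VecEq ws X, VecEq zs ys, ?A, bwd_progress, \<Phi>]. v \<psi>"
      interpret valuation v by fact
      have xw: "v (VecEq X ws)" using v(2) ws by - (rule v_fol[of _ "[VecEq ws X]"], auto)
      have pw: "v ?Pw" using v(2) fol sem_w ws by - (rule v_fol[of _ "[VecEq ws X, \<Phi>]"], auto)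
      have "der [And ?E (Not \<Phi>)] (Not ?Py)" by (rule der_fol) (use fol sem_y ys in auto)
      then have "v (Dia (ODE F2 (Or \<Phi> ?E)) (Not ?Py))" using v(2) by - (rule dia_mono, auto)
      then have py: "v (Not ?Py)"
        by (rule dia_const[rotated]) (use FV_Py in \<open>simp add: BV2 del: BV.simps\<close>)
      have "der [And ?E (Not \<Phi>)] ?E" by (rule derI) (simp add: valuation.v_And)
      then have dE: "v (Dia (ODE F2 (Or \<Phi> ?E)) ?E)" using v(2) by - (rule dia_mono, auto)
      have "v (Box (ODE F2 (Or \<Phi> ?E)) (VecEq zs ys))"
        using v(2) FV_VecEq[of zs ys] ys zs by (intro box_const) (auto simp: BV2 simp del: BV.simps)
      moreover have "der [Or \<Phi> ?E, VecEq zs ys] ?D" by (rule der_fol) (use ys zs in auto)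
      ultimately have "v (Box (ODE F2 (Or \<Phi> ?E)) ?D)"
        using box_domain[OF wf2(1), of "Or \<Phi> ?E"]
        by - (rule box_der[of "[Or \<Phi> ?E, VecEq zs ys]"], auto)
      then have "v (Dia (ODE F2 ?D) ?E)" using dE dia_refine wf2(1) by blast
      then show "v FF"
        using v(2) xw pw py by - (rule v_der[OF rev], auto simp: F2_def)
    qed
    then have "der [VecEq zs ys, ?A, bwd_progress, \<Phi>] FF"
      using ws ys zs FV_A FV_VecEq[of zs ys]
      by - (rule der_fresh_vec[of ws X], auto simp del: FV.simps(12) simp: Int_Un_distrib)
    then have d: "der [?A, bwd_progress, \<Phi>] FF"
      using ys zs FV_A by - (rule der_fresh_vec[of zs ys], auto simp del: FV.simps(12))
    show ?thesis
    proof (rule derI)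
      fix v assume v: "valuation v" "\<forall>\<psi>\<in>set [bwd_progress, \<Phi>]. v \<psi>"
      interpret valuation v by fact
      have "\<not> v ?A" using v_der[OF d] v(2) not_v_FF by auto
      then have "v (Box (ODE F2 (Or \<Phi> ?E)) (Not (And ?E (Not \<Phi>))))" by (simp add: dia_iff)
      moreover have "der [Not (And ?E (Not \<Phi>))] (Imp ?E \<Phi>)" by (rule der_fol) auto
      ultimately show "v (Box (ODE F2 (Or \<Phi> ?E)) (Imp ?E \<Phi>))" by - (rule box_mono)
    qed
  qed
  let ?RI = "Box (ODE F2 (Or \<Phi> ?E)) (Imp ?E (And \<Phi> (Dia (ODE F2 \<Phi>) (Not ?E))))"
  have "der [fwd_progress, bwd_progress, \<Phi>] (Foralls ys ?RI)"
  proof (rule der_ForallsI)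
    show "der [fwd_progress, bwd_progress, \<Phi>] ?RI"
    proof (rule derI)
      fix v assume v: "valuation v" "\<forall>\<psi>\<in>set [fwd_progress, bwd_progress, \<Phi>]. v \<psi>"
      interpret valuation v by fact
      have "v (Box (ODE F2 (Or \<Phi> ?E)) (Imp ?E \<Phi>))"
        using v(2) by - (rule v_der[OF closed], auto)
      \<comment> \<open>The local progress in (RI) is required inside a box, so the forward
        condition is first carried to the states reached.\<close>
      moreover have "v (Box (ODE F2 (Or \<Phi> ?E)) fwd_progress)"
        using v(2) FV_fwd_bwd by - (rule box_const, auto simp: BV2 simp del: BV.simps FV_Foralls)
      then have "v (Box (ODE F2 (Or \<Phi> ?E)) (Imp (And ?E \<Phi>) (Dia (ODE F2 \<Phi>) (Not ?E))))"
        by (rule box_mono[OF step])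
      moreover have "der [Imp ?E \<Phi>, Imp (And ?E \<Phi>) (Dia (ODE F2 \<Phi>) (Not ?E))]
          (Imp ?E (And \<Phi> (Dia (ODE F2 \<Phi>) (Not ?E))))"
        by (rule derI) (auto simp: valuation.v_And valuation.v_Imp)
      ultimately show "v ?RI"
        by - (rule box_der[of "[Imp ?E \<Phi>, Imp (And ?E \<Phi>) (Dia (ODE F2 \<Phi>) (Not ?E))]"], auto)
    qed
    show "set ys \<inter> FVs [fwd_progress, bwd_progress, \<Phi>] = {}" using ys by auto
  qed
  note RI_prem = this
  show ?thesis
  proof (rule der_ForallsI)
    show "der [fwd_progress, bwd_progress] (Imp \<Phi> (Box (ODE sys TT) \<Phi>))"
    proof (rule derI)
      fix v assume v: "valuation v" "\<forall>\<psi>\<in>set [fwd_progress, bwd_progress]. v \<psi>"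
      interpret valuation v by fact
      have "v (Box (ODE sys TT) \<Phi>)" if "v \<Phi>"
      proof (rule clocksI[OF wf_F ts_disj(1) _ v(1)])
        have "v (Foralls ys ?RI)" using v(2) that by - (rule v_der[OF RI_prem], auto)
        moreover have "X = map fst F2" using X(2) by (simp add: F2_def)
        moreover have "fresh_vec ys F2 \<Phi>"
          using ys lX by (auto simp: fresh_vec_def FVp2 simp del: FVp.simps)
        ultimately have "v (Box (ODE F2 TT) \<Phi>)"
          using v_axiom1[OF RI[OF wf2(1) F2.clock]] by simp
        then show "v (Box (ODE (add_clocks sys t s) TT) \<Phi>)" by (simp add: add_clocks_def F2)
        show "{t, s} \<inter> (FVp (ODE sys TT) \<union> FV \<Phi>) = {}" unfolding FVp_F using ts_disj by auto
      qed
      then show "v (Imp \<Phi> (Box (ODE sys TT) \<Phi>))" by simp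
    qed
  qed auto
qed

end

theorem theorem17:
  fixes xs :: "var list" and fs :: "trm list" and P N :: nform
  assumes "xs \<noteq> []" and "distinct xs" and "length fs = length xs"
    and "\<forall>f\<in>set fs. pvars f \<subseteq> set xs"
    and "valid (Iff (nf_fml N) (Not (nf_fml P)))"
  shows "derivable_C1
    (Iff (And (Foralls xs (Imp (nf_fml P) (Prog (zip xs fs) P)))
              (Foralls xs (Imp (Not (nf_fml P)) (Prog (zip xs (map uminus fs)) N))))
         (Foralls xs (Imp (nf_fml P) (Box (ODE (zip xs fs) TT) (nf_fml P)))))"
  unfolding derivable_C1_def
proof (intro IffR)
  note fwd = inv_imp_fwd[OF assms(2-5)] and bwd = inv_imp_bwd[OF assms(2-5)]
  note invar = progress_imp_inv[OF assms(2-5)]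
  show "der [And (Foralls xs (Imp (nf_fml P) (Prog (zip xs fs) P)))
              (Foralls xs (Imp (Not (nf_fml P)) (Prog (zip xs (map uminus fs)) N)))]
         (Foralls xs (Imp (nf_fml P) (Box (ODE (zip xs fs) TT) (nf_fml P))))"
    by (rule AndL[OF invar])
  show "der [Foralls xs (Imp (nf_fml P) (Box (ODE (zip xs fs) TT) (nf_fml P)))]
      (And (Foralls xs (Imp (nf_fml P) (Prog (zip xs fs) P)))
              (Foralls xs (Imp (Not (nf_fml P)) (Prog (zip xs (map uminus fs)) N))))"
    by (rule AndR[OF fwd bwd])
qed

end
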